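(* Let $n\ge2$, $\gamma\in(n,\infty)$, $1<p<\infty$, let $\Omega_\gamma\subset\mathbb{R}^n$ be the outward $\gamma$-cuspidal domain and let $w:\partial\Omega_\gamma\to\mathbb{R}$ be the associated weight (both defined in the context). Then there exists a constant $C=C(\Omega_\gamma,p,w)>0$ such that $$\|u\|_{L^p(\Omega_\gamma)}\le C\,\|\nabla u\|_{L^p(\Omega_\gamma)}$$ for all $u\in W^{1,p}(\Omega_\gamma)$ satisfying the condition $$\int_{\partial\Omega_\gamma}|u|^{p-2}u\,w\,ds=0.$$
   Context: Domain: let $n\ge2$, $\gamma\in(n,\infty)$, $\alpha=(\gamma-1)/(n-1)$, and $g(t)=t^\alpha$ for $t\ge0$. Write $x=(x',x_n)$ with $x'=(x_1,\dots,x_{n-1})\in\mathbb{R}^{n-1}$ and $|x'|=\sqrt{x_1^2+\dots+x_{n-1}^2}$. The outward $\gamma$-cuspidal domain is $$\Omega_\gamma=\{(x',x_n)\in\mathbb{R}^{n-1}\times\mathbb{R}: |x'|<g(x_n),\ 0<x_n\le 1\}\cup B^n((0,2),\sqrt2),$$ where $B^n((0,2),\sqrt2)$ is the open ball of radius $\sqrt2$ centered at $(0,2)\in\mathbb{R}^{n-1}\times\mathbb{R}$. Weight: $w:\partial\Omega_\gamma\to\mathbb{R}$ is the continuous function with $w(x',x_n)=g(x_n)$ if $g(x_n)<1$ and $w(x',x_n)=1$ if $g(x_n)\ge1$, i.e. $w=\min\{g(x_n),1\}$. Spaces: $W^{1,p}(\Omega_\gamma)$ is the real Sobolev space with norm $\|u\|_{W^{1,p}(\Omega_\gamma)}=\left(\int_{\Omega_\gamma}|\nabla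 u|^p\,dx+\int_{\Omega_\gamma}|u|^p\,dx\right)^{1/p}$. Here $ds$ is the $(n-1)$-dimensional surface measure on $\partial\Omega_\gamma$. Values of a Sobolev function on $\partial\Omega_\gamma$ are understood in the sense of traces (the boundary is Lipschitz near every point other than the cusp tip $0$, so the trace is defined $ds$-almost everywhere). The expression $|\xi|^{p-2}\xi$ is read as $0$ when $\xi=0$. *)

theory Defs
  imports "HOL-Analysis.Analysis"
begin

section \<open>Smooth functions\<close>

primrec Ck :: "nat \<Rightarrow> ('a::euclidean_space \<Rightarrow> real) \<Rightarrow> bool" where
  "Ck 0 f \<longleftrightarrow> continuous_on UNIV f"
| "Ck (Suc k) f \<longleftrightarrow>
     (\<forall>x. f differentiable (at x)) \<and> (\<forall>b\<in>Basis. Ck k (\<lambda>x. frechet_derivative f (at x) b))"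

definition smooth :: "('a::euclidean_space \<Rightarrow> real) \<Rightarrow> bool" where
  "smooth f \<longleftrightarrow> (\<forall>k. Ck k f)"

definition gradient :: "('a::euclidean_space \<Rightarrow> real) \<Rightarrow> 'a \<Rightarrow> 'a" where
  "gradient f x = (\<Sum>b\<in>Basis. frechet_derivative f (at x) b *\<^sub>R b)"

definition test_function :: "'a::euclidean_space set \<Rightarrow> ('a \<Rightarrow> real) \<Rightarrow> bool" where
  "test_function \<Omega> \<phi> \<longleftrightarrow>
     smooth \<phi> \<and> compact (closure {x. \<phi> x \<noteq> 0}) \<and> closure {x. \<phi> x \<noteq> 0} \<subseteq> \<Omega>"


section \<open>Lebesgue and Sobolev spaces\<close>

definition Lp :: "real \<Rightarrow> 'a::euclidean_space set \<Rightarrow> ('a \<Rightarrow> 'b::real_normed_vector) set" where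
  "Lp p \<Omega> = {f. f \<in> borel_measurable (lebesgue_on \<Omega>)
                \<and> integrable (lebesgue_on \<Omega>) (\<lambda>x. norm (f x) powr p)}"

definition Lp_norm :: "real \<Rightarrow> 'a::euclidean_space set \<Rightarrow> ('a \<Rightarrow> 'b::real_normed_vector) \<Rightarrow> real" where
  "Lp_norm p \<Omega> f = (LINT x|lebesgue_on \<Omega>. norm (f x) powr p) powr (1 / p)"

definition locally_integrable ::
    "'a::euclidean_space set \<Rightarrow> ('a \<Rightarrow> 'b::euclidean_space) \<Rightarrow> bool" where
  "locally_integrable \<Omega> f \<longleftrightarrow> (\<forall>K. compact K \<and> K \<subseteq> \<Omega> \<longrightarrow> integrable (lebesgue_on K) f)"

definition is_weak_gradient ::
    "'a::euclidean_space set \<Rightarrow> ('a \<Rightarrow> real) \<Rightarrow> ('a \<Rightarrow> 'a) \<Rightarrow> bool" where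
  "is_weak_gradient \<Omega> u G \<longleftrightarrow>
     locally_integrable \<Omega> u \<and> locally_integrable \<Omega> G \<and>
     (\<forall>\<phi>. test_function \<Omega> \<phi> \<longrightarrow>
        (LINT x|lebesgue_on \<Omega>. u x *\<^sub>R gradient \<phi> x) = - (LINT x|lebesgue_on \<Omega>. \<phi> x *\<^sub>R G x))"

text \<open>A weak gradient on an open set is unique up to a Lebesgue null set; the choice below only
  selects a representative.\<close>

definition weak_grad :: "'a::euclidean_space set \<Rightarrow> ('a \<Rightarrow> real) \<Rightarrow> 'a \<Rightarrow> 'a" where
  "weak_grad \<Omega> u = (SOME G. is_weak_gradient \<Omega> u G)"

definition W1p :: "real \<Rightarrow> 'a::euclidean_space set \<Rightarrow> ('a \<Rightarrow> real) set" where
  "W1p p \<Omega> = {u. u \<in> Lp p \<Omega> \<and> (\<exists>G. is_weak_gradient \<Omega> u G) \<and> weak_grad \<Omega> u \<in> Lp p \<Omega>}"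


section \<open>Surface measure\<close>

text \<open>The \<open>d\<close>-dimensional Hausdorff measure, normalised so that on \<open>d\<close>-dimensional Lipschitz
  surfaces it is the usual surface area. Boundedness of the covering sets is required explicitly
  because \<^const>\<open>diameter\<close> is unspecified on unbounded sets, and the empty set is given size
  \<open>0\<close> so that finite covers are allowed also for \<open>d = 0\<close>.\<close>

definition hausdorff_size :: "nat \<Rightarrow> 'a::metric_space set \<Rightarrow> ennreal" where
  "hausdorff_size d U =
     (if U = {} then 0 else ennreal (unit_ball_vol (real d) * (diameter U / 2) ^ d))"

definition hausdorff_pre :: "nat \<Rightarrow> real \<Rightarrow> 'a::metric_space set \<Rightarrow> ennreal" where
  "hausdorff_pre d \<delta> A =
     (INF U\<in>{U::nat \<Rightarrow> 'a set. A \<subseteq> (\<Union>i. U i) \<and> (\<forall>i. bounded (U i) \<and> diameter (U i) \<le> \<delta>)}.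
        \<Sum>i. hausdorff_size d (U i))"

definition hausdorff_outer :: "nat \<Rightarrow> 'a::metric_space set \<Rightarrow> ennreal" where
  "hausdorff_outer d A = (SUP \<delta>\<in>{0<..}. hausdorff_pre d \<delta> A)"

text \<open>The outer measure above is a metric outer measure, hence countably additive on the Borel
  sets by Caratheodory's criterion, so \<^const>\<open>measure_of\<close> does not fall back to the zero
  measure.\<close>

definition hausdorff_measure :: "nat \<Rightarrow> 'a::metric_space measure" where
  "hausdorff_measure d = measure_of UNIV (sets borel) (hausdorff_outer d)"

definition surface_measure :: "'a::euclidean_space set \<Rightarrow> 'a measure" where
  "surface_measure \<Omega> = restrict_space (hausdorff_measure (DIM('a) - 1)) (frontier \<Omega>)"


section \<open>Traces\<close>

text \<open>\<open>\<tau>\<close> is a trace of \<open>u \<in> W\<^sup>1\<^sup>,\<^sup>p(\<Omega>)\<close> on \<open>\<partial>\<Omega>\<close>, where the boundary is Lipschitz near every point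
  other than \<open>z\<close>: away from each neighbourhood of \<open>z\<close>, the function \<open>u\<close> is the \<open>W\<^sup>1\<^sup>,\<^sup>p\<close> limit of
  functions smooth up to the boundary whose boundary values converge to \<open>\<tau>\<close> in \<open>L\<^sup>p\<close> with
  respect to surface measure. Such a \<open>\<tau>\<close> exists and is unique almost everywhere; no integrability
  up to \<open>z\<close> is imposed on it.\<close>

definition is_trace_off ::
    "'a::euclidean_space \<Rightarrow> real \<Rightarrow> 'a set \<Rightarrow> ('a \<Rightarrow> real) \<Rightarrow> ('a \<Rightarrow> real) \<Rightarrow> bool" where
  "is_trace_off z p \<Omega> u \<tau> \<longleftrightarrow>
     \<tau> \<in> borel_measurable (surface_measure \<Omega>) \<and>
     (\<forall>\<epsilon>>0. \<exists>\<phi>::nat \<Rightarrow> 'a \<Rightarrow> real.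
        (\<forall>k. smooth (\<phi> k)) \<and>
        (\<lambda>k. \<integral>\<^sup>+x. ennreal (\<bar>\<phi> k x - u x\<bar> powr p + norm (gradient (\<phi> k) x - weak_grad \<Omega> u x) powr p)
               \<partial>lebesgue_on (\<Omega> - ball z \<epsilon>)) \<longlonglongrightarrow> 0 \<and>
        (\<lambda>k. \<integral>\<^sup>+x\<in>frontier \<Omega> - ball z \<epsilon>. ennreal (\<bar>\<phi> k x - \<tau> x\<bar> powr p) \<partial>surface_measure \<Omega>)
          \<longlonglongrightarrow> 0)"


section \<open>The cuspidal domain and its weight\<close>

text \<open>Points of \<open>n\<close>-dimensional space are pairs \<open>(x', x\<^sub>n)\<close> with \<open>x' :: real ^ 'm\<close>, so that
  \<open>n = CARD('m) + 1\<close>; the norm on the product type is the Euclidean one.\<close>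

definition cusp_profile :: "nat \<Rightarrow> real \<Rightarrow> real \<Rightarrow> real" where
  "cusp_profile n \<gamma> t = t powr ((\<gamma> - 1) / (real n - 1))"

definition cusp_domain :: "real \<Rightarrow> ((real ^ 'm::finite) \<times> real) set" where
  "cusp_domain \<gamma> =
     {(x', t). norm x' < cusp_profile (CARD('m) + 1) \<gamma> t \<and> 0 < t \<and> t \<le> 1} \<union> ball (0, 2) (sqrt 2)"

definition cusp_weight :: "real \<Rightarrow> (real ^ 'm::finite) \<times> real \<Rightarrow> real" where
  "cusp_weight \<gamma> x = min (cusp_profile (CARD('m) + 1) \<gamma> (snd x)) 1"

end

theory Submission
  imports Defs
begin

text \<open>
  Write \<open>\<alpha> = (\<gamma> - 1) / (n - 1)\<close>, which exceeds \<open>1\<close>, and call the two pieces of the domain the cusp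
  \<open>|x'| < t\<^sup>\<alpha>\<close> and the ball \<open>B\<close>.  The proof is direct and uses no compactness argument.

  The vanishing of \<open>\<integral> |u|\<^sup>p\<^sup>-\<^sup>2 u w ds\<close> is the first order condition for the convex function
  \<open>c \<mapsto> \<integral> |u - c|\<^sup>p w ds\<close> to be minimal at \<open>c = 0\<close>.  Hence \<open>\<integral> |u|\<^sup>p w ds \<le> \<integral> |u - c|\<^sup>p w ds\<close>
  for every constant \<open>c\<close> (\<open>deviation_zero_minimal\<close>).  Suppose that
  \<^item> some \<open>c\<close> satisfies \<open>\<integral>\<^sub>B |u - c|\<^sup>p \<le> C \<integral> |\<nabla>u|\<^sup>p\<close> (\<open>ball_estimate\<close>),
  \<^item> \<open>\<integral>\<^sub>\<Omega> |v|\<^sup>p \<le> C (\<integral>\<^sub>B |v|\<^sup>p + \<integral>\<^sub>\<Omega> |\<nabla>v|\<^sup>p)\<close> (\<open>domain_estimate\<close>), and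
  \<^item> \<open>\<integral>\<^sub>\<partial>\<^sub>\<Omega> |v|\<^sup>p w ds \<le> C (\<integral>\<^sub>\<Omega> |v|\<^sup>p + \<integral>\<^sub>\<Omega> |\<nabla>v|\<^sup>p)\<close> (\<open>trace_estimate\<close>).
  With \<open>v = u - c\<close> these bound \<open>\<integral> |u - c|\<^sup>p w ds\<close>, hence by minimality also \<open>\<integral> |u|\<^sup>p w ds\<close>, hence
  \<open>|c|\<^sup>p \<integral> w ds\<close>, by the gradient term.  Since \<open>0 < \<integral> w ds < \<infinity>\<close>, the constant \<open>c\<close> itself is
  controlled, and so is \<open>u = (u - c) + c\<close> (\<open>poincare_slack\<close>).  The trace estimate does one more
  thing: it makes \<open>|u|\<^sup>p\<^sup>-\<^sup>2 u w\<close> integrable, so that the vanishing integral is a genuine one and not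
  the default value of a divergent integral.

  Each of the three estimates comes from bounding a function at a point by its values and its
  gradient along a segment (\<open>C1_line_bound\<close>) and integrating over the segments.  Vertical segments
  starting in the cusp and going upwards never leave the domain, because \<open>t\<^sup>\<alpha>\<close> increases; they carry
  the estimate from the cusp to the ball.  Inside the ball all pairs of points are joined.  For the
  trace, the boundary is cut into finitely many Lipschitz graphs over coordinate hyperplanes, and
  each boundary point is the end of a segment in an axis direction which lies in the domain.  At
  height \<open>t\<close> in the cusp this segment has length comparable with \<open>t\<^sup>\<alpha>\<close> only; the average over so
  short a segment costs a factor \<open>t\<^sup>-\<^sup>\<alpha>\<close>, and this is what the weight \<open>w = t\<^sup>\<alpha>\<close> pays for.  The
  Lipschitz constants of the graphs do not depend on the height.

  By the definition of the trace it suffices to treat functions that are smooth on the whole space,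
  on the part of the domain above a height \<open>\<epsilon>\<close>, with constants that do not depend on \<open>\<epsilon>\<close>.
\<close>

section \<open>Hausdorff measure\<close>

lemma hausdorff_pre_le:
  assumes "A \<subseteq> (\<Union>i. U i)" "\<And>i. bounded (U i)" "\<And>i. diameter (U i) \<le> \<delta>"
  shows "hausdorff_pre d \<delta> A \<le> (\<Sum>i. hausdorff_size d (U i))"
  unfolding hausdorff_pre_def by (rule INF_lower) (use assms in auto)

lemma hausdorff_pre_approx:
  assumes "hausdorff_pre d \<delta> A < c"
  obtains U where "A \<subseteq> (\<Union>i. U i)" "\<And>i. bounded (U i)" "\<And>i. diameter (U i) \<le> \<delta>"
    "(\<Sum>i. hausdorff_size d (U i)) < c"
  using assms unfolding hausdorff_pre_def INF_less_iff by blast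

lemma hausdorff_size_empty [simp]: "hausdorff_size d {} = 0"
  by (simp add: hausdorff_size_def)

lemma hausdorff_pre_empty:
  assumes "0 \<le> \<delta>" shows "hausdorff_pre d \<delta> {} = 0"
  using hausdorff_pre_le[of "{}" "\<lambda>_. {}" \<delta> d] assms by simp

lemma hausdorff_pre_mono: "A \<subseteq> B \<Longrightarrow> hausdorff_pre d \<delta> A \<le> hausdorff_pre d \<delta> B"
  unfolding hausdorff_pre_def by (rule INF_superset_mono) auto

lemma hausdorff_pre_antimono: "\<delta> \<le> \<delta>' \<Longrightarrow> hausdorff_pre d \<delta>' A \<le> hausdorff_pre d \<delta> A"
  unfolding hausdorff_pre_def by (rule INF_superset_mono) (auto intro: order_trans)

lemma hausdorff_pre_le_outer: "0 < \<delta> \<Longrightarrow> hausdorff_pre d \<delta> A \<le> hausdorff_outer d A"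
  unfolding hausdorff_outer_def by (rule SUP_upper) auto

text \<open>Choose covers that are optimal up to \<open>\<epsilon> / 2\<^sup>i\<^sup>+\<^sup>1\<close> and enumerate their union.\<close>

lemma hausdorff_pre_subadditive:
  "hausdorff_pre d \<delta> (\<Union>i. A i) \<le> (\<Sum>i::nat. hausdorff_pre d \<delta> (A i))"
proof (rule ennreal_le_epsilon)
  fix e :: real
  assume fin: "(\<Sum>i. hausdorff_pre d \<delta> (A i)) < top" and e: "0 < e"
  have "\<exists>U. A i \<subseteq> (\<Union>j. U j) \<and> (\<forall>j. bounded (U j) \<and> diameter (U j) \<le> \<delta>) \<and>
     (\<Sum>j. hausdorff_size d (U j)) \<le> hausdorff_pre d \<delta> (A i) + ennreal (e * (1/2) ^ Suc i)" for i
  proof -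
    have "hausdorff_pre d \<delta> (A i) < top"
      using ennreal_suminf_lessD[OF fin] by blast
    then have "hausdorff_pre d \<delta> (A i) < hausdorff_pre d \<delta> (A i) + ennreal (e * (1/2) ^ Suc i)"
      using e by (cases "hausdorff_pre d \<delta> (A i)") (auto simp flip: ennreal_plus intro!: ennreal_lessI add_nonneg_pos)
    then show ?thesis
      by (rule hausdorff_pre_approx) (metis less_imp_le)
  qed
  then obtain U where U: "\<And>i. A i \<subseteq> (\<Union>j. U i j)" "\<And>i j. bounded (U i j)"
    "\<And>i j. diameter (U i j) \<le> \<delta>"
    "\<And>i. (\<Sum>j. hausdorff_size d (U i j)) \<le> hausdorff_pre d \<delta> (A i) + ennreal (e * (1/2) ^ Suc i)"
    by metis
  have "hausdorff_pre d \<delta> (\<Union>i. A i) \<le> (\<Sum>k. hausdorff_size d (case prod_decode k of (i, j) \<Rightarrow> U i j))"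
  proof (rule hausdorff_pre_le)
    show "(\<Union>i. A i) \<subseteq> (\<Union>k. case prod_decode k of (i, j) \<Rightarrow> U i j)"
    proof
      fix x assume "x \<in> (\<Union>i. A i)"
      then obtain i j where "x \<in> U i j" using U(1) by blast
      then have "x \<in> (case prod_decode (prod_encode (i, j)) of (i, j) \<Rightarrow> U i j)" by simp
      then show "x \<in> (\<Union>k. case prod_decode k of (i, j) \<Rightarrow> U i j)" by (rule UN_I[OF UNIV_I])
    qed
  qed (simp_all add: U split: prod.split)
  also have "\<dots> = (\<Sum>k. (\<lambda>(i, j). hausdorff_size d (U i j)) (prod_decode k))"
    by (intro suminf_cong) (simp split: prod.split)
  also have "\<dots> = (\<Sum>i. \<Sum>j. hausdorff_size d (U i j))"
    by (rule suminf_ennreal_2dimen) simp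
  also have "\<dots> \<le> (\<Sum>i. hausdorff_pre d \<delta> (A i) + ennreal (e * (1/2) ^ Suc i))"
    by (intro suminf_le U) auto
  also have "\<dots> = (\<Sum>i. hausdorff_pre d \<delta> (A i)) + (\<Sum>i. ennreal (e * (1/2) ^ Suc i))"
    by (simp add: suminf_add)
  also have "(\<Sum>i. ennreal (e * (1/2) ^ Suc i)) = ennreal e"
    using sums_mult[OF power_half_series, of e] e
    by (intro sums_unique[symmetric] sums_ennreal[THEN iffD2]) auto
  finally show "hausdorff_pre d \<delta> (\<Union>i. A i) \<le> (\<Sum>i. hausdorff_pre d \<delta> (A i)) + ennreal e" .
qed

lemma hausdorff_outer_mono: "A \<subseteq> B \<Longrightarrow> hausdorff_outer d A \<le> hausdorff_outer d B"
  unfolding hausdorff_outer_def by (intro SUP_mono) (auto intro: hausdorff_pre_mono)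

lemma hausdorff_outer_empty: "hausdorff_outer d {} = 0"
  unfolding hausdorff_outer_def by (simp add: hausdorff_pre_empty)

lemma hausdorff_outer_subadditive:
  "hausdorff_outer d (\<Union>i. A i) \<le> (\<Sum>i::nat. hausdorff_outer d (A i))"
  unfolding hausdorff_outer_def[of d "\<Union>i. A i"]
proof (rule SUP_least)
  fix \<delta> :: real assume "\<delta> \<in> {0<..}"
  then show "hausdorff_pre d \<delta> (\<Union>i. A i) \<le> (\<Sum>i. hausdorff_outer d (A i))"
    by (intro order_trans[OF hausdorff_pre_subadditive] suminf_le hausdorff_pre_le_outer) auto
qed

text \<open>Sets of a cover whose diameter is below the distance of \<open>A\<close> and \<open>B\<close> meet at most one of
  the two, so the cover splits into a cover of \<open>A\<close> and one of \<open>B\<close>.\<close>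

lemma hausdorff_outer_separated:
  assumes "0 < \<eta>" and sep: "\<And>x y. x \<in> A \<Longrightarrow> y \<in> B \<Longrightarrow> \<eta> \<le> dist x y"
  shows "hausdorff_outer d A + hausdorff_outer d B \<le> hausdorff_outer d (A \<union> B)"
proof -
  have pre: "hausdorff_pre d \<delta> A + hausdorff_pre d \<delta> B \<le> hausdorff_pre d \<delta> (A \<union> B)"
    if \<delta>: "0 < \<delta>" "\<delta> < \<eta>" for \<delta>
    unfolding hausdorff_pre_def[of d \<delta> "A \<union> B"]
  proof (rule INF_greatest)
    fix U :: "nat \<Rightarrow> 'a set"
    assume "U \<in> {U. A \<union> B \<subseteq> (\<Union>i. U i) \<and> (\<forall>i. bounded (U i) \<and> diameter (U i) \<le> \<delta>)}"
    then have U: "A \<union> B \<subseteq> (\<Union>i. U i)" "\<And>i. bounded (U i)" "\<And>i. diameter (U i) \<le> \<delta>" by auto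
    define V where "V X i = (if U i \<inter> X = {} then {} else U i)" for X i
    have V: "X \<subseteq> (\<Union>i. V X i)" if "X \<subseteq> A \<union> B" for X
      using that U(1) unfolding V_def by fastforce
    have V': "bounded (V X i)" "diameter (V X i) \<le> \<delta>" for X i
      using U \<delta> by (auto simp: V_def)
    have "hausdorff_pre d \<delta> A + hausdorff_pre d \<delta> B
       \<le> (\<Sum>i. hausdorff_size d (V A i)) + (\<Sum>i. hausdorff_size d (V B i))"
      by (intro add_mono hausdorff_pre_le V V') auto
    also have "\<dots> = (\<Sum>i. hausdorff_size d (V A i) + hausdorff_size d (V B i))"
      by (simp add: suminf_add)
    also have "\<dots> \<le> (\<Sum>i. hausdorff_size d (U i))"
    proof (intro suminf_le)
      fix i
      have "V A i = {} \<or> V B i = {}"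
      proof (rule ccontr)
        assume "\<not> ?thesis"
        then obtain x y where xy: "x \<in> U i" "x \<in> A" "y \<in> U i" "y \<in> B"
          by (auto simp: V_def split: if_splits)
        have "dist x y \<le> diameter (U i)" using diameter_bounded_bound U(2) xy by blast
        with sep[of x y] U(3)[of i] xy \<delta> show False by auto
      qed
      then show "hausdorff_size d (V A i) + hausdorff_size d (V B i) \<le> hausdorff_size d (U i)"
        by (elim disjE) (auto simp: V_def)
    qed auto
    finally show "hausdorff_pre d \<delta> A + hausdorff_pre d \<delta> B \<le> (\<Sum>i. hausdorff_size d (U i))" .
  qed
  have le: "hausdorff_pre d \<delta>1 A + hausdorff_pre d \<delta>2 B \<le> hausdorff_outer d (A \<union> B)"
    if "0 < \<delta>1" "0 < \<delta>2" for \<delta>1 \<delta>2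
  proof -
    (* below \<eta>, so that no set of a cover meets both A and B *)
    define \<delta> where "\<delta> = min (min \<delta>1 \<delta>2) (\<eta>/2)"
    have \<delta>: "0 < \<delta>" "\<delta> < \<eta>" "\<delta> \<le> \<delta>1" "\<delta> \<le> \<delta>2" using that assms(1) by (auto simp: \<delta>_def)
    have "hausdorff_pre d \<delta>1 A + hausdorff_pre d \<delta>2 B \<le> hausdorff_pre d \<delta> A + hausdorff_pre d \<delta> B"
      by (intro add_mono hausdorff_pre_antimono \<delta>)
    also have "\<dots> \<le> hausdorff_outer d (A \<union> B)"
      using pre[OF \<delta>(1,2)] hausdorff_pre_le_outer[OF \<delta>(1)] by (rule order_trans)
    finally show ?thesis .
  qed
  have ne: "{0::real<..} \<noteq> {}" by auto
  have "hausdorff_outer d A + hausdorff_outer d B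
      = (SUP \<delta>1\<in>{0<..}. SUP \<delta>2\<in>{0<..}. hausdorff_pre d \<delta>1 A + hausdorff_pre d \<delta>2 B)"
    unfolding hausdorff_outer_def
    by (simp add: ennreal_SUP_add_left[OF ne, symmetric] ennreal_SUP_add_right[OF ne, symmetric])
  also have "\<dots> \<le> hausdorff_outer d (A \<union> B)"
    by (intro SUP_least le) auto
  finally show ?thesis .
qed

lemma infdist_diff_le_dist: "infdist x C \<le> infdist y C + dist x y"
  by (metis infdist_triangle)

text \<open>Caratheodory's criterion.  Slice the complement of \<open>C\<close> into shells according to the distance
  to \<open>C\<close>.  Every other shell is separated from the union of the previous ones, so the shells have
  finite total measure, and dropping the shells close to \<open>C\<close> costs arbitrarily little.\<close>

lemma caratheodory_closed:
  fixes H :: "'a::metric_space set \<Rightarrow> ennreal"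
  assumes empty: "H {} = 0"
    and mono: "\<And>A B. A \<subseteq> B \<Longrightarrow> H A \<le> H B"
    and sub: "\<And>A :: nat \<Rightarrow> 'a set. H (\<Union>i. A i) \<le> (\<Sum>i. H (A i))"
    and sep: "\<And>A B \<eta>. 0 < \<eta> \<Longrightarrow> (\<And>x y. x \<in> A \<Longrightarrow> y \<in> B \<Longrightarrow> \<eta> \<le> dist x y) \<Longrightarrow>
        H A + H B \<le> H (A \<union> B)"
    and C: "closed C"
  shows "H (A \<inter> C) + H (A - C) = H A"
proof (rule antisym)
  have sub2: "H (X \<union> Y) \<le> H X + H Y" for X Y
  proof -
    have "H (X \<union> Y) \<le> (\<Sum>i. H (binaryset X Y i))"
      using sub[of "binaryset X Y"] by (simp only: UN_binaryset_eq)
    also have "\<dots> = H X + H Y"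
      using sums_unique[OF binaryset_sums[of H X Y]] empty by simp
    finally show ?thesis .
  qed
  show "H A \<le> H (A \<inter> C) + H (A - C)"
    using sub2[of "A \<inter> C" "A - C"] by (simp add: Int_Diff_Un)
  show "H (A \<inter> C) + H (A - C) \<le> H A"
  proof (cases "H A = top \<or> C = {}")
    case True then show ?thesis by (auto simp: empty)
  next
    case False
    then have fin: "H A < top" and Cne: "C \<noteq> {}" by (auto simp: top.not_eq_extremum)
    (* R k is the shell of points of A at distance between 1/(k+2) and 1/(k+1) from C *)
    define S where "S k = {x \<in> A. 1 / (real k + 1) \<le> infdist x C}" for k
    define R where "R k = S (Suc k) - S k" for k
    have R1: "1 / (real k + 2) \<le> infdist x C" "infdist x C < 1 / (real k + 1)" "x \<in> A" if "x \<in> R k" for x k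
      using that by (auto simp: R_def S_def add.commute)
    have shells: "(\<Sum>i<N. H (R (2 * i + q))) \<le> H A" for N q
    proof -
      have "(\<Sum>i<N. H (R (2 * i + q))) \<le> H (\<Union>i<N. R (2 * i + q))"
      proof (induction N)
        case (Suc N)
        have "(\<Sum>i<Suc N. H (R (2 * i + q))) \<le> H (\<Union>i<N. R (2 * i + q)) + H (R (2 * N + q))"
          using Suc by (simp add: add_right_mono)
        also have "\<dots> \<le> H ((\<Union>i<N. R (2 * i + q)) \<union> R (2 * N + q))"
        proof (cases "N = 0")
          case True then show ?thesis by (simp add: empty)
        next
          case N: False
          show ?thesis
          proof (rule sep)
            show "0 < 1 / (2 * real N + real q) - 1 / (2 * real N + real q + 1)"
              using N by (simp add: divide_strict_left_mono)
            fix x y assume "x \<in> (\<Union>i<N. R (2 * i + q))" and y: "y \<in> R (2 * N + q)"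
            then obtain i where i: "i < N" "x \<in> R (2 * i + q)" by auto
            have "1 / (2 * real N + real q) \<le> 1 / (real (2 * i + q) + 2)"
              using i by (intro divide_left_mono) auto
            with R1(1)[OF i(2)] R1(2)[OF y] infdist_diff_le_dist[of x C y]
            show "1 / (2 * real N + real q) - 1 / (2 * real N + real q + 1) \<le> dist x y"
              by simp
          qed
        qed
        also have "\<dots> = H (\<Union>i<Suc N. R (2 * i + q))"
          by (simp add: lessThan_Suc Un_commute)
        finally show ?case .
      qed (simp add: empty)
      also have "\<dots> \<le> H A" by (intro mono) (auto simp: R_def S_def)
      finally show ?thesis .
    qed
    have "(\<Sum>i<n. H (R i)) \<le> 2 * H A" for n
    proof -
      have "(\<Sum>i<n. H (R i)) \<le> (\<Sum>i<2*n. H (R i))"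
        by (intro sum_mono2) auto
      also have "\<dots> = (\<Sum>i<n. H (R (2*i+0))) + (\<Sum>i<n. H (R (2*i+1)))"
        by (induction n) (auto simp: algebra_simps)
      also have "\<dots> \<le> H A + H A"
        by (intro add_mono shells)
      finally show ?thesis by (simp add: mult_2)
    qed
    then have "(\<Sum>i. H (R i)) \<le> 2 * H A"
      by (intro suminf_le_const) auto
    also have "\<dots> < top" using fin by (simp add: ennreal_mult_less_top)
    finally have sfin: "(\<Sum>i. H (R i)) < top" .
    have "(\<lambda>k. \<Sum>j. H (R (j + k))) \<longlonglongrightarrow> 0"
    proof -
      have Rfin: "H (R i) < top" for i using ennreal_suminf_lessD[OF sfin] .
      then have eq: "H (R i) = ennreal (enn2real (H (R i)))" for i by (simp add: less_top)
      have sm: "summable (\<lambda>i. enn2real (H (R i)))"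
        using sfin by (intro summable_suminf_not_top) (auto simp: eq[symmetric] less_top)
      have "(\<Sum>j. H (R (j + k))) = ennreal (\<Sum>j. enn2real (H (R (j + k))))" for k
        using suminf_ennreal2[OF _ summable_ignore_initial_segment[OF sm, of k]] by (simp add: eq[symmetric])
      moreover have "(\<lambda>k. \<Sum>j. enn2real (H (R (j + k)))) \<longlonglongrightarrow> 0"
        using suminf_exist_split2[OF sm] by simp
      ultimately show ?thesis
        using tendsto_ennrealI[of _ 0 sequentially] by simp
    qed
    then have lim: "(\<lambda>k. H A + (\<Sum>j. H (R (j + k)))) \<longlonglongrightarrow> H A + 0"
      by (intro tendsto_add tendsto_const)
    have "H (A \<inter> C) + H (A - C) \<le> H A + (\<Sum>j. H (R (j + k)))" for k
    proof -
      have "A - C \<subseteq> S k \<union> (\<Union>j. R (j + k))"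
      proof
        fix x assume x: "x \<in> A - C"
        then have "0 < infdist x C"
          using in_closed_iff_infdist_zero[OF C Cne, of x] infdist_nonneg[of x C] by auto
        then obtain m where "1 / (real m + 1) \<le> infdist x C"
          using reals_Archimedean[of "infdist x C"]
          by (auto simp: inverse_eq_divide add.commute dest: less_imp_le)
        then have "x \<in> S m" using x by (simp add: S_def)
        show "x \<in> S k \<union> (\<Union>j. R (j + k))"
        proof (rule ccontr)
          assume neg: "\<not> ?thesis"
          have "x \<notin> S (j + k)" for j
          proof (induction j)
            case (Suc j) then show ?case using neg by (auto simp: R_def)
          qed (use neg in auto)
          moreover have "S m \<subseteq> S (m + k)"
          proof -
            have "1 / (real (m + k) + 1) \<le> 1 / (real m + 1)" by (intro divide_left_mono) auto
            then show ?thesis by (auto simp: S_def)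
          qed
          ultimately show False using \<open>x \<in> S m\<close> by blast
        qed
      qed
      then have "H (A - C) \<le> H (S k) + H (\<Union>j. R (j + k))"
        by (intro order_trans[OF mono sub2])
      also have "\<dots> \<le> H (S k) + (\<Sum>j. H (R (j + k)))" by (intro add_left_mono sub)
      finally have "H (A \<inter> C) + H (A - C) \<le> (H (A \<inter> C) + H (S k)) + (\<Sum>j. H (R (j + k)))"
        by (simp add: add.assoc add_left_mono)
      also have "H (A \<inter> C) + H (S k) \<le> H (A \<inter> C \<union> S k)"
      proof (rule sep[of "1 / (real k + 1)"])
        fix x y assume "x \<in> A \<inter> C" "y \<in> S k"
        then show "1 / (real k + 1) \<le> dist x y"
          using infdist_le[of x C y] by (auto simp: S_def dist_commute)
      qed simp
      also have "\<dots> \<le> H A" by (intro mono) (auto simp: S_def)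
      finally show ?thesis by (simp add: add_right_mono)
    qed
    then show ?thesis
      using LIMSEQ_le_const[OF lim, of "H (A \<inter> C) + H (A - C)"] by simp
  qed
qed

lemma sets_hausdorff_measure [measurable_cong, simp]: "sets (hausdorff_measure d) = sets borel"
  by (simp add: hausdorff_measure_def) (metis sets.sigma_sets_eq space_borel)

lemma space_hausdorff_measure [simp]: "space (hausdorff_measure d) = UNIV"
  by (simp add: hausdorff_measure_def)

text \<open>Caratheodory's criterion makes every closed set, hence every Borel set, measurable for the outer
  measure, so that \<^const>\<open>measure_of\<close> does return the outer measure.\<close>

lemma emeasure_hausdorff_measure:
  assumes A: "A \<in> sets borel"
  shows "emeasure (hausdorff_measure d) A = hausdorff_outer d A"
proof -
  let ?H = "hausdorff_outer d :: 'a set \<Rightarrow> ennreal"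
  have "outer_measure_space (Pow UNIV) ?H"
    by (auto simp: outer_measure_space_def positive_def increasing_def countably_subadditive_def
        hausdorff_outer_empty hausdorff_outer_mono hausdorff_outer_subadditive)
  then have ms: "measure_space UNIV (lambda_system UNIV (Pow UNIV) ?H) ?H"
    using sigma_algebra.caratheodory_lemma[OF sigma_algebra_Pow] by blast
  then have sa: "sigma_algebra UNIV (lambda_system UNIV (Pow UNIV) ?H)"
    by (simp add: measure_space_def)
  have "{S. closed S} \<subseteq> lambda_system UNIV (Pow UNIV) ?H"
  proof
    fix C :: "'a set" assume "C \<in> {S. closed S}"
    then have "?H (X \<inter> C) + ?H (X - C) = ?H X" for X
      using hausdorff_outer_empty hausdorff_outer_mono hausdorff_outer_subadditive
        hausdorff_outer_separated
      by (intro caratheodory_closed) (blast+)?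
    then show "C \<in> lambda_system UNIV (Pow UNIV) ?H"
      unfolding algebra.lambda_system_eq[OF algebra_Pow] by simp
  qed
  then have "sets borel \<subseteq> lambda_system UNIV (Pow UNIV) ?H"
    using sigma_algebra.sigma_sets_subset[OF sa] by (metis borel_eq_closed sets_measure_of_conv Pow_UNIV top_greatest)
  then have "measure_space UNIV (sets borel) ?H"
    using ms sets.sigma_algebra_axioms[of "borel::'a measure"]
    by (auto simp: measure_space_def positive_def countably_additive_def subset_eq)
  then show ?thesis
    unfolding hausdorff_measure_def using A
    by (intro emeasure_measure_of_sigma) (auto simp: measure_space_def)
qed

lemma hausdorff_size_mono_diameter:
  assumes "diameter U \<le> r" "bounded U" "0 \<le> r"
  shows "hausdorff_size d U \<le> ennreal (unit_ball_vol (real d) * (r / 2) ^ d)"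
  unfolding hausdorff_size_def using assms
  by (auto intro!: ennreal_leI mult_left_mono power_mono divide_right_mono diameter_ge_0
      unit_ball_vol_nonneg)

section \<open>Hausdorff measure of Lipschitz graphs\<close>

text \<open>An open neighbourhood of \<open>P ` S\<close> is cut into small nonoverlapping cubes.  Over a cube of side
  \<open>s\<close> the set \<open>S\<close> has diameter at most \<open>L\<close> times the diameter of the cube, so its Hausdorff size
  is at most a constant times \<open>s\<^sup>m\<close>, the volume of the cube.\<close>

lemma hausdorff_outer_le_lborel:
  fixes P :: "'b::real_normed_vector \<Rightarrow> 'a::euclidean_space"
  assumes L: "0 \<le> L" and lip: "\<And>z z'. z \<in> S \<Longrightarrow> z' \<in> S \<Longrightarrow> dist z z' \<le> L * dist (P z) (P z')"
    and PS: "P ` S \<subseteq> B" and B: "B \<in> sets borel" and bnd: "bounded (P ` S)"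
  shows "hausdorff_outer DIM('a) S
    \<le> ennreal (unit_ball_vol (real DIM('a)) * (L * real DIM('a) / 2) ^ DIM('a)) * emeasure lborel B"
proof -
  let ?m = "DIM('a)"
  define c where "c = unit_ball_vol (real ?m) * (L * real ?m / 2) ^ ?m"
  have c0: "0 \<le> c" unfolding c_def using L by (auto intro!: mult_nonneg_nonneg unit_ball_vol_nonneg)
  have pre: "hausdorff_pre ?m \<delta> S \<le> ennreal c * emeasure lborel W"
    if \<delta>: "0 < \<delta>" and W: "open W" "B \<subseteq> W" for \<delta> W
  proof -
    obtain N where N: "0 < N" "P ` S \<subseteq> cbox (- N *\<^sub>R One) (N *\<^sub>R One)"
    proof -
      obtain N where "0 < N" "\<And>x. x \<in> P ` S \<Longrightarrow> norm x \<le> N"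
        using bnd by (auto simp: bounded_pos)
      then show ?thesis
      proof (intro that[of N] subsetI)
        fix x assume "x \<in> P ` S"
        then have "norm x \<le> N" by fact
        then have "\<bar>x \<bullet> i\<bar> \<le> N" if "i \<in> Basis" for i
          using Basis_le_norm[OF that, of x] by linarith
        then show "x \<in> cbox (- N *\<^sub>R One) (N *\<^sub>R One)"
          by (simp add: mem_box abs_le_iff minus_le_iff)
      qed
    qed
    (* points of S over one ball of radius r are at most \<delta> apart *)
    define r where "r = \<delta> / (2 * (L + 1))"
    have r: "0 < r" "L * (2 * r) \<le> \<delta>"
      using \<delta> L by (auto simp: r_def field_simps)
    define g where "g x = (if x \<in> W then W \<inter> ball x r else ball x r)" for x
    have g: "gauge g" using W(1) r by (auto simp: gauge_def g_def)
    have ne: "box (- N *\<^sub>R One) (N *\<^sub>R One :: 'a) \<noteq> {}"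
      using N by (auto simp: box_ne_empty)
    obtain \<D> where \<D>: "countable \<D>"
      "\<And>K. K \<in> \<D> \<Longrightarrow> interior K \<noteq> {} \<and> (\<exists>c d. K = cbox c d)"
      "pairwise (\<lambda>A B. interior A \<inter> interior B = {}) \<D>"
      "\<And>K. K \<in> \<D> \<Longrightarrow> \<exists>x \<in> P ` S \<inter> K. K \<subseteq> g x"
      "\<And>u v. cbox u v \<in> \<D> \<Longrightarrow> \<exists>n. \<forall>i \<in> Basis. v \<bullet> i - u \<bullet> i
          = ((N *\<^sub>R One) \<bullet> i - (- N *\<^sub>R One) \<bullet> i) / 2^n"
      "P ` S \<subseteq> \<Union>\<D>"
      by (rule covering_lemma[OF N(2) ne g]) blast
    (* the empty set pads the enumeration when there are only finitely many cubes *)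
    define K where "K i = (if i \<in> to_nat_on \<D> ` \<D> then from_nat_into \<D> i else {})" for i
    have K: "K i \<in> \<D>" if "i \<in> to_nat_on \<D> ` \<D>" for i
      using that \<D>(1) by (auto simp: K_def)
    have disj: "disjoint_family (\<lambda>i. interior (K i))"
      unfolding disjoint_family_on_def
    proof (intro ballI impI)
      fix i j :: nat assume "i \<noteq> j"
      show "interior (K i) \<inter> interior (K j) = {}"
      proof (cases "i \<in> to_nat_on \<D> ` \<D> \<and> j \<in> to_nat_on \<D> ` \<D>")
        case True
        then have "K i \<noteq> K j" using \<open>i \<noteq> j\<close> \<D>(1) by (auto simp: K_def)
        then show ?thesis using True \<D>(3) K by (auto simp: pairwise_def)
      qed (auto simp: K_def)
    qed
    have KW: "interior (K i) \<subseteq> W" for i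
    proof (cases "i \<in> to_nat_on \<D> ` \<D>")
      case True
      then obtain x where "x \<in> P ` S" "K i \<subseteq> g x" using \<D>(4) K by blast
      moreover have "x \<in> W" using \<open>x \<in> P ` S\<close> PS W(2) by blast
      ultimately show ?thesis using interior_subset[of "K i"] by (auto simp: g_def)
    qed (auto simp: K_def)
    have size: "bounded (S \<inter> P -` K i) \<and> diameter (S \<inter> P -` K i) \<le> \<delta> \<and>
      hausdorff_size ?m (S \<inter> P -` K i) \<le> ennreal c * emeasure lborel (interior (K i))" for i
    proof (cases "i \<in> to_nat_on \<D> ` \<D>")
      case True
      then have Ki: "K i \<in> \<D>" by (rule K)
      then obtain u v where uv: "K i = cbox u v" using \<D>(2) by blast
      obtain n where n: "\<And>j. j \<in> Basis \<Longrightarrow> v \<bullet> j - u \<bullet> j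
          = ((N *\<^sub>R One) \<bullet> j - (- N *\<^sub>R One) \<bullet> j) / 2^n"
        using \<D>(5) Ki uv by metis
      define s where "s = 2 * N / 2 ^ n"
      have s: "0 < s" "\<And>j. j \<in> Basis \<Longrightarrow> v \<bullet> j - u \<bullet> j = s"
        using N n by (auto simp: s_def)
      obtain x where x: "K i \<subseteq> g x" using \<D>(4)[OF Ki] by blast
      have d1: "dist y y' \<le> 2 * r" if "y \<in> K i" "y' \<in> K i" for y y'
      proof -
        have "dist x y < r" "dist x y' < r" using that x by (auto simp: g_def split: if_splits)
        then show ?thesis using dist_triangle2[of y y' x] by (simp add: dist_commute)
      qed
      have d2: "dist y y' \<le> real ?m * s" if "y \<in> K i" "y' \<in> K i" for y y'
      proof -
        have "dist y y' \<le> (\<Sum>j\<in>Basis. \<bar>(y - y') \<bullet> j\<bar>)"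
          unfolding dist_norm by (rule norm_le_l1)
        also have "\<dots> \<le> (\<Sum>j\<in>(Basis::'a set). s)"
        proof (rule sum_mono)
          fix j :: 'a assume j: "j \<in> Basis"
          then have "u \<bullet> j \<le> y \<bullet> j" "y \<bullet> j \<le> v \<bullet> j" "u \<bullet> j \<le> y' \<bullet> j" "y' \<bullet> j \<le> v \<bullet> j"
            using that uv by (auto simp: mem_box)
          then show "\<bar>(y - y') \<bullet> j\<bar> \<le> s" using s(2)[OF j] by (simp add: inner_diff_left)
        qed
        finally show ?thesis by simp
      qed
      have e1: "dist z z' \<le> \<delta>" and e2: "dist z z' \<le> L * (real ?m * s)"
        if "z \<in> S \<inter> P -` K i" "z' \<in> S \<inter> P -` K i" for z z'
      proof -
        have "dist z z' \<le> L * dist (P z) (P z')" using lip that by blast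
        moreover have "L * dist (P z) (P z') \<le> L * (2 * r)" "L * dist (P z) (P z') \<le> L * (real ?m * s)"
          using d1[of "P z" "P z'"] d2[of "P z" "P z'"] that L by (auto intro!: mult_left_mono)
        ultimately show "dist z z' \<le> \<delta>" "dist z z' \<le> L * (real ?m * s)" using r(2) by linarith+
      qed
      have bd: "bounded (S \<inter> P -` K i)"
        using e1 by (auto simp: bounded_two_points)
      have "hausdorff_size ?m (S \<inter> P -` K i)
          \<le> ennreal (unit_ball_vol (real ?m) * (L * (real ?m * s) / 2) ^ ?m)"
        using e2 L s bd by (intro hausdorff_size_mono_diameter diameter_le) (auto simp: dist_norm)
      also have "unit_ball_vol (real ?m) * (L * (real ?m * s) / 2) ^ ?m = c * s ^ ?m"
        by (simp add: c_def power_mult_distrib power_divide)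
      also have "ennreal (c * s ^ ?m) = ennreal c * emeasure lborel (interior (K i))"
      proof -
        have "emeasure lborel (box u v) = ennreal (\<Prod>j\<in>Basis. (v - u) \<bullet> j)"
          by (rule emeasure_lborel_box) (metis s diff_ge_0_iff_ge less_imp_le)
        also have "(\<Prod>j\<in>Basis. (v - u) \<bullet> j) = s ^ ?m"
          using s(2) by (simp add: inner_diff_left)
        finally show ?thesis using c0 s by (simp add: uv interior_cbox ennreal_mult)
      qed
      finally show ?thesis using bd e1 \<delta> 
        by (auto intro!: diameter_le simp: dist_norm)
    qed (use \<delta> in \<open>auto simp: K_def\<close>)
    have "hausdorff_pre ?m \<delta> S \<le> (\<Sum>i. hausdorff_size ?m (S \<inter> P -` K i))"
    proof (rule hausdorff_pre_le)
      show "S \<subseteq> (\<Union>i. S \<inter> P -` K i)"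
      proof
        fix z assume z: "z \<in> S"
        then obtain k where k: "k \<in> \<D>" "P z \<in> k" using \<D>(6) by blast
        then have "K (to_nat_on \<D> k) = k" using \<D>(1) by (simp add: K_def)
        then have "z \<in> S \<inter> P -` K (to_nat_on \<D> k)" using k z by simp
        then show "z \<in> (\<Union>i. S \<inter> P -` K i)" by blast
      qed
    qed (use size in auto)
    also have "\<dots> \<le> (\<Sum>i. ennreal c * emeasure lborel (interior (K i)))"
      using size by (intro suminf_le) auto
    also have "\<dots> = ennreal c * emeasure lborel (\<Union>i. interior (K i))"
      using suminf_emeasure[OF _ disj, of lborel] by (simp add: image_subset_iff)
    also have "\<dots> \<le> ennreal c * emeasure lborel W"
      using KW W(1) by (intro mult_left_mono emeasure_mono) auto
    finally show ?thesis .
  qed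
  have "hausdorff_outer ?m S \<le> ennreal c * emeasure lborel B"
  proof (rule ennreal_le_epsilon)
    fix e :: real assume e: "0 < e"
    have "0 < e / (c + 1)" using e c0 by simp
    then obtain W where W: "open W" "B \<subseteq> W" "emeasure lborel (W - B) < ennreal (e / (c + 1))"
      using outer_regular_lborel[OF B] by blast
    have "hausdorff_outer ?m S \<le> ennreal c * emeasure lborel W"
      unfolding hausdorff_outer_def by (intro SUP_least pre W) auto
    also have "emeasure lborel W = emeasure lborel B + emeasure lborel (W - B)"
      using W B plus_emeasure[of B lborel "W - B"] by (simp add: Un_absorb1)
    also have "ennreal c * \<dots> \<le> ennreal c * emeasure lborel B + ennreal c * ennreal (e / (c + 1))"
      using W(3) by (simp add: distrib_left add_left_mono mult_left_mono less_imp_le)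
    also have "ennreal c * ennreal (e / (c + 1)) \<le> ennreal e"
      using c0 e by (auto simp flip: ennreal_mult simp: field_simps intro!: ennreal_leI)
    finally show "hausdorff_outer ?m S \<le> ennreal c * emeasure lborel B + ennreal e"
      by (simp add: add_left_mono)
  qed
  then show ?thesis by (simp add: c_def)
qed

text \<open>The image of a covering set under the 1-Lipschitz map \<open>P\<close> lies in a ball whose radius is the full
  diameter; its volume is \<open>2\<^sup>m\<close> times the Hausdorff size of the covering set.\<close>

lemma lborel_le_hausdorff_outer:
  fixes P :: "'b::metric_space \<Rightarrow> 'a::euclidean_space"
  assumes lip: "\<And>z z'. z \<in> S \<Longrightarrow> z' \<in> S \<Longrightarrow> dist (P z) (P z') \<le> dist z z'"
    and B: "B \<subseteq> P ` S"
  shows "emeasure lborel B \<le> 2 ^ DIM('a) * hausdorff_outer DIM('a) S"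
proof -
  let ?m = "DIM('a)"
  have "emeasure lborel B \<le> 2 ^ ?m * (\<Sum>i. hausdorff_size ?m (U i))"
    if U: "S \<subseteq> (\<Union>i. U i)" "\<And>i. bounded (U i)" for U :: "nat \<Rightarrow> 'b set"
  proof -
    define V where "V i = (if U i \<inter> S = {} then {}
      else cball (P (SOME x. x \<in> U i \<inter> S)) (diameter (U i)))" for i
    have V: "P ` (U i \<inter> S) \<subseteq> V i" for i
    proof (cases "U i \<inter> S = {}")
      case False
      then have "(SOME x. x \<in> U i \<inter> S) \<in> U i \<inter> S" by (meson ex_in_conv someI_ex)
      then show ?thesis using False U(2) lip
        by (auto simp: V_def intro!: order_trans[OF lip diameter_bounded_bound])
    qed auto
    have "emeasure lborel B \<le> emeasure lborel (\<Union>i. V i)"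
    proof (intro emeasure_mono subsetI)
      fix y assume "y \<in> B"
      then obtain z where "z \<in> S" "y = P z" using B by blast
      moreover then obtain i where "z \<in> U i" using U(1) by blast
      ultimately have "y \<in> V i" using V[of i] by blast
      then show "y \<in> (\<Union>i. V i)" by (rule UN_I[OF UNIV_I])
    qed (auto simp: V_def)
    also have "\<dots> \<le> (\<Sum>i. emeasure lborel (V i))"
      by (rule emeasure_subadditive_countably) (auto simp: V_def)
    also have "\<dots> \<le> (\<Sum>i. 2 ^ ?m * hausdorff_size ?m (U i))"
    proof (intro suminf_le)
      fix i
      show "emeasure lborel (V i) \<le> 2 ^ ?m * hausdorff_size ?m (U i)"
      proof (cases "U i \<inter> S = {}")
        case False
        have "emeasure lborel (V i) = ennreal (unit_ball_vol (real ?m) * diameter (U i) ^ ?m)"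
          using False U(2) by (simp add: V_def emeasure_cball diameter_ge_0)
        also have "\<dots> = ennreal (2 ^ ?m) * hausdorff_size ?m (U i)"
          using False U(2)
          by (auto simp: hausdorff_size_def power_divide diameter_ge_0 unit_ball_vol_nonneg
              simp flip: ennreal_mult)
        finally show ?thesis by (simp add: ennreal_power[symmetric])
      qed (simp add: V_def)
    qed auto
    finally show ?thesis by simp
  qed
  moreover define c where "c = (2::ennreal) ^ ?m"
  moreover have "c = ennreal (2 ^ ?m)" by (simp add: c_def ennreal_power[symmetric])
  then have c: "0 < c" "c < top" by simp_all
  ultimately have "emeasure lborel B / c \<le> hausdorff_pre ?m 1 S"
    unfolding hausdorff_pre_def
    by (intro INF_greatest divide_le_posI_ennreal) auto
  also have "\<dots> \<le> hausdorff_outer ?m S" by (rule hausdorff_pre_le_outer) simp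
  finally have "c * (emeasure lborel B / c) \<le> c * hausdorff_outer ?m S"
    by (rule mult_left_mono) simp
  then show ?thesis
    using c by (simp add: ennreal_times_divide mult.commute mult_divide_eq_ennreal c_def less_top)
qed

text \<open>The Householder reflection that exchanges the basis vector \<open>b\<close> with the last one; the usual
  factor \<open>2 / |e - b|\<^sup>2\<close> equals \<open>1\<close> for distinct basis vectors, and for equal ones the map is the
  identity.  It turns graphs in direction \<open>b\<close> into graphs over the first factor of the product.\<close>

definition basis_swap :: "'a::euclidean_space \<times> real \<Rightarrow> 'a \<times> real \<Rightarrow> 'a \<times> real" where
  "basis_swap b x = x - (x \<bullet> ((0, 1) - b)) *\<^sub>R ((0, 1) - b)"

context
  fixes b :: "'a::euclidean_space \<times> real"
  assumes b: "b \<in> Basis"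
begin

lemma basis_swap_inner: "basis_swap b x \<bullet> y = x \<bullet> basis_swap b y"
  by (simp add: basis_swap_def inner_diff_left inner_diff_right inner_commute)

lemma basis_swap_basis:
  "basis_swap b i = (if i = b then (0, 1) else if i = (0, 1) then b else i)" if "i \<in> Basis"
proof -
  have e: "(0, 1) \<in> (Basis :: ('a \<times> real) set)" by (simp add: Basis_prod_def)
  show ?thesis
    using b e that by (auto simp: basis_swap_def inner_diff_right inner_Basis)
qed

lemma basis_swap_swap [simp]: "basis_swap b (basis_swap b x) = x"
proof (rule euclidean_eqI)
  fix i :: "'a \<times> real" assume i: "i \<in> Basis"
  have "(0, 1) \<in> (Basis :: ('a \<times> real) set)" by (simp add: Basis_prod_def)
  then show "basis_swap b (basis_swap b x) \<bullet> i = x \<bullet> i"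
    using b i by (simp add: basis_swap_inner) (simp add: basis_swap_basis)
qed

lemma linear_basis_swap: "linear (basis_swap b)"
  by (rule linearI) (simp_all add: basis_swap_def algebra_simps inner_add_left)

lemma norm_basis_swap [simp]: "norm (basis_swap b x) = norm x"
  by (simp add: norm_eq_sqrt_inner basis_swap_inner)

lemma snd_basis_swap: "snd (basis_swap b x) = x \<bullet> b"
proof -
  have e: "(0, 1) \<in> (Basis :: ('a \<times> real) set)" by (simp add: Basis_prod_def)
  have "snd (basis_swap b x) = basis_swap b x \<bullet> (0, 1)" by (simp add: inner_prod_def)
  also have "\<dots> = x \<bullet> b" using e b by (simp add: basis_swap_inner basis_swap_basis)
  finally show ?thesis .
qed

lemma borel_measurable_basis_swap [measurable]: "basis_swap b \<in> borel_measurable borel"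
  by (intro borel_measurable_continuous_onI linear_continuous_on linear_conv_bounded_linear[THEN iffD1]
      linear_basis_swap)

lemma distr_basis_swap: "distr lborel borel (basis_swap b) = lborel"
proof (rule lborel_eqI[symmetric])
  fix l u :: "'a \<times> real"
  assume le: "\<And>i. i \<in> Basis \<Longrightarrow> l \<bullet> i \<le> u \<bullet> i"
  have e: "(0, 1) \<in> (Basis :: ('a \<times> real) set)" by (simp add: Basis_prod_def)
  have bB: "basis_swap b i \<in> Basis" if "i \<in> Basis" for i
    using that b e by (simp add: basis_swap_basis)
  have bij: "bij_betw (basis_swap b) Basis Basis"
    by (rule bij_betw_byWitness[where f' = "basis_swap b"]) (auto simp: bB)
  have "basis_swap b -` box l u = box (basis_swap b l) (basis_swap b u)"
  proof (intro set_eqI iffI)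
    fix x assume "x \<in> basis_swap b -` box l u"
    then have x: "l \<bullet> i < x \<bullet> basis_swap b i \<and> x \<bullet> basis_swap b i < u \<bullet> i" if "i \<in> Basis" for i
      using that by (simp add: mem_box basis_swap_inner)
    show "x \<in> box (basis_swap b l) (basis_swap b u)"
      unfolding mem_box using x[OF bB] by (simp add: basis_swap_inner)
  next
    fix x assume "x \<in> box (basis_swap b l) (basis_swap b u)"
    then have x: "l \<bullet> basis_swap b i < x \<bullet> i \<and> x \<bullet> i < u \<bullet> basis_swap b i" if "i \<in> Basis" for i
      using that by (simp add: mem_box basis_swap_inner)
    show "x \<in> basis_swap b -` box l u"
      using x[OF bB] by (simp add: mem_box basis_swap_inner)
  qed
  then have "emeasure (distr lborel borel (basis_swap b)) (box l u)
      = emeasure lborel (box (basis_swap b l) (basis_swap b u))"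
    by (subst emeasure_distr) auto
  also have "\<dots> = (\<Prod>i\<in>Basis. (basis_swap b u - basis_swap b l) \<bullet> i)"
    using le bB by (intro emeasure_lborel_box) (simp add: basis_swap_inner)
  also have "\<dots> = (\<Prod>i\<in>Basis. (u - l) \<bullet> basis_swap b i)"
    by (simp add: inner_diff_left basis_swap_inner)
  also have "\<dots> = (\<Prod>i\<in>Basis. (u - l) \<bullet> i)"
    by (rule arg_cong[of _ _ ennreal], rule prod.reindex_bij_betw[OF bij])
  finally show "emeasure (distr lborel borel (basis_swap b)) (box l u) = (\<Prod>i\<in>Basis. (u - l) \<bullet> i)" .
qed simp

lemma nn_integral_basis_swap:
  "f \<in> borel_measurable borel \<Longrightarrow> (\<integral>\<^sup>+x. f (basis_swap b x) \<partial>lborel) = (\<integral>\<^sup>+x. f x \<partial>lborel)"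
  using nn_integral_distr[of "basis_swap b" lborel borel f] by (simp add: distr_basis_swap)

end

section \<open>Bounds along segments\<close>

text \<open>Estimates for smooth functions only see the function and a continuous gradient; the pair is
  stable under subtracting a constant, whereas \<^const>\<open>gradient\<close> would have to be recomputed.\<close>

definition C1_grad :: "('a::euclidean_space \<Rightarrow> real) \<Rightarrow> ('a \<Rightarrow> 'a) \<Rightarrow> bool" where
  "C1_grad \<phi> G \<longleftrightarrow> (\<forall>x. (\<phi> has_derivative (\<lambda>h. G x \<bullet> h)) (at x)) \<and> continuous_on UNIV G"

lemma smooth_C1_grad:
  assumes "smooth \<phi>" shows "C1_grad \<phi> (gradient \<phi>)"
proof -
  have d: "\<phi> differentiable (at x)" for x
    using assms unfolding smooth_def by (metis Ck.simps(2))
  have c: "continuous_on UNIV (\<lambda>x. frechet_derivative \<phi> (at x) b)" if "b \<in> Basis" for b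
    using assms that unfolding smooth_def by (metis Ck.simps)
  have "(\<phi> has_derivative (\<lambda>h. gradient \<phi> x \<bullet> h)) (at x)" for x
  proof -
    have D: "(\<phi> has_derivative frechet_derivative \<phi> (at x)) (at x)"
      using d frechet_derivative_works by blast
    then have lin: "linear (frechet_derivative \<phi> (at x))" by (rule has_derivative_linear)
    have "frechet_derivative \<phi> (at x) h = gradient \<phi> x \<bullet> h" for h
    proof -
      have "frechet_derivative \<phi> (at x) h
          = frechet_derivative \<phi> (at x) (\<Sum>b\<in>Basis. (h \<bullet> b) *\<^sub>R b)"
        by (simp add: euclidean_representation)
      also have "\<dots> = (\<Sum>b\<in>Basis. (h \<bullet> b) * frechet_derivative \<phi> (at x) b)"
        using lin by (simp add: linear_sum linear_scale)
      also have "\<dots> = gradient \<phi> x \<bullet> h"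
        unfolding gradient_def inner_sum_left by (simp add: inner_commute mult.commute)
      finally show ?thesis .
    qed
    then have "frechet_derivative \<phi> (at x) = (\<lambda>h. gradient \<phi> x \<bullet> h)" by (rule ext)
    then show ?thesis using D by simp
  qed
  moreover have "continuous_on UNIV (gradient \<phi>)"
    unfolding gradient_def by (intro continuous_intros c)
  ultimately show ?thesis by (simp add: C1_grad_def)
qed

lemma C1_grad_diff_const: "C1_grad \<phi> G \<Longrightarrow> C1_grad (\<lambda>x. \<phi> x - c) G"
  unfolding C1_grad_def by (auto intro!: derivative_eq_intros)

lemma C1_grad_const: "C1_grad (\<lambda>x. c) (\<lambda>x. 0)"
  unfolding C1_grad_def by (auto intro!: derivative_eq_intros)

lemma C1_grad_continuous:
  assumes "C1_grad \<phi> G" shows "continuous_on UNIV \<phi>" "continuous_on UNIV G"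
  using assms unfolding C1_grad_def
  by (auto intro!: continuous_at_imp_continuous_on has_derivative_continuous)

lemma C1_grad_measurable:
  assumes "C1_grad \<phi> G" shows "\<phi> \<in> borel_measurable borel" "G \<in> borel_measurable borel"
  using C1_grad_continuous[OF assms] by (auto intro: borel_measurable_continuous_onI)

lemma powr_add_le:
  fixes a b p :: real
  assumes "0 \<le> a" "0 \<le> b" "0 \<le> p"
  shows "(a + b) powr p \<le> 2 powr p * (a powr p + b powr p)"
proof -
  have "(a + b) powr p \<le> (2 * max a b) powr p"
    using assms by (intro powr_mono2) auto
  also have "\<dots> = 2 powr p * (max a b) powr p"
    using assms by (simp add: powr_mult)
  also have "\<dots> \<le> 2 powr p * (a powr p + b powr p)"
    by (intro mult_left_mono) (auto simp: max_def)
  finally show ?thesis .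
qed

text \<open>A substitute for Jensen's inequality up to the factor \<open>2\<^sup>p\<close>: for any \<open>t > 0\<close> a value \<open>k\<close> is at
  most \<open>t\<close> or at most \<open>t\<^sup>1\<^sup>-\<^sup>p k\<^sup>p\<close>, and \<open>t\<close> is chosen to balance the two after integration.\<close>

lemma integral_powr_le:
  fixes k :: "real \<Rightarrow> real"
  assumes k: "continuous_on {0..l} k" "\<And>x. x \<in> {0..l} \<Longrightarrow> 0 \<le> k x" and l: "0 < l" and p: "1 < p"
  shows "(integral {0..l} k) powr p \<le> 2 powr p * l powr (p - 1) * integral {0..l} (\<lambda>x. k x powr p)"
proof -
  define I where "I = integral {0..l} (\<lambda>x. k x powr p)"
  have ck: "continuous_on {0..l} (\<lambda>x. k x powr p)"
    using k p by (intro continuous_on_powr') auto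
  have I0: "0 \<le> I" unfolding I_def by (intro integral_nonneg integrable_continuous_interval ck) auto
  have k0: "0 \<le> integral {0..l} k"
    by (intro integral_nonneg integrable_continuous_interval k)
  have *: "integral {0..l} k \<le> l * t + t powr (1 - p) * I" if t: "0 < t" for t
  proof -
    have "integral {0..l} k \<le> integral {0..l} (\<lambda>x. t + t powr (1 - p) * k x powr p)"
    proof (intro integral_le integrable_continuous_interval continuous_on_add continuous_on_mult
        continuous_on_const k ck)
      fix x assume x: "x \<in> {0..l}"
      show "k x \<le> t + t powr (1 - p) * k x powr p"
      proof (cases "k x \<le> t")
        case False
        have "k x = k x powr (1 - p) * k x powr p"
          using False t by (simp add: powr_add[symmetric])
        also have "\<dots> \<le> t powr (1 - p) * k x powr p"
          using False t p by (intro mult_right_mono powr_mono2') auto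
        finally show ?thesis using t by simp
      qed (use t in \<open>auto intro: add_increasing2\<close>)
    qed
    also have "\<dots> = l * t + t powr (1 - p) * I"
      unfolding I_def using l
      by (subst integral_add)
        (auto intro!: integrable_continuous_interval continuous_on_mult continuous_on_const ck)
    finally show ?thesis .
  qed
  show ?thesis
  proof (cases "I = 0")
    case True
    have "integral {0..l} k \<le> 0 + e" if "0 < e" for e
      using *[of "e / l"] True that l by simp
    then have "integral {0..l} k \<le> 0" by (rule field_le_epsilon)
    then show ?thesis using k0 True by (simp add: I_def)
  next
    case False
    then have I: "0 < I" using I0 by simp
    (* for this t the two terms of the bound * agree *)
    define t where "t = (I / l) powr (1 / p)"
    have t: "0 < t" using I l by (simp add: t_def)
    have "t powr (1 - p) * I = t * (t powr (- p) * I)"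
      using t powr_add[of t 1 "-p"] by simp
    also have "t powr (- p) = l / I"
      using I l p by (simp add: t_def powr_powr powr_minus)
    finally have "integral {0..l} k \<le> 2 * (l * t)" using *[OF t] I by (simp add: field_simps)
    then have "(integral {0..l} k) powr p \<le> (2 * (l * t)) powr p"
      using k0 p by (intro powr_mono2) auto
    also have "\<dots> = 2 powr p * (l powr p * t powr p)"
      using l t by (simp add: powr_mult)
    also have "l powr p * t powr p = l powr (p - 1) * I"
      using I l p by (simp add: t_def powr_powr powr_diff)
    finally show ?thesis by (simp add: I_def mult.assoc)
  qed
qed

lemma nn_integral_Icc_continuous:
  fixes f :: "real \<Rightarrow> real"
  assumes f: "continuous_on UNIV f" "\<And>x. 0 \<le> f x"
  shows "(\<integral>\<^sup>+x\<in>{a..b}. ennreal (f x) \<partial>lborel) = ennreal (integral {a..b} f)"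
proof -
  have "(\<integral>\<^sup>+x. ennreal (indicator {a..b} x * f x) \<partial>lborel) = ennreal (integral {a..b} f)"
  proof (rule nn_integral_has_integral_lborel)
    show "((\<lambda>x. indicator {a..b} x * f x) has_integral integral {a..b} f) UNIV"
      using integrable_integral[OF integrable_continuous_interval[OF continuous_on_subset[OF f(1) subset_UNIV]], of a b]
      by (subst (asm) has_integral_restrict_UNIV[symmetric])
        (auto elim!: has_integral_eq[rotated] simp: indicator_def)
    show "(\<lambda>x. indicator {a..b} x * f x) \<in> borel_measurable borel"
      using borel_measurable_continuous_onI[OF f(1)] by measurable
  qed (use f in auto)
  then show ?thesis by (simp add: ennreal_mult' ennreal_indicator mult.commute f)
qed

text \<open>The fundamental theorem of calculus along the segment, followed by the power mean inequality.  The
  factor \<open>4\<^sup>p\<close> collects \<open>2\<^sup>p\<close> from splitting the sum and \<open>2\<^sup>p\<close> from \<open>integral_powr_le\<close>.\<close>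

lemma C1_line_bound:
  fixes \<phi> :: "'a::euclidean_space \<Rightarrow> real"
  assumes \<phi>: "C1_grad \<phi> G" and s: "0 \<le> s" "s \<le> l" and l: "0 < l" and p: "1 < p"
  shows "ennreal (\<bar>\<phi> z\<bar> powr p) \<le> ennreal (2 powr p) * ennreal (\<bar>\<phi> (z + s *\<^sub>R v)\<bar> powr p)
    + ennreal (4 powr p * norm v powr p * l powr (p - 1))
      * (\<integral>\<^sup>+r\<in>{0..l}. ennreal (norm (G (z + r *\<^sub>R v)) powr p) \<partial>lborel)"
proof -
  have G: "continuous_on UNIV G" using C1_grad_continuous[OF \<phi>] by simp
  have cG: "continuous_on A (\<lambda>r. G (z + r *\<^sub>R v))" for A
    by (intro continuous_on_compose2[OF G] continuous_intros) auto
  define J where "J = integral {0..l} (\<lambda>r. norm (G (z + r *\<^sub>R v)))"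
  define K where "K = integral {0..l} (\<lambda>r. norm (G (z + r *\<^sub>R v)) powr p)"
  have J0: "0 \<le> J" unfolding J_def
    by (intro integral_nonneg integrable_continuous_interval continuous_intros cG) auto
  have "((\<lambda>r. G (z + r *\<^sub>R v) \<bullet> v) has_integral \<phi> (z + s *\<^sub>R v) - \<phi> (z + 0 *\<^sub>R v)) {0..s}"
  proof (rule fundamental_theorem_of_calculus[OF s(1)])
    fix r assume "r \<in> {0..s}"
    have "((\<lambda>r. z + r *\<^sub>R v) has_derivative (\<lambda>h. h *\<^sub>R v)) (at r within {0..s})"
      by (auto intro!: derivative_eq_intros)
    moreover have "(\<phi> has_derivative (\<lambda>h. G (z + r *\<^sub>R v) \<bullet> h)) (at (z + r *\<^sub>R v))"
      using \<phi> by (simp add: C1_grad_def)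
    ultimately have "((\<lambda>r. \<phi> (z + r *\<^sub>R v)) has_derivative (\<lambda>h. G (z + r *\<^sub>R v) \<bullet> (h *\<^sub>R v)))
        (at r within {0..s})"
      by (rule has_derivative_compose)
    then show "((\<lambda>r. \<phi> (z + r *\<^sub>R v)) has_vector_derivative G (z + r *\<^sub>R v) \<bullet> v) (at r within {0..s})"
      by (simp add: has_vector_derivative_def)
  qed
  then have eq: "\<phi> (z + s *\<^sub>R v) - \<phi> z = integral {0..s} (\<lambda>r. G (z + r *\<^sub>R v) \<bullet> v)"
    by (simp add: integral_unique)
  have "\<bar>\<phi> (z + s *\<^sub>R v) - \<phi> z\<bar> \<le> integral {0..s} (\<lambda>r. norm v * norm (G (z + r *\<^sub>R v)))"
    unfolding eq real_norm_def[symmetric]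
  proof (rule integral_norm_bound_integral)
    fix r show "norm (G (z + r *\<^sub>R v) \<bullet> v) \<le> norm v * norm (G (z + r *\<^sub>R v))"
      using Cauchy_Schwarz_ineq2[of "G (z + r *\<^sub>R v)" v] by (simp add: mult.commute)
  qed (intro integrable_continuous_interval continuous_intros cG)+
  also have "\<dots> \<le> integral {0..l} (\<lambda>r. norm v * norm (G (z + r *\<^sub>R v)))"
    by (rule integral_subset_le) (use s in \<open>auto intro!: integrable_continuous_interval continuous_intros cG\<close>)
  also have "\<dots> = norm v * J" by (simp add: J_def)
  finally have "\<bar>\<phi> z\<bar> \<le> \<bar>\<phi> (z + s *\<^sub>R v)\<bar> + norm v * J" by linarith
  then have "\<bar>\<phi> z\<bar> powr p \<le> (\<bar>\<phi> (z + s *\<^sub>R v)\<bar> + norm v * J) powr p"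
    using p by (intro powr_mono2) auto
  also have "\<dots> \<le> 2 powr p * (\<bar>\<phi> (z + s *\<^sub>R v)\<bar> powr p + (norm v * J) powr p)"
    using p J0 by (intro powr_add_le) auto
  also have "(norm v * J) powr p = norm v powr p * J powr p"
    using J0 by (simp add: powr_mult)
  also have "2 powr p * (\<bar>\<phi> (z + s *\<^sub>R v)\<bar> powr p + norm v powr p * J powr p)
      \<le> 2 powr p * (\<bar>\<phi> (z + s *\<^sub>R v)\<bar> powr p + norm v powr p * (2 powr p * l powr (p - 1) * K))"
    unfolding J_def K_def
    by (intro mult_left_mono add_left_mono integral_powr_le continuous_intros cG l p) auto
  finally have "\<bar>\<phi> z\<bar> powr p \<le> 2 powr p * \<bar>\<phi> (z + s *\<^sub>R v)\<bar> powr p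
      + (4 powr p * norm v powr p * l powr (p - 1)) * K"
    using powr_mult[of 2 2 p] by (simp add: algebra_simps)
  moreover have "(\<integral>\<^sup>+r\<in>{0..l}. ennreal (norm (G (z + r *\<^sub>R v)) powr p) \<partial>lborel) = ennreal K"
    unfolding K_def using p
    by (intro nn_integral_Icc_continuous continuous_on_powr' continuous_intros cG) auto
  moreover have "0 \<le> K"
    unfolding K_def using p
    by (intro integral_nonneg integrable_continuous_interval continuous_on_powr' continuous_intros cG) auto
  ultimately show ?thesis
    by (auto simp flip: ennreal_mult ennreal_plus intro!: ennreal_leI)
qed

section \<open>The trace inequality on one Lipschitz graph\<close>

definition energy_density :: "real \<Rightarrow> ('a::euclidean_space \<Rightarrow> real) \<Rightarrow> ('a \<Rightarrow> 'a) \<Rightarrow> 'a \<Rightarrow> ennreal" where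
  "energy_density p \<phi> G x = ennreal (\<bar>\<phi> x\<bar> powr p + norm (G x) powr p)"

lemma energy_density_measurable:
  "C1_grad \<phi> G \<Longrightarrow> energy_density p \<phi> G \<in> borel_measurable borel"
  using C1_grad_measurable[of \<phi> G] unfolding energy_density_def by measurable

text \<open>Averaging \<open>C1_line_bound\<close> over the end point of the segment.\<close>

lemma C1_point_le_segment:
  fixes \<phi> :: "'a::euclidean_space \<Rightarrow> real"
  assumes \<phi>: "C1_grad \<phi> G" and v: "norm v = 1" and l: "0 < l" "l \<le> 1" and p: "1 < p"
  shows "ennreal (\<bar>\<phi> z\<bar> powr p * l)
    \<le> ennreal (4 powr p) * (\<integral>\<^sup>+r\<in>{0<..<l}. energy_density p \<phi> G (z + r *\<^sub>R v) \<partial>lborel)"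
proof -
  note [measurable] = C1_grad_measurable[OF \<phi>]
  define J where "J = (\<integral>\<^sup>+r\<in>{0..l}. ennreal (norm (G (z + r *\<^sub>R v)) powr p) \<partial>lborel)"
  define I where "I = (\<integral>\<^sup>+r\<in>{0..l}. ennreal (\<bar>\<phi> (z + r *\<^sub>R v)\<bar> powr p) \<partial>lborel)"
  have "ennreal (\<bar>\<phi> z\<bar> powr p * l) = (\<integral>\<^sup>+s\<in>{0..l}. ennreal (\<bar>\<phi> z\<bar> powr p) \<partial>lborel)"
    using l by (simp add: nn_integral_cmult_indicator ennreal_mult)
  also have "\<dots> \<le> (\<integral>\<^sup>+s. ennreal (2 powr p) * (ennreal (\<bar>\<phi> (z + s *\<^sub>R v)\<bar> powr p) * indicator {0..l} s)
      + (ennreal (4 powr p * l powr (p - 1)) * J) * indicator {0..l} s \<partial>lborel)"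
    using C1_line_bound[OF \<phi> _ _ l(1) p, of _ z v] v
    by (intro nn_integral_mono) (auto simp: J_def indicator_def)
  also have "\<dots> = ennreal (2 powr p) * I + (ennreal (4 powr p * l powr (p - 1)) * J) * ennreal l"
    using l by (simp add: nn_integral_add nn_integral_cmult nn_integral_cmult_indicator I_def)
  also have "(ennreal (4 powr p * l powr (p - 1)) * J) * ennreal l
      = ennreal (4 powr p * l powr (p - 1) * l) * J"
    using l by (simp add: ennreal_mult' mult.commute mult.left_commute)
  also have "4 powr p * l powr (p - 1) * l = 4 powr p * l powr p"
    using l by (simp add: powr_diff)
  also have "ennreal (2 powr p) * I + ennreal (4 powr p * l powr p) * J
      \<le> ennreal (4 powr p) * I + ennreal (4 powr p) * J"
  proof (intro add_mono mult_right_mono ennreal_leI)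
    show "2 powr p \<le> 4 powr p" using p by (intro powr_mono2) auto
    show "4 powr p * l powr p \<le> 4 powr p"
      using p l powr_le1[of p l] by (simp add: mult_left_le)
  qed auto
  also have "\<dots> = ennreal (4 powr p) * (\<integral>\<^sup>+r\<in>{0..l}. energy_density p \<phi> G (z + r *\<^sub>R v) \<partial>lborel)"
    unfolding I_def J_def energy_density_def
    by (simp add: distrib_left[symmetric] nn_integral_add[symmetric] distrib_right[symmetric]
        ennreal_plus[symmetric] del: ennreal_plus)
  also have "(\<integral>\<^sup>+r\<in>{0..l}. energy_density p \<phi> G (z + r *\<^sub>R v) \<partial>lborel)
      = (\<integral>\<^sup>+r\<in>{0<..<l}. energy_density p \<phi> G (z + r *\<^sub>R v) \<partial>lborel)"
  proof (rule nn_integral_cong_AE)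
    show "AE r in lborel. energy_density p \<phi> G (z + r *\<^sub>R v) * indicator {0..l} r
        = energy_density p \<phi> G (z + r *\<^sub>R v) * indicator {0<..<l} r"
      using AE_lborel_singleton[of 0] AE_lborel_singleton[of l]
      by eventually_elim (auto simp: indicator_def)
  qed
  finally show ?thesis .
qed

text \<open>The projection of surface measure to the hyperplane is dominated by a multiple of Lebesgue measure,
  so the integral of a function that depends on the projection only is dominated as well.\<close>

lemma nn_integral_hausdorff_graph_le:
  fixes P :: "'b::euclidean_space \<Rightarrow> 'a::euclidean_space"
  assumes L: "0 \<le> L" and lip: "\<And>z z'. z \<in> S \<Longrightarrow> z' \<in> S \<Longrightarrow> dist z z' \<le> L * dist (P z) (P z')"
    and S: "S \<in> sets borel" and P: "P \<in> borel_measurable borel" and bnd: "bounded (P ` S)"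
    and F: "F \<in> borel_measurable borel"
  shows "(\<integral>\<^sup>+z\<in>S. F (P z) \<partial>hausdorff_measure DIM('a))
    \<le> ennreal (unit_ball_vol (real DIM('a)) * (L * real DIM('a) / 2) ^ DIM('a)) * (\<integral>\<^sup>+y. F y \<partial>lborel)"
proof -
  let ?H = "hausdorff_measure DIM('a) :: 'b measure"
  define \<kappa> where "\<kappa> = ennreal (unit_ball_vol (real DIM('a)) * (L * real DIM('a) / 2) ^ DIM('a))"
  define M where "M = distr (density ?H (indicator S)) lborel P"
  have P': "P \<in> density ?H (indicator S) \<rightarrow>\<^sub>M lborel"
    using P by (simp add: measurable_def)
  have "M \<le> scale_measure \<kappa> lborel"
  proof (subst le_measure)
    show "sets M = sets (scale_measure \<kappa> lborel)" by (simp add: M_def)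
    show "\<forall>A\<in>sets M. emeasure M A \<le> emeasure (scale_measure \<kappa> lborel) A"
    proof
      fix A :: "'a set" assume "A \<in> sets M"
      then have A: "A \<in> sets borel" by (simp add: M_def)
      have PA: "P -` A \<in> sets borel" using measurable_sets[OF P A] by simp
      have "emeasure M A = emeasure (density ?H (indicator S)) (P -` A)"
        using A P' by (simp add: M_def emeasure_distr)
      also have "\<dots> = emeasure ?H (S \<inter> P -` A)"
      proof -
        have "emeasure (density ?H (indicator S)) (P -` A)
            = (\<integral>\<^sup>+z. indicator S z * indicator (P -` A) z \<partial>?H)"
          using PA S by (intro emeasure_density) auto
        also have "\<dots> = (\<integral>\<^sup>+z. indicator (S \<inter> P -` A) z \<partial>?H)"
          by (intro nn_integral_cong) (simp add: indicator_inter_arith)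
        finally show ?thesis using PA S by simp
      qed
      also have "\<dots> = hausdorff_outer DIM('a) (S \<inter> P -` A)"
        using PA S by (intro emeasure_hausdorff_measure) auto
      also have "\<dots> \<le> \<kappa> * emeasure lborel A"
        unfolding \<kappa>_def
      proof (rule hausdorff_outer_le_lborel[OF L])
        show "bounded (P ` (S \<inter> P -` A))" by (rule bounded_subset[OF bnd]) auto
      qed (use lip A in auto)
      finally show "emeasure M A \<le> emeasure (scale_measure \<kappa> lborel) A" by simp
    qed
  qed
  then have "(\<integral>\<^sup>+y. F y \<partial>M) \<le> (\<integral>\<^sup>+y. F y \<partial>scale_measure \<kappa> lborel)"
    by (intro nn_integral_mono_measure) (simp_all add: M_def)
  also have "\<dots> = \<kappa> * (\<integral>\<^sup>+y. F y \<partial>lborel)"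
    using F by (simp add: nn_integral_scale_measure)
  also have "(\<integral>\<^sup>+y. F y \<partial>M) = (\<integral>\<^sup>+z\<in>S. F (P z) \<partial>?H)"
    unfolding M_def using F P S P'
    by (simp add: nn_integral_distr nn_integral_density mult.commute)
  finally show ?thesis by (simp add: \<kappa>_def)
qed

text \<open>Here \<open>S\<close> is a Lipschitz graph in direction \<open>b\<close>, and a segment of length \<open>l z\<close> in direction
  \<open>\<plusminus>b\<close> leads from each of its points into \<open>D\<close>.  The integral over the segment is at most the integral
  of the energy over the whole line \<open>z + \<real> b\<close> cut with \<open>D\<close>, which depends only on the projection of
  \<open>z\<close> along \<open>b\<close>.  Integrating over the projections gives back the integral over \<open>D\<close> by Fubini.\<close>

lemma trace_chart:
  fixes \<phi> :: "'a::euclidean_space \<times> real \<Rightarrow> real"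
  assumes \<phi>: "C1_grad \<phi> G" and p: "1 < p"
    and b: "b \<in> Basis" and \<sigma>: "\<bar>\<sigma>\<bar> = 1"
    and S: "S \<in> sets borel" "bounded S" and L: "0 \<le> L"
    and lip: "\<And>z z'. z \<in> S \<Longrightarrow> z' \<in> S \<Longrightarrow>
      \<bar>(z - z') \<bullet> b\<bar> \<le> L * norm ((z - z') - ((z - z') \<bullet> b) *\<^sub>R b)"
    and D: "D \<in> sets borel"
    and l: "\<And>z. z \<in> S \<Longrightarrow> 0 < l z \<and> l z \<le> 1"
    and seg: "\<And>z r. z \<in> S \<Longrightarrow> 0 < r \<Longrightarrow> r < l z \<Longrightarrow> z + r *\<^sub>R (\<sigma> *\<^sub>R b) \<in> D"
  shows "(\<integral>\<^sup>+z\<in>S. ennreal (\<bar>\<phi> z\<bar> powr p * l z) \<partial>hausdorff_measure DIM('a))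
    \<le> ennreal (4 powr p * (unit_ball_vol (real DIM('a)) * ((1 + L) * real DIM('a) / 2) ^ DIM('a)))
      * (\<integral>\<^sup>+x\<in>D. energy_density p \<phi> G x \<partial>lborel)"
proof -
  note [measurable] = energy_density_measurable[OF \<phi>] borel_measurable_basis_swap[OF b] D
  define \<kappa> where "\<kappa> = unit_ball_vol (real DIM('a)) * ((1 + L) * real DIM('a) / 2) ^ DIM('a)"
  define f where "f x = energy_density p \<phi> G x * indicator D x" for x
  have fm [measurable]: "f \<in> borel_measurable borel" unfolding f_def by measurable
  define F where "F y = (\<integral>\<^sup>+r. f (basis_swap b (y, r)) \<partial>lborel)" for y
  define P where "P z = fst (basis_swap b z)" for z
  have f2: "(\<lambda>x. f (basis_swap b x)) \<in> borel_measurable (lborel \<Otimes>\<^sub>M lborel)"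
    unfolding lborel_prod using measurable_compose[OF borel_measurable_basis_swap[OF b] fm] by simp
  have Fm: "F \<in> borel_measurable borel"
    using lborel.borel_measurable_nn_integral_fst[OF f2] by (simp add: F_def[abs_def])
  have Pm: "P \<in> borel_measurable borel"
    unfolding P_def
    by (intro borel_measurable_continuous_onI continuous_on_fst linear_continuous_on
        linear_conv_bounded_linear[THEN iffD1] linear_basis_swap[OF b])
  have point: "ennreal (\<bar>\<phi> z\<bar> powr p * l z) \<le> ennreal (4 powr p) * F (P z)" if z: "z \<in> S" for z
  proof -
    have "ennreal (\<bar>\<phi> z\<bar> powr p * l z) \<le> ennreal (4 powr p) *
        (\<integral>\<^sup>+r\<in>{0<..<l z}. energy_density p \<phi> G (z + r *\<^sub>R (\<sigma> *\<^sub>R b)) \<partial>lborel)"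
      using l[OF z] b \<sigma> by (intro C1_point_le_segment[OF \<phi> _ _ _ p]) auto
    also have "\<dots> \<le> ennreal (4 powr p) * (\<integral>\<^sup>+r. f (z + r *\<^sub>R (\<sigma> *\<^sub>R b)) \<partial>lborel)"
      using seg[OF z] by (intro mult_left_mono nn_integral_mono) (auto simp: f_def indicator_def)
    also have "(\<integral>\<^sup>+r. f (z + r *\<^sub>R (\<sigma> *\<^sub>R b)) \<partial>lborel)
        = (\<integral>\<^sup>+r. f (basis_swap b (P z, snd (basis_swap b z) + \<sigma> * r)) \<partial>lborel)"
    proof (intro nn_integral_cong arg_cong[where f = f])
      fix r
      have "(P z, snd (basis_swap b z) + \<sigma> * r) = basis_swap b z + (r * \<sigma>) *\<^sub>R (0, 1)"
        by (simp add: P_def prod_eq_iff)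
      then have "basis_swap b (P z, snd (basis_swap b z) + \<sigma> * r)
          = basis_swap b (basis_swap b z) + (r * \<sigma>) *\<^sub>R basis_swap b (0, 1)"
        by (simp only: linear_add[OF linear_basis_swap[OF b]] linear_scale[OF linear_basis_swap[OF b]])
      moreover have "basis_swap b (0, 1) = b"
        using basis_swap_basis[OF b, of "(0, 1)"] by (simp add: Basis_prod_def)
      ultimately show "z + r *\<^sub>R (\<sigma> *\<^sub>R b) = basis_swap b (P z, snd (basis_swap b z) + \<sigma> * r)"
        by (simp add: basis_swap_swap[OF b])
    qed
    also have "\<dots> = F (P z)"
      unfolding F_def using nn_integral_real_affine[of "\<lambda>r. f (basis_swap b (P z, r))" \<sigma>
          "snd (basis_swap b z)"] \<sigma> by auto
    finally show ?thesis .
  qed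
  have proj: "norm (P (z - z')) = norm ((z - z') - ((z - z') \<bullet> b) *\<^sub>R b)" for z z'
  proof -
    let ?w = "z - z'"
    have "(norm (P ?w))\<^sup>2 = (norm (basis_swap b ?w))\<^sup>2 - (snd (basis_swap b ?w))\<^sup>2"
      by (simp add: P_def norm_prod_def)
    also have "\<dots> = (norm (?w - (?w \<bullet> b) *\<^sub>R b))\<^sup>2"
      using b unfolding power2_norm_eq_inner
      by (simp add: norm_basis_swap[OF b, unfolded norm_eq_sqrt_inner] snd_basis_swap[OF b] inner_diff_left inner_diff_right
          inner_Basis power2_eq_square inner_commute basis_swap_inner[OF b] basis_swap_swap[OF b])
    finally show ?thesis by simp
  qed
  have Pdiff: "P z - P z' = P (z - z')" for z z'
    by (simp add: P_def linear_diff[OF linear_basis_swap[OF b]])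
  have "(\<integral>\<^sup>+z\<in>S. ennreal (\<bar>\<phi> z\<bar> powr p * l z) \<partial>hausdorff_measure DIM('a))
      \<le> (\<integral>\<^sup>+z. ennreal (4 powr p) * (F (P z) * indicator S z) \<partial>hausdorff_measure DIM('a))"
    using point by (intro nn_integral_mono) (auto simp: indicator_def)
  also have "\<dots> = ennreal (4 powr p) * (\<integral>\<^sup>+z\<in>S. F (P z) \<partial>hausdorff_measure DIM('a))"
    using S(1) measurable_compose[OF Pm Fm]
    by (intro nn_integral_cmult borel_measurable_times_ennreal borel_measurable_indicator) (auto cong: measurable_cong_sets)
  also have "\<dots> \<le> ennreal (4 powr p) * (ennreal \<kappa> * (\<integral>\<^sup>+y. F y \<partial>lborel))"
    unfolding \<kappa>_def
  proof (rule mult_left_mono[OF nn_integral_hausdorff_graph_le[OF _ _ S(1) _ _ Fm]])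
    fix z z' assume zz: "z \<in> S" "z' \<in> S"
    let ?w = "z - z'"
    have "norm ?w \<le> norm (?w - (?w \<bullet> b) *\<^sub>R b) + norm ((?w \<bullet> b) *\<^sub>R b)"
      using norm_triangle_ineq[of "?w - (?w \<bullet> b) *\<^sub>R b" "(?w \<bullet> b) *\<^sub>R b"] by simp
    also have "\<dots> \<le> (1 + L) * norm (?w - (?w \<bullet> b) *\<^sub>R b)"
      using lip[OF zz] by (simp add: norm_Basis[OF b] distrib_right)
    finally show "dist z z' \<le> (1 + L) * dist (P z) (P z')"
      by (simp add: dist_norm Pdiff proj)
  next
    show "P \<in> borel_measurable borel" by (rule Pm)
    show "bounded (P ` S)"
    proof -
      obtain c where "\<And>x. x \<in> S \<Longrightarrow> norm x \<le> c" using S(2) by (auto simp: bounded_iff)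
      then have "norm (P x) \<le> c" if "x \<in> S" for x
      proof -
        have "norm (P x) \<le> norm (basis_swap b x)"
          using norm_fst_le[of "fst (basis_swap b x)" "snd (basis_swap b x)"] by (simp add: P_def)
        then show ?thesis using that \<open>\<And>x. x \<in> S \<Longrightarrow> norm x \<le> c\<close>[of x] by (simp add: norm_basis_swap[OF b])
      qed
      then show ?thesis unfolding bounded_iff by blast
    qed
  qed (use L in auto)
  also have "(\<integral>\<^sup>+y. F y \<partial>lborel) = (\<integral>\<^sup>+x. f (basis_swap b x) \<partial>(lborel \<Otimes>\<^sub>M lborel))"
    unfolding F_def by (rule lborel.nn_integral_fst[OF f2])
  also have "\<dots> = (\<integral>\<^sup>+x. f x \<partial>lborel)"
    unfolding lborel_prod by (rule nn_integral_basis_swap[OF b fm])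
  finally show ?thesis
    by (simp add: f_def \<kappa>_def[symmetric] ennreal_mult' mult.assoc)
qed

section \<open>Geometry of the cuspidal domain\<close>

lemma large_coordinate:
  fixes v :: "'a::euclidean_space"
  obtains b where "b \<in> Basis" "norm v / real DIM('a) \<le> \<bar>v \<bullet> b\<bar>"
proof (rule ccontr)
  assume "\<not> thesis"
  then have "\<bar>v \<bullet> b\<bar> < norm v / real DIM('a)" if "b \<in> Basis" for b
    using that \<open>\<And>b. b \<in> Basis \<Longrightarrow> norm v / real DIM('a) \<le> \<bar>v \<bullet> b\<bar> \<Longrightarrow> thesis\<close> by force
  then have "(\<Sum>b\<in>Basis. \<bar>v \<bullet> b\<bar>) < (\<Sum>b\<in>(Basis::'a set). norm v / real DIM('a))"
    by (intro sum_strict_mono) auto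
  also have "\<dots> = norm v" by simp
  finally show False using norm_le_l1[of v] by simp
qed

text \<open>A chord of a sphere, started in a direction that points inwards, stays inside.\<close>

lemma norm_shift_less:
  fixes v :: "'a::real_inner"
  assumes "norm b = 1" "\<bar>\<sigma>\<bar> = 1" "0 < r" "r < l" "l \<le> - \<sigma> * (v \<bullet> b)"
  shows "norm (v + r *\<^sub>R (\<sigma> *\<^sub>R b)) < norm v"
proof -
  have \<sigma>2: "\<sigma> * \<sigma> = 1" using assms(2) by (metis abs_mult_self_eq mult_1)
  have b2: "b \<bullet> b = 1" using assms(1) by (simp add: norm_eq_1)
  have "(norm (v + r *\<^sub>R (\<sigma> *\<^sub>R b)))\<^sup>2 = (norm v)\<^sup>2 + 2 * r * (\<sigma> * (v \<bullet> b)) + r * r * (\<sigma> * \<sigma>) * (b \<bullet> b)"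
    unfolding power2_norm_eq_inner by (simp add: inner_add_left inner_add_right inner_commute algebra_simps)
  also have "\<dots> \<le> (norm v)\<^sup>2 + 2 * r * (- l) + r * r"
    using mult_left_mono[OF assms(5), of r] assms(3) \<sigma>2 b2 by (simp add: algebra_simps)
  also have "\<dots> < (norm v)\<^sup>2"
  proof -
    have "r * r < r * l" "0 < r * l" using assms(3,4) by auto
    then show ?thesis by simp
  qed
  finally show ?thesis by (rule power2_less_imp_less) simp
qed

text \<open>By Pythagoras the squares of the components along \<open>b\<close> differ by at most
  \<open>(|v| + |w|)\<close> times the bracket on the right.  Dividing by the sum of the components, which have
  equal sign and are at least \<open>|v| / N\<close> and \<open>|w| / N\<close> in absolute value, leaves the claim.  The
  argument compares two arbitrary points, so it covers charts over nonconvex regions, such as those of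
  the cusp.\<close>

lemma chart_lipschitz:
  fixes v w :: "'a::real_inner"
  assumes b: "norm b = 1" and \<sigma>: "\<bar>\<sigma>\<bar> = 1" and N: "0 < N"
    and v: "norm v / N \<le> - \<sigma> * (v \<bullet> b)" and w: "norm w / N \<le> - \<sigma> * (w \<bullet> b)"
    and pos: "0 < norm v + norm w"
  shows "\<bar>(v - w) \<bullet> b\<bar> \<le> N * (\<bar>norm v - norm w\<bar> + norm ((v - w) - ((v - w) \<bullet> b) *\<^sub>R b))"
proof -
  define \<pi> where "\<pi> x = x - (x \<bullet> b) *\<^sub>R b" for x
  have b2: "b \<bullet> b = 1" using b by (simp add: norm_eq_1)
  have pyth: "(norm x)\<^sup>2 = (x \<bullet> b)\<^sup>2 + (norm (\<pi> x))\<^sup>2" for x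
    unfolding power2_norm_eq_inner \<pi>_def inner_diff_left inner_diff_right inner_scaleR_left
      inner_scaleR_right b2 inner_commute[of b x] by (simp add: power2_eq_square)
  have \<pi>le: "norm (\<pi> x) \<le> norm x" for x
  proof (rule power2_le_imp_le[OF _ norm_ge_zero])
    show "(norm (\<pi> x))\<^sup>2 \<le> (norm x)\<^sup>2" unfolding pyth[of x] by simp
  qed
  have \<pi>d: "\<pi> v - \<pi> w = \<pi> (v - w)"
    by (simp add: \<pi>_def inner_diff_left algebra_simps)
  let ?s = "norm v + norm w"
  have sum: "?s / N \<le> \<bar>v \<bullet> b + w \<bullet> b\<bar>"
  proof -
    have "?s / N \<le> - \<sigma> * (v \<bullet> b + w \<bullet> b)"
      using v w by (simp add: add_divide_distrib algebra_simps)
    also have "\<dots> \<le> \<bar>- \<sigma> * (v \<bullet> b + w \<bullet> b)\<bar>" by simp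
    also have "\<dots> = \<bar>v \<bullet> b + w \<bullet> b\<bar>" using \<sigma> by (simp only: abs_mult abs_minus_cancel mult_1)
    finally show ?thesis .
  qed
  have "\<bar>(v - w) \<bullet> b\<bar> * (?s / N) \<le> \<bar>(v - w) \<bullet> b\<bar> * \<bar>v \<bullet> b + w \<bullet> b\<bar>"
    using sum by (intro mult_left_mono) auto
  also have "\<dots> = \<bar>(norm v - norm w) * ?s - (norm (\<pi> v) - norm (\<pi> w)) * (norm (\<pi> v) + norm (\<pi> w))\<bar>"
    unfolding abs_mult[symmetric] using pyth[of v] pyth[of w]
    by (simp add: inner_diff_left power2_eq_square algebra_simps)
  also have "\<dots> \<le> \<bar>norm v - norm w\<bar> * ?s + \<bar>norm (\<pi> v) - norm (\<pi> w)\<bar> * (norm (\<pi> v) + norm (\<pi> w))"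
    by (rule order_trans[OF abs_triangle_ineq4]) (simp add: abs_mult)
  also have "\<dots> \<le> \<bar>norm v - norm w\<bar> * ?s + norm (\<pi> (v - w)) * ?s"
    unfolding \<pi>d[symmetric]
    by (intro add_mono mult_mono norm_triangle_ineq3 \<pi>le) auto
  finally have "\<bar>(v - w) \<bullet> b\<bar> * (?s / N) \<le> (\<bar>norm v - norm w\<bar> + norm (\<pi> (v - w))) * ?s"
    by (simp add: algebra_simps)
  then have "\<bar>(v - w) \<bullet> b\<bar> \<le> (\<bar>norm v - norm w\<bar> + norm (\<pi> (v - w))) * N"
    using mult_right_le_imp_le[OF _ pos, of "\<bar>(v - w) \<bullet> b\<bar> / N"] N
    by (simp add: pos_divide_le_eq)
  then show ?thesis by (simp add: \<pi>_def mult.commute)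
qed

lemma powr_lipschitz_unit:
  fixes a s t :: real
  assumes "1 \<le> a" "0 < s" "s \<le> 1" "0 < t" "t \<le> 1"
  shows "\<bar>s powr a - t powr a\<bar> \<le> a * \<bar>s - t\<bar>"
proof -
  have "norm (s powr a - t powr a) \<le> a * norm (s - t)"
  proof (rule field_differentiable_bound[where S = "{0<..1}" and f' = "\<lambda>x. a * x powr (a - 1)"])
    fix z :: real assume z: "z \<in> {0<..1}"
    then show "((\<lambda>x. x powr a) has_field_derivative a * z powr (a - 1)) (at z within {0<..1})"
      by (auto intro!: derivative_eq_intros)
    show "norm (a * z powr (a - 1)) \<le> a"
      using z assms powr_le1[of "a - 1" z] by (simp add: abs_mult mult_left_le)
  qed (use assms in auto)
  then show ?thesis by simp
qed

lemma mem_cusp_ball: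
  fixes x :: "'a::real_normed_vector"
  shows "(x, t) \<in> ball (0, 2 :: real) (sqrt 2) \<longleftrightarrow> (norm x)\<^sup>2 + (t - 2)\<^sup>2 < 2"
  by (simp add: dist_Pair_Pair dist_real_def power2_commute)

lemma ball_cusp_snd_gt:
  fixes z :: "'a::real_normed_vector \<times> real"
  assumes "z \<in> ball (0, 2 :: real) (sqrt 2)" shows "1 / 2 < snd z"
proof -
  obtain x t where z: "z = (x, t)" by (cases z)
  have "(t - 2)\<^sup>2 < 2" using assms mem_cusp_ball[of x t] z by (smt (verit) zero_le_power2)
  moreover have "(9/4 :: real) \<le> (t - 2)\<^sup>2" if "t \<le> 1 / 2"
    using that power_mono[of "3/2" "2 - t" 2] by (simp add: power2_commute[of t] power_divide)
  ultimately show ?thesis using z by force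
qed

text \<open>The parameter \<open>m\<close> only fixes the type that indexes the coordinates of \<open>x'\<close>, and \<open>a\<close> is the exponent of
  the profile.\<close>

locale cusp =
  fixes \<gamma> a p :: real and m :: "'m::finite itself"
  assumes a_def: "a = (\<gamma> - 1) / real CARD('m)"
    and \<gamma>: "real CARD('m) + 1 < \<gamma>" and p: "1 < p"
begin

abbreviation \<Omega> :: "((real ^ 'm) \<times> real) set" where "\<Omega> \<equiv> cusp_domain \<gamma>"
abbreviation B :: "((real ^ 'm) \<times> real) set" where "B \<equiv> ball (0, 2) (sqrt 2)"
abbreviation w :: "(real ^ 'm) \<times> real \<Rightarrow> real" where "w \<equiv> cusp_weight \<gamma>"
abbreviation H :: "((real ^ 'm) \<times> real) measure" where "H \<equiv> hausdorff_measure CARD('m)"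

text \<open>The parts of the domain and of its boundary above the height \<open>\<epsilon>\<close>.  They avoid the ball of radius
  \<open>\<epsilon>\<close> about the tip, since \<open>|z| \<ge> snd z\<close>.\<close>

definition upper :: "real \<Rightarrow> ((real ^ 'm) \<times> real) set" where "upper \<epsilon> = {z \<in> \<Omega>. \<epsilon> \<le> snd z}"
definition side :: "real \<Rightarrow> ((real ^ 'm) \<times> real) set" where "side \<epsilon> = {z \<in> frontier \<Omega>. \<epsilon> \<le> snd z}"

lemma a: "1 \<le> a" unfolding a_def using \<gamma> by (simp add: field_simps)

lemma profile: "cusp_profile (CARD('m) + 1) \<gamma> t = t powr a"
  by (simp add: cusp_profile_def a_def)

lemma mem_\<Omega>: "(x, t) \<in> \<Omega> \<longleftrightarrow> (norm x < t powr a \<and> 0 < t \<and> t \<le> 1) \<or> (x, t) \<in> B"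
  by (simp only: cusp_domain_def profile Un_iff mem_Collect_eq prod.case)

lemma w_eq: "w z = min (snd z powr a) 1"
  by (simp only: cusp_weight_def profile)

text \<open>The slice at \<open>t = 1\<close>, where the cusp is cut off, is contained in the ball.\<close>

lemma open_\<Omega>: "open \<Omega>"
proof -
  have "\<Omega> = {z \<in> {z. 0 < snd z}. norm (fst z) < snd z powr a} \<inter> {z. snd z < 1} \<union> B"
  proof -
    have "(x, t) \<in> B" if "norm x < t powr a" "t = 1" for x :: "real ^ 'm" and t
      using that mem_cusp_ball[of x t] by (simp add: abs_square_less_1)
    then have "(x, t) \<in> \<Omega> \<longleftrightarrow> (0 < t \<and> norm x < t powr a) \<and> t < 1 \<or> (x, t) \<in> B" for x t
      unfolding mem_\<Omega> less_le[of t 1] by blast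
    then show ?thesis by (intro set_eqI) (simp only: split_paired_all Un_iff Int_iff mem_Collect_eq fst_conv snd_conv)
  qed
  moreover have "open {z \<in> {z :: (real ^ 'm) \<times> real. 0 < snd z}. norm (fst z) < snd z powr a}"
  proof -
    have "continuous_on {z :: (real ^ 'm) \<times> real. 0 < snd z} (\<lambda>z. norm (fst z) - snd z powr a)"
      by (intro continuous_intros continuous_on_powr') auto
    from continuous_open_preimage[OF this open_Collect_less[OF continuous_on_const continuous_on_snd[OF continuous_on_id]], of "{..<0}"]
    show ?thesis by (simp add: vimage_def Int_def)
  qed
  ultimately show ?thesis
    by (auto intro!: open_Un open_Int open_Collect_less continuous_intros)
qed

text \<open>The sphere is not restricted to \<open>t \<ge> 1\<close>: just below \<open>t = 1\<close> the ball is wider than the cusp, because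
  \<open>t\<^sup>2\<^sup>\<alpha> + (2 - t)\<^sup>2\<close> has positive derivative at \<open>1\<close>.\<close>

lemma frontier_\<Omega>_subset:
  "frontier \<Omega> \<subseteq> {(x, t). 0 \<le> t \<and> t \<le> 1 \<and> norm x = t powr a} \<union> sphere (0, 2) (sqrt 2)"
proof
  fix z assume z: "z \<in> frontier \<Omega>"
  obtain x t where zt: "z = (x, t)" by (cases z)
  let ?C = "{z :: (real ^ 'm) \<times> real. 0 \<le> snd z} \<inter> {z. snd z \<le> 1}"
  have "closed {z \<in> ?C. norm (fst z) \<le> snd z powr a}"
  proof -
    have "continuous_on ?C (\<lambda>z. norm (fst z) - snd z powr a)"
      by (intro continuous_on_diff continuous_on_norm continuous_on_fst continuous_on_snd
          continuous_on_id continuous_on_powr' continuous_on_const) (use a in auto)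
    moreover have "closed ?C" by (intro closed_Int closed_Collect_le continuous_intros)
    ultimately have "closed (?C \<inter> (\<lambda>z. norm (fst z) - snd z powr a) -` {..0})"
      by (rule continuous_closed_preimage) simp
    then show ?thesis by (simp add: vimage_def Int_def)
  qed
  then have "closed ({z \<in> ?C. norm (fst z) \<le> snd z powr a} \<union> cball (0, 2) (sqrt 2))" by auto
  moreover have "\<Omega> \<subseteq> {z \<in> ?C. norm (fst z) \<le> snd z powr a} \<union> cball (0, 2) (sqrt 2)"
    by (auto simp: mem_\<Omega>)
  ultimately have "closure \<Omega> \<subseteq> {z \<in> ?C. norm (fst z) \<le> snd z powr a} \<union> cball (0, 2) (sqrt 2)"
    by (rule closure_minimal[rotated])
  then have 1: "(0 \<le> t \<and> t \<le> 1 \<and> norm x \<le> t powr a) \<or> z \<in> cball (0, 2) (sqrt 2)"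
    using z zt by (auto simp: frontier_def)
  have 2: "z \<notin> \<Omega>" using z open_\<Omega> by (auto simp: frontier_def interior_open)
  show "z \<in> {(x, t). 0 \<le> t \<and> t \<le> 1 \<and> norm x = t powr a} \<union> sphere (0, 2) (sqrt 2)"
  proof (cases "z \<in> cball (0, 2) (sqrt 2)")
    case True
    then show ?thesis using 2 zt mem_\<Omega>[of x t] by (auto simp: less_eq_real_def)
  next
    case False
    then have 3: "0 \<le> t" "t \<le> 1" "norm x \<le> t powr a" using 1 by auto
    then have "norm x = t powr a" using 2 zt mem_\<Omega>[of x t] by (cases "t = 0") auto
    then show ?thesis using 3 zt by auto
  qed
qed

lemma B_subset_upper: "\<epsilon> \<le> 1 / 2 \<Longrightarrow> B \<subseteq> upper \<epsilon>"
  using ball_cusp_snd_gt by (fastforce simp: upper_def mem_\<Omega> simp del: mem_ball)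

lemma borel_upper [measurable]: "upper \<epsilon> \<in> sets borel"
proof -
  have "upper \<epsilon> = \<Omega> \<inter> {z. \<epsilon> \<le> snd z}" by (auto simp: upper_def)
  then show ?thesis using
    sets.Int[OF borel_open[OF open_\<Omega>] borel_closed[OF closed_Collect_le[OF continuous_on_const continuous_on_snd[OF continuous_on_id], of \<epsilon>]]]
    by simp
qed

lemma borel_side [measurable]: "side \<epsilon> \<in> sets borel"
proof -
  have "side \<epsilon> = frontier \<Omega> \<inter> {z. \<epsilon> \<le> snd z}" by (auto simp: side_def)
  then show ?thesis by (auto intro!: borel_closed closed_Int closed_Collect_le continuous_intros)
qed

section \<open>The trace inequality on the boundary of the domain\<close>

text \<open>The points of the cusp surface whose radius vector has a component in direction \<open>- \<sigma> b\<close> that is a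
  fixed proportion of its length, so that the direction \<open>\<sigma> b\<close> leads inwards.\<close>

definition cusp_chart :: "real \<Rightarrow> real ^ 'm \<Rightarrow> real \<Rightarrow> ((real ^ 'm) \<times> real) set" where
  "cusp_chart \<epsilon> b \<sigma> = {(x, t). \<epsilon> \<le> t \<and> t \<le> 1 \<and> norm x = t powr a \<and>
     norm x / real CARD('m) \<le> - \<sigma> * (x \<bullet> b)}"

definition sphere_chart :: "(real ^ 'm) \<times> real \<Rightarrow> real \<Rightarrow> ((real ^ 'm) \<times> real) set" where
  "sphere_chart b \<sigma> = {z. norm (z - (0, 2)) = sqrt 2 \<and>
     norm (z - (0, 2)) / real (CARD('m) + 1) \<le> - \<sigma> * ((z - (0, 2)) \<bullet> b)}"

lemma side_subset_charts:
  assumes "z \<in> side \<epsilon>"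
  shows "(\<exists>b\<in>Basis. \<exists>\<sigma>\<in>{1, -1}. z \<in> cusp_chart \<epsilon> b \<sigma>) \<or> (\<exists>b\<in>Basis. \<exists>\<sigma>\<in>{1, -1}. z \<in> sphere_chart b \<sigma>)"
proof -
  obtain x t where z: "z = (x, t)" by (cases z)
  from assms frontier_\<Omega>_subset consider
    "\<epsilon> \<le> t" "t \<le> 1" "norm x = t powr a" | "z \<in> sphere (0, 2) (sqrt 2)"
    by (auto simp: side_def z)
  then show ?thesis
  proof cases
    case 1
    obtain b where b: "b \<in> Basis" "norm x / real DIM(real ^ 'm) \<le> \<bar>x \<bullet> b\<bar>"
      using large_coordinate[of x] .
    define \<sigma> :: real where "\<sigma> = (if 0 \<le> x \<bullet> b then -1 else 1)"
    have "z \<in> cusp_chart \<epsilon> b \<sigma>" "\<sigma> \<in> {1, -1}"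
      using 1 b by (auto simp: cusp_chart_def z \<sigma>_def)
    then show ?thesis using b(1) by blast
  next
    case 2
    let ?v = "z - (0, 2)"
    obtain b where b: "b \<in> Basis" "norm ?v / real DIM((real ^ 'm) \<times> real) \<le> \<bar>?v \<bullet> b\<bar>"
      using large_coordinate[of ?v] .
    have "norm ?v = sqrt 2" using 2 by (simp add: dist_norm norm_minus_commute)
    moreover define \<sigma> :: real where "\<sigma> = (if 0 \<le> ?v \<bullet> b then -1 else 1)"
    ultimately have "z \<in> sphere_chart b \<sigma>" "\<sigma> \<in> {1, -1}"
      using b by (auto simp: sphere_chart_def \<sigma>_def)
    then show ?thesis using b(1) by blast
  qed
qed

lemma borel_cusp_chart: "0 < \<epsilon> \<Longrightarrow> cusp_chart \<epsilon> b \<sigma> \<in> sets borel"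
proof -
  assume \<epsilon>: "0 < \<epsilon>"
  let ?C = "{z :: (real ^ 'm) \<times> real. \<epsilon> \<le> snd z} \<inter> {z. snd z \<le> 1}"
  have "closed ?C" by (intro closed_Int closed_Collect_le continuous_intros)
  moreover have "continuous_on ?C (\<lambda>z. norm (fst z) - snd z powr a)"
    using \<epsilon> a by (intro continuous_intros continuous_on_powr') auto
  ultimately have "closed (?C \<inter> (\<lambda>z. norm (fst z) - snd z powr a) -` {0})"
    using continuous_closed_preimage by blast
  moreover have "closed {z :: (real ^ 'm) \<times> real. norm (fst z) / real CARD('m) \<le> - \<sigma> * (fst z \<bullet> b)}"
    by (intro closed_Collect_le continuous_intros) auto
  moreover have "cusp_chart \<epsilon> b \<sigma> = (?C \<inter> (\<lambda>z. norm (fst z) - snd z powr a) -` {0})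
      \<inter> {z. norm (fst z) / real CARD('m) \<le> - \<sigma> * (fst z \<bullet> b)}"
    by (auto simp: cusp_chart_def)
  ultimately have "closed (cusp_chart \<epsilon> b \<sigma>)" by (simp only: closed_Int)
  then show ?thesis by (rule borel_closed)
qed

lemma bounded_cusp_chart: "0 < \<epsilon> \<Longrightarrow> bounded (cusp_chart \<epsilon> b \<sigma>)"
  unfolding bounded_iff
proof (intro exI ballI)
  fix z assume "0 < \<epsilon>" "z \<in> cusp_chart \<epsilon> b \<sigma>"
  moreover obtain x t where zt: "z = (x, t)" by (cases z)
  ultimately have z: "z = (x, t)" "0 < t" "t \<le> 1" "norm x = t powr a"
    by (simp_all add: cusp_chart_def)
  then have "norm x \<le> 1" "norm t \<le> 1" using a by (auto intro: powr_le1)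
  then show "norm z \<le> 1 + 1" using norm_Pair_le[of x t] z by simp
qed

lemma borel_sphere_chart: "sphere_chart b \<sigma> \<in> sets borel"
  unfolding sphere_chart_def
  by (intro borel_closed closed_Collect_conj closed_Collect_eq closed_Collect_le continuous_intros) auto

lemma bounded_sphere_chart: "bounded (sphere_chart b \<sigma>)"
proof (rule bounded_subset[of "sphere (0, 2) (sqrt 2)"])
  show "sphere_chart b \<sigma> \<subseteq> sphere (0, 2) (sqrt 2)"
  proof
    fix z assume "z \<in> sphere_chart b \<sigma>"
    then have "dist z (0, 2) = sqrt 2" unfolding sphere_chart_def dist_norm by blast
    then show "z \<in> sphere (0, 2) (sqrt 2)" by (simp only: mem_sphere dist_commute)
  qed
qed simp

definition chart_const :: "real \<Rightarrow> real" where
  "chart_const L = 4 powr p * (unit_ball_vol (real DIM(real ^ 'm))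
     * ((1 + L) * real DIM(real ^ 'm) / 2) ^ DIM(real ^ 'm))"

text \<open>The inward segment at \<open>(x, t)\<close> has length \<open>|x| / m = t\<^sup>\<alpha> / m\<close>, hence the weight is at most
  \<open>m\<close> times the length.  The slope of the graph is controlled because \<open>t\<^sup>\<alpha>\<close> is Lipschitz on the unit
  interval.\<close>

lemma trace_cusp_chart:
  assumes \<phi>: "C1_grad \<phi> G" and \<epsilon>: "0 < \<epsilon>" and b: "b \<in> Basis" and \<sigma>: "\<bar>\<sigma>\<bar> = 1"
  shows "(\<integral>\<^sup>+z\<in>cusp_chart \<epsilon> b \<sigma>. ennreal (\<bar>\<phi> z\<bar> powr p * w z) \<partial>H)
    \<le> ennreal (real CARD('m) * chart_const (real CARD('m) * (a + 1)))
      * (\<integral>\<^sup>+x\<in>upper \<epsilon>. energy_density p \<phi> G x \<partial>lborel)"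
proof -
  let ?m = "real CARD('m)"
  define l where "l z = norm (fst z) / ?m" for z :: "(real ^ 'm) \<times> real"
  have lm: "l \<in> borel_measurable borel"
    unfolding l_def by (intro borel_measurable_continuous_onI continuous_intros) auto
  have m1: "1 \<le> ?m" by (simp add: Suc_le_eq)
  have nb: "norm b = 1" using b by simp
  have chart: "(\<integral>\<^sup>+z\<in>cusp_chart \<epsilon> b \<sigma>. ennreal (\<bar>\<phi> z\<bar> powr p * l z) \<partial>hausdorff_measure DIM(real ^ 'm))
    \<le> ennreal (chart_const (?m * (a + 1))) * (\<integral>\<^sup>+x\<in>upper \<epsilon>. energy_density p \<phi> G x \<partial>lborel)"
    unfolding chart_const_def
  proof (rule trace_chart[OF \<phi> p, where b = "(b, 0)" and \<sigma> = \<sigma>])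
    fix z z' assume zz: "z \<in> cusp_chart \<epsilon> b \<sigma>" "z' \<in> cusp_chart \<epsilon> b \<sigma>"
    obtain x t where z: "z = (x, t)" by (cases z)
    obtain x' t' where z': "z' = (x', t')" by (cases z')
    have t: "0 < t" "t \<le> 1" "norm x = t powr a" "norm x / ?m \<le> - \<sigma> * (x \<bullet> b)"
      using zz(1) \<epsilon> unfolding cusp_chart_def z by auto
    have t': "0 < t'" "t' \<le> 1" "norm x' = t' powr a" "norm x' / ?m \<le> - \<sigma> * (x' \<bullet> b)"
      using zz(2) \<epsilon> unfolding cusp_chart_def z' by auto
    define u where "u = (x - x') - ((x - x') \<bullet> b) *\<^sub>R b"
    have eq: "(z - z') - ((z - z') \<bullet> (b, 0)) *\<^sub>R (b, 0) = (u, t - t')"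
      by (simp add: z z' u_def)
    have "\<bar>(x - x') \<bullet> b\<bar> \<le> ?m * (\<bar>norm x - norm x'\<bar> + norm u)"
    proof -
      have "0 < norm x + norm x'" unfolding t(3) t'(3) using t(1) t'(1) by (intro add_pos_pos) simp_all
      then show ?thesis
        unfolding u_def using m1 by (intro chart_lipschitz[OF nb \<sigma> _ t(4) t'(4)]) simp_all
    qed
    also have "\<dots> \<le> ?m * (a * \<bar>t - t'\<bar> + norm u)"
      using powr_lipschitz_unit[OF a, of t t'] t t' by (intro mult_left_mono add_right_mono) auto
    also have "\<dots> \<le> ?m * (a * norm (u, t - t') + norm (u, t - t'))"
      using norm_fst_le[of u "t - t'"] norm_snd_le[of "t - t'" u] a
      by (intro mult_left_mono add_mono) auto
    finally show "\<bar>(z - z') \<bullet> (b, 0)\<bar> \<le> ?m * (a + 1) * norm ((z - z') - ((z - z') \<bullet> (b, 0)) *\<^sub>R (b, 0))"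
      unfolding eq by (simp add: z z' algebra_simps)
  next
    fix z assume "z \<in> cusp_chart \<epsilon> b \<sigma>"
    moreover obtain x t where zt: "z = (x, t)" by (cases z)
    ultimately have z: "z = (x, t)" "0 < t" "\<epsilon> \<le> t" "t \<le> 1" "norm x = t powr a"
      "norm x / ?m \<le> - \<sigma> * (x \<bullet> b)"
      using \<epsilon> unfolding cusp_chart_def by auto
    have "t powr a \<le> 1" using z a by (intro powr_le1) auto
    then show "0 < l z \<and> l z \<le> 1" using z(1,2,5) m1 order_trans[of "t powr a" 1 ?m] by (simp add: l_def divide_le_eq)
    fix r assume r: "0 < r" "r < l z"
    have "norm (x + r *\<^sub>R (\<sigma> *\<^sub>R b)) < norm x"
      using r z by (intro norm_shift_less[OF nb \<sigma>, of r "l z"]) (auto simp: l_def)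
    then show "z + r *\<^sub>R (\<sigma> *\<^sub>R (b, 0)) \<in> upper \<epsilon>"
      using z by (simp add: upper_def mem_\<Omega> del: mem_ball)
  qed (use b \<sigma> m1 a borel_cusp_chart[OF \<epsilon>] bounded_cusp_chart[OF \<epsilon>] in \<open>auto simp: Basis_prod_def\<close>)
  have "(\<integral>\<^sup>+z\<in>cusp_chart \<epsilon> b \<sigma>. ennreal (\<bar>\<phi> z\<bar> powr p * w z) \<partial>H)
      \<le> (\<integral>\<^sup>+z. ennreal ?m * (ennreal (\<bar>\<phi> z\<bar> powr p * l z) * indicator (cusp_chart \<epsilon> b \<sigma>) z) \<partial>H)"
  proof (rule nn_integral_mono)
    fix z
    have "ennreal (\<bar>\<phi> z\<bar> powr p * w z) \<le> ennreal ?m * ennreal (\<bar>\<phi> z\<bar> powr p * l z)"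
      if "z \<in> cusp_chart \<epsilon> b \<sigma>"
      using that m1 by (auto simp: ennreal_mult[symmetric] cusp_chart_def l_def w_eq
          intro!: ennreal_leI mult_left_mono)
    then show "ennreal (\<bar>\<phi> z\<bar> powr p * w z) * indicator (cusp_chart \<epsilon> b \<sigma>) z
        \<le> ennreal ?m * (ennreal (\<bar>\<phi> z\<bar> powr p * l z) * indicator (cusp_chart \<epsilon> b \<sigma>) z)"
      by (auto simp: indicator_def)
  qed
  also have "\<dots> = ennreal ?m * (\<integral>\<^sup>+z\<in>cusp_chart \<epsilon> b \<sigma>. ennreal (\<bar>\<phi> z\<bar> powr p * l z) \<partial>H)"
    using C1_grad_measurable(1)[OF \<phi>] borel_cusp_chart[OF \<epsilon>, of b \<sigma>] lm
    by (intro nn_integral_cmult) auto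
  also have "\<dots> \<le> ennreal ?m * (ennreal (chart_const (?m * (a + 1))) * (\<integral>\<^sup>+x\<in>upper \<epsilon>. energy_density p \<phi> G x \<partial>lborel))"
    using chart by (intro mult_left_mono) simp_all
  finally show ?thesis by (simp add: ennreal_mult' mult.assoc)
qed

text \<open>Here the inward segments have a fixed length and the weight is at most \<open>1\<close>.\<close>

lemma trace_sphere_chart:
  assumes \<phi>: "C1_grad \<phi> G" and \<epsilon>: "0 < \<epsilon>" "\<epsilon> \<le> 1 / 2" and b: "b \<in> Basis" and \<sigma>: "\<bar>\<sigma>\<bar> = 1"
  shows "(\<integral>\<^sup>+z\<in>sphere_chart b \<sigma>. ennreal (\<bar>\<phi> z\<bar> powr p * w z) \<partial>H)
    \<le> ennreal (real (CARD('m) + 1) / sqrt 2 * chart_const (real (CARD('m) + 1)))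
      * (\<integral>\<^sup>+x\<in>upper \<epsilon>. energy_density p \<phi> G x \<partial>lborel)"
proof -
  let ?n = "real (CARD('m) + 1)"
  define l where "l = sqrt 2 / ?n"
  have n2: "2 \<le> ?n" by (simp add: Suc_le_eq)
  have l: "0 < l" "l \<le> 1"
    using n2 real_sqrt_le_iff[of 2 4] order_trans[of "sqrt 2" 2 ?n] by (auto simp: l_def divide_le_eq)
  have nb: "norm b = 1" using b by simp
  have chart: "(\<integral>\<^sup>+z\<in>sphere_chart b \<sigma>. ennreal (\<bar>\<phi> z\<bar> powr p * l) \<partial>hausdorff_measure DIM(real ^ 'm))
    \<le> ennreal (chart_const ?n) * (\<integral>\<^sup>+x\<in>upper \<epsilon>. energy_density p \<phi> G x \<partial>lborel)"
    unfolding chart_const_def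
  proof (rule trace_chart[OF \<phi> p b \<sigma>])
    fix z z' assume zz: "z \<in> sphere_chart b \<sigma>" "z' \<in> sphere_chart b \<sigma>"
    let ?v = "z - (0, 2)" and ?w = "z' - (0, 2)"
    have v: "norm ?v = sqrt 2" "norm ?v / ?n \<le> - \<sigma> * (?v \<bullet> b)"
      and w: "norm ?w = sqrt 2" "norm ?w / ?n \<le> - \<sigma> * (?w \<bullet> b)"
      using zz unfolding sphere_chart_def by blast+
    have "0 < norm ?v + norm ?w" "0 < ?n" unfolding v(1) w(1) by simp_all
    then have "\<bar>(?v - ?w) \<bullet> b\<bar> \<le> ?n * (\<bar>norm ?v - norm ?w\<bar> + norm ((?v - ?w) - ((?v - ?w) \<bullet> b) *\<^sub>R b))"
      by (intro chart_lipschitz[OF nb \<sigma> _ v(2) w(2)])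
    moreover have "norm ?v = norm ?w" unfolding v(1) w(1) ..
    ultimately show "\<bar>(z - z') \<bullet> b\<bar> \<le> ?n * norm ((z - z') - ((z - z') \<bullet> b) *\<^sub>R b)" by simp
  next
    fix z r assume z: "z \<in> sphere_chart b \<sigma>" and r: "0 < r" "r < l"
    have "norm ((z - (0, 2)) + r *\<^sub>R (\<sigma> *\<^sub>R b)) < norm (z - (0, 2))"
      using r z by (intro norm_shift_less[OF nb \<sigma>, of r l]) (auto simp: l_def sphere_chart_def)
    then have "z + r *\<^sub>R (\<sigma> *\<^sub>R b) \<in> B"
      using z by (simp add: sphere_chart_def dist_norm norm_minus_commute algebra_simps)
    then show "z + r *\<^sub>R (\<sigma> *\<^sub>R b) \<in> upper \<epsilon>" using B_subset_upper[OF \<epsilon>(2)] by blast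
  qed (use l n2 borel_sphere_chart bounded_sphere_chart in auto)
  have "(\<integral>\<^sup>+z\<in>sphere_chart b \<sigma>. ennreal (\<bar>\<phi> z\<bar> powr p * w z) \<partial>H)
      \<le> (\<integral>\<^sup>+z. ennreal (1 / l) * (ennreal (\<bar>\<phi> z\<bar> powr p * l) * indicator (sphere_chart b \<sigma>) z) \<partial>H)"
  proof (rule nn_integral_mono)
    fix z
    have "ennreal (\<bar>\<phi> z\<bar> powr p * w z) \<le> ennreal (1 / l) * ennreal (\<bar>\<phi> z\<bar> powr p * l)"
      using l by (auto simp: ennreal_mult[symmetric] w_eq mult_left_le intro!: ennreal_leI)
    then show "ennreal (\<bar>\<phi> z\<bar> powr p * w z) * indicator (sphere_chart b \<sigma>) z
        \<le> ennreal (1 / l) * (ennreal (\<bar>\<phi> z\<bar> powr p * l) * indicator (sphere_chart b \<sigma>) z)"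
      by (auto simp: indicator_def)
  qed
  also have "\<dots> = ennreal (1 / l) * (\<integral>\<^sup>+z\<in>sphere_chart b \<sigma>. ennreal (\<bar>\<phi> z\<bar> powr p * l) \<partial>H)"
    using C1_grad_measurable(1)[OF \<phi>] borel_sphere_chart[of b \<sigma>]
    by (intro nn_integral_cmult) auto
  also have "\<dots> \<le> ennreal (1 / l) * (ennreal (chart_const ?n) * (\<integral>\<^sup>+x\<in>upper \<epsilon>. energy_density p \<phi> G x \<partial>lborel))"
    using chart by (intro mult_left_mono) simp_all
  also have "ennreal (1 / l) * (ennreal (chart_const ?n) * (\<integral>\<^sup>+x\<in>upper \<epsilon>. energy_density p \<phi> G x \<partial>lborel))
      = ennreal (?n / sqrt 2 * chart_const ?n) * (\<integral>\<^sup>+x\<in>upper \<epsilon>. energy_density p \<phi> G x \<partial>lborel)"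
    using ennreal_mult'[of "1 / l" "chart_const ?n"] l by (simp add: l_def mult.assoc)
  finally show ?thesis .
qed

definition trace_const :: real where
  "trace_const = 2 * real CARD('m) * (real CARD('m) * chart_const (real CARD('m) * (a + 1)))
    + 2 * real (CARD('m) + 1) * (real (CARD('m) + 1) / sqrt 2 * chart_const (real (CARD('m) + 1)))"

lemma borel_w [measurable]: "w \<in> borel_measurable borel"
proof -
  have "(\<lambda>z :: (real ^ 'm) \<times> real. snd z) \<in> borel_measurable borel"
    by (rule borel_measurable_continuous_onI[OF continuous_on_snd[OF continuous_on_id]])
  then have "(\<lambda>z :: (real ^ 'm) \<times> real. min (snd z powr a) 1) \<in> borel_measurable borel"
    by measurable
  then show ?thesis by (simp add: w_eq[abs_def])
qed

lemma chart_const_nonneg: "0 \<le> L \<Longrightarrow> 0 \<le> chart_const L"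
  unfolding chart_const_def by (intro mult_nonneg_nonneg zero_le_power unit_ball_vol_nonneg) auto

lemma trace_side:
  assumes \<phi>: "C1_grad \<phi> G" and \<epsilon>: "0 < \<epsilon>" "\<epsilon> \<le> 1 / 2"
  shows "(\<integral>\<^sup>+z\<in>side \<epsilon>. ennreal (\<bar>\<phi> z\<bar> powr p * w z) \<partial>H)
    \<le> ennreal trace_const * (\<integral>\<^sup>+x\<in>upper \<epsilon>. energy_density p \<phi> G x \<partial>lborel)"
proof -
  let ?f = "\<lambda>z. ennreal (\<bar>\<phi> z\<bar> powr p * w z)"
  let ?E = "\<integral>\<^sup>+x\<in>upper \<epsilon>. energy_density p \<phi> G x \<partial>lborel"
  let ?c1 = "real CARD('m) * chart_const (real CARD('m) * (a + 1))"
  let ?c2 = "real (CARD('m) + 1) / sqrt 2 * chart_const (real (CARD('m) + 1))"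
  let ?I = "(Basis :: (real ^ 'm) set) \<times> {1 :: real, -1}"
  let ?J = "(Basis :: ((real ^ 'm) \<times> real) set) \<times> {1 :: real, -1}"
  let ?X = "\<lambda>i. cusp_chart \<epsilon> (fst i) (snd i)" and ?Y = "\<lambda>j. sphere_chart (fst j) (snd j)"
  have fm: "?f \<in> borel_measurable borel"
    using C1_grad_measurable(1)[OF \<phi>] by measurable
  have X: "?X i \<in> sets borel" and Y: "?Y j \<in> sets borel" for i j
    using borel_cusp_chart[OF \<epsilon>(1)] borel_sphere_chart by auto
  have c12: "0 \<le> ?c1" "0 \<le> ?c2"
    using a by (simp_all add: chart_const_nonneg)
  have "(\<integral>\<^sup>+z\<in>side \<epsilon>. ?f z \<partial>H) \<le>
    (\<integral>\<^sup>+z. (\<Sum>i\<in>?I. ?f z * indicator (?X i) z) + (\<Sum>j\<in>?J. ?f z * indicator (?Y j) z) \<partial>H)"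
  proof (rule nn_integral_mono)
    fix z
    show "?f z * indicator (side \<epsilon>) z
        \<le> (\<Sum>i\<in>?I. ?f z * indicator (?X i) z) + (\<Sum>j\<in>?J. ?f z * indicator (?Y j) z)"
    proof (cases "z \<in> side \<epsilon>")
      case True
      from side_subset_charts[OF True]
      have "(\<exists>i\<in>?I. z \<in> ?X i) \<or> (\<exists>j\<in>?J. z \<in> ?Y j)" by fastforce
      then show ?thesis
      proof (elim disjE bexE)
        fix i assume "i \<in> ?I" "z \<in> ?X i"
        then have "?f z \<le> (\<Sum>i\<in>?I. ?f z * indicator (?X i) z)"
          using member_le_sum[of i ?I "\<lambda>i. ?f z * indicator (?X i) z"] by simp
        then show ?thesis using True by (simp add: add_increasing2)
      next
        fix j assume "j \<in> ?J" "z \<in> ?Y j"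
        then have "?f z \<le> (\<Sum>j\<in>?J. ?f z * indicator (?Y j) z)"
          using member_le_sum[of j ?J "\<lambda>j. ?f z * indicator (?Y j) z"] by simp
        then show ?thesis using True by (simp add: add_increasing)
      qed
    qed simp
  qed
  also have "\<dots> = (\<Sum>i\<in>?I. \<integral>\<^sup>+z\<in>?X i. ?f z \<partial>H) + (\<Sum>j\<in>?J. \<integral>\<^sup>+z\<in>?Y j. ?f z \<partial>H)"
  proof -
    have mX: "(\<lambda>z. ?f z * indicator (?X i) z) \<in> borel_measurable H"
      and mY: "(\<lambda>z. ?f z * indicator (?Y j) z) \<in> borel_measurable H" for i j
      using fm X Y by simp_all
    show ?thesis
      unfolding nn_integral_add[OF borel_measurable_sum[OF mX] borel_measurable_sum[OF mY]]
        nn_integral_sum[OF mX] nn_integral_sum[OF mY] ..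
  qed
  also have "\<dots> \<le> (\<Sum>i\<in>?I. ennreal ?c1 * ?E) + (\<Sum>j\<in>?J. ennreal ?c2 * ?E)"
  proof (intro add_mono sum_mono)
    fix i assume "i \<in> ?I"
    then show "(\<integral>\<^sup>+z\<in>?X i. ?f z \<partial>H) \<le> ennreal ?c1 * ?E"
      using trace_cusp_chart[OF \<phi> \<epsilon>(1), of "fst i" "snd i"] by fastforce
  next
    fix j assume "j \<in> ?J"
    then show "(\<integral>\<^sup>+z\<in>?Y j. ?f z \<partial>H) \<le> ennreal ?c2 * ?E"
      using trace_sphere_chart[OF \<phi> \<epsilon>, of "fst j" "snd j"] by fastforce
  qed
  also have "\<dots> = (ennreal (real (card ?I) * ?c1) + ennreal (real (card ?J) * ?c2)) * ?E"
    using c12 by (simp only: sum_constant distrib_right ennreal_mult' mult.assoc of_nat_0_le_iff ennreal_of_nat_eq_real_of_nat)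
  also have "ennreal (real (card ?I) * ?c1) + ennreal (real (card ?J) * ?c2) = ennreal trace_const"
  proof -
    have "ennreal (real (card ?I) * ?c1) + ennreal (real (card ?J) * ?c2)
        = ennreal (real (card ?I) * ?c1 + real (card ?J) * ?c2)"
      by (rule ennreal_plus[symmetric, OF mult_nonneg_nonneg[OF of_nat_0_le_iff c12(1)]
            mult_nonneg_nonneg[OF of_nat_0_le_iff c12(2)]])
    also have "real (card ?I) * ?c1 + real (card ?J) * ?c2 = trace_const"
      by (simp add: trace_const_def card_cartesian_product)
    finally show ?thesis .
  qed
  finally show ?thesis .
qed

end

section \<open>Poincare inequalities for smooth functions\<close>

lemma nn_integral_lborel_iterated:
  fixes k :: "'a::euclidean_space \<times> 'b::euclidean_space \<Rightarrow> ennreal"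
  assumes "k \<in> borel_measurable borel"
  shows "(\<integral>\<^sup>+z. k z \<partial>lborel) = (\<integral>\<^sup>+x. \<integral>\<^sup>+y. k (x, y) \<partial>lborel \<partial>lborel)"
proof -
  have "k \<in> borel_measurable (lborel \<Otimes>\<^sub>M lborel)" using assms by (simp add: lborel_prod)
  from lborel.nn_integral_fst[OF this] show ?thesis by (simp add: lborel_prod)
qed

lemma nn_integral_affine_le:
  fixes g :: "'a::euclidean_space \<Rightarrow> ennreal"
  assumes g: "g \<in> borel_measurable borel" and c: "1 / 2 \<le> c"
  shows "(\<integral>\<^sup>+x. g (t + c *\<^sub>R x) \<partial>lborel) \<le> 2 ^ DIM('a) * (\<integral>\<^sup>+x. g x \<partial>lborel)"
proof -
  have "(\<integral>\<^sup>+x. g x \<partial>lborel) = (\<integral>\<^sup>+x. g x \<partial>density (distr lborel borel (\<lambda>x. t + c *\<^sub>R x)) (\<lambda>_. \<bar>c\<bar> ^ DIM('a)))"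
    using lborel_affine[of c t] c by simp
  also have "\<dots> = ennreal (c ^ DIM('a)) * (\<integral>\<^sup>+x. g (t + c *\<^sub>R x) \<partial>lborel)"
    using g c by (simp add: nn_integral_density nn_integral_distr nn_integral_cmult)
  finally have "2 ^ DIM('a) * (\<integral>\<^sup>+x. g x \<partial>lborel)
      = ennreal ((2 * c) ^ DIM('a)) * (\<integral>\<^sup>+x. g (t + c *\<^sub>R x) \<partial>lborel)"
    using c by (simp add: power_mult_distrib ennreal_mult mult.assoc ennreal_power[symmetric])
  moreover have "1 \<le> ennreal ((2 * c) ^ DIM('a))"
    using c one_le_power[of "2 * c" "DIM('a)"] by (simp add: ennreal_ge_1)
  ultimately show ?thesis
    using mult_right_mono[of 1 "ennreal ((2 * c) ^ DIM('a))"] by simp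
qed

lemma C1_diff_le_segment:
  fixes \<phi> :: "'a::euclidean_space \<Rightarrow> real"
  assumes \<phi>: "C1_grad \<phi> G" and p: "1 < p" and xy: "x \<in> ball c \<rho>" "y \<in> ball c \<rho>"
  shows "ennreal (\<bar>\<phi> x - \<phi> y\<bar> powr p) \<le> ennreal ((8 * \<rho>) powr p) *
    (\<integral>\<^sup>+s\<in>{0..1}. ennreal (norm (G (x + s *\<^sub>R (y - x))) powr p) * indicator (ball c \<rho>) (x + s *\<^sub>R (y - x)) \<partial>lborel)"
proof -
  have "dist x y \<le> dist x c + dist c y" by (rule dist_triangle)
  then have d: "norm (y - x) \<le> 2 * \<rho>" using xy by (simp add: dist_commute dist_norm norm_minus_commute)
  have \<rho>: "0 < \<rho>" using xy le_less_trans[OF zero_le_dist[of c x]] by simp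
  have seg: "x + s *\<^sub>R (y - x) \<in> ball c \<rho>" if "s \<in> {0..1}" for s
  proof -
    have "x + s *\<^sub>R (y - x) = (1 - s) *\<^sub>R x + s *\<^sub>R y" by (simp add: algebra_simps)
    then show ?thesis using convexD_alt[OF convex_ball xy, of s] that by simp
  qed
  have "ennreal (\<bar>\<phi> x - \<phi> y\<bar> powr p) \<le> ennreal (4 powr p * norm (y - x) powr p)
      * (\<integral>\<^sup>+s\<in>{0..1}. ennreal (norm (G (x + s *\<^sub>R (y - x))) powr p) \<partial>lborel)"
    using C1_line_bound[OF C1_grad_diff_const[OF \<phi>, of "\<phi> y"], of 1 1 p x "y - x"] p by simp
  also have "\<dots> \<le> ennreal ((8 * \<rho>) powr p) *
      (\<integral>\<^sup>+s\<in>{0..1}. ennreal (norm (G (x + s *\<^sub>R (y - x))) powr p) * indicator (ball c \<rho>) (x + s *\<^sub>R (y - x)) \<partial>lborel)"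
  proof (rule mult_mono[OF ennreal_leI nn_integral_mono])
    have "4 powr p * norm (y - x) powr p \<le> 4 powr p * (2 * \<rho>) powr p"
      using d p by (intro mult_left_mono powr_mono2) auto
    also have "\<dots> = (8 * \<rho>) powr p" using powr_mult[of 4 "2 * \<rho>" p] \<rho> by simp
    finally show "4 powr p * norm (y - x) powr p \<le> (8 * \<rho>) powr p" .
    fix s
    show "ennreal (norm (G (x + s *\<^sub>R (y - x))) powr p) * indicator {0..1} s
        \<le> ennreal (norm (G (x + s *\<^sub>R (y - x))) powr p) * indicator (ball c \<rho>) (x + s *\<^sub>R (y - x))
          * indicator {0..1} s"
      using seg[of s] by (cases "s \<in> {0..1}") simp_all
  qed auto
  finally show ?thesis .
qed

text \<open>Integrate the bound of \<open>|\<phi> x - \<phi> y|\<^sup>p\<close> along the segment from \<open>x\<close> to \<open>y\<close> over all pairs of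
  points.  At the parameter \<open>s\<close> of the segment the integrand depends on \<open>(1 - s) x + s y\<close>; one of the
  two factors is at least \<open>1/2\<close>, and the substitution is made in that variable, at a cost of at most
  \<open>2\<^sup>n\<close>.  So the average over \<open>y\<close> of the left side is bounded, and some \<open>y\<close> does as well as the
  average up to the slack \<open>\<eta>\<close>.\<close>

lemma ball_poincare:
  fixes \<phi> :: "'a::euclidean_space \<Rightarrow> real"
  assumes \<phi>: "C1_grad \<phi> G" and p: "1 < p" and \<rho>: "0 < \<rho>" and \<eta>: "0 < \<eta>"
  shows "\<exists>y. (\<integral>\<^sup>+x\<in>ball c \<rho>. ennreal (\<bar>\<phi> x - \<phi> y\<bar> powr p) \<partial>lborel)
    \<le> ennreal ((8 * \<rho>) powr p * 2 ^ DIM('a)) *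
      ((\<integral>\<^sup>+x\<in>ball c \<rho>. ennreal (norm (G x) powr p) \<partial>lborel) + ennreal \<eta>)"
proof (rule ccontr)
  let ?B = "ball c \<rho>" and ?n = "DIM('a)"
  let ?I = "\<integral>\<^sup>+x\<in>?B. ennreal (norm (G x) powr p) \<partial>lborel"
  define K where "K = (8 * \<rho>) powr p * 2 ^ ?n"
  define \<Psi> where "\<Psi> y = (\<integral>\<^sup>+x\<in>?B. ennreal (\<bar>\<phi> x - \<phi> y\<bar> powr p) \<partial>lborel)" for y
  assume neg: "\<not> ?thesis"
  then have large: "ennreal K * (?I + ennreal \<eta>) \<le> \<Psi> y" for y
    by (auto simp: K_def \<Psi>_def not_le intro: less_imp_le)
  have K: "0 < K" using \<rho> by (simp add: K_def)
  have Ifin: "?I < top"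
  proof (rule ccontr)
    assume "\<not> ?I < top"
    then have "?I = top" by (simp add: not_less top_unique)
    then have "ennreal K * (?I + ennreal \<eta>) = top" using K by (simp add: ennreal_mult_top)
    then show False using neg by (auto simp: K_def)
  qed
  define g where "g x = ennreal (norm (G x) powr p) * indicator ?B x" for x
  have [measurable]: "?B \<in> sets borel" by simp
  have g [measurable]: "g \<in> borel_measurable borel"
    using C1_grad_measurable(2)[OF \<phi>] unfolding g_def by measurable
  define k where "k y x s = indicator ?B y * (indicator ?B x * (indicator {0..1::real} s * g (x + s *\<^sub>R (y - x))))"
    for x y s
  have kyxs: "(\<lambda>(y, x, s). k y x s) \<in> borel_measurable borel"
  proof -
    have "continuous_on UNIV (\<lambda>(y, x, s). x + s *\<^sub>R (y - x) :: 'a)"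
      unfolding case_prod_unfold by (intro continuous_intros)
    from measurable_compose[OF borel_measurable_continuous_onI[OF this] g]
    have 1: "(\<lambda>(y, x, s). g (x + s *\<^sub>R (y - x))) \<in> borel_measurable borel"
      by (simp add: case_prod_unfold)
    have 2: "fst \<in> borel_measurable borel" "(\<lambda>q. fst (snd q)) \<in> borel_measurable borel"
      "(\<lambda>q. snd (snd q)) \<in> borel_measurable borel"
      for q :: "'a \<times> 'a \<times> real"
      by (intro borel_measurable_continuous_onI continuous_intros)+
    show ?thesis
      using 1 unfolding k_def case_prod_unfold
      by (intro borel_measurable_times_ennreal measurable_compose[OF 2(1)] measurable_compose[OF 2(2)]
          measurable_compose[OF 2(3)] borel_measurable_indicator) auto
  qed
  have sub: "(\<lambda>q. k (fst (h q)) (fst (snd (h q))) (snd (snd (h q)))) \<in> borel_measurable borel"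
    if "continuous_on UNIV h" for h :: "'b::euclidean_space \<Rightarrow> 'a \<times> 'a \<times> real"
    using measurable_compose[OF borel_measurable_continuous_onI[OF that] kyxs] by (simp add: case_prod_unfold)
  have sub_pair: "(\<lambda>q. k (fst (h q)) (fst (snd (h q))) (snd (snd (h q)))) \<in> borel_measurable (lborel \<Otimes>\<^sub>M lborel)"
    if "continuous_on UNIV h" for h :: "'b::euclidean_space \<times> 'c::euclidean_space \<Rightarrow> 'a \<times> 'a \<times> real"
    using measurable_compose[OF borel_measurable_continuous_onI[OF that] kyxs]
    by (simp add: case_prod_unfold lborel_prod)
  have Iy: "indicator ?B y * \<Psi> y \<le> ennreal ((8 * \<rho>) powr p) * (\<integral>\<^sup>+x. \<integral>\<^sup>+s. k y x s \<partial>lborel \<partial>lborel)" for y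
  proof (cases "y \<in> ?B")
    case True
    have "\<Psi> y \<le> (\<integral>\<^sup>+x. ennreal ((8 * \<rho>) powr p) * (\<integral>\<^sup>+s. k y x s \<partial>lborel) \<partial>lborel)"
      unfolding \<Psi>_def
    proof (rule nn_integral_mono)
      fix x
      show "ennreal (\<bar>\<phi> x - \<phi> y\<bar> powr p) * indicator ?B x
          \<le> ennreal ((8 * \<rho>) powr p) * (\<integral>\<^sup>+s. k y x s \<partial>lborel)"
      proof (cases "x \<in> ?B")
        case x: True
        have "(\<integral>\<^sup>+s. k y x s \<partial>lborel) = (\<integral>\<^sup>+s\<in>{0..1}. ennreal (norm (G (x + s *\<^sub>R (y - x))) powr p)
            * indicator ?B (x + s *\<^sub>R (y - x)) \<partial>lborel)"
          using True x by (intro nn_integral_cong) (simp add: k_def g_def mult.commute)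
        then show ?thesis using C1_diff_le_segment[OF \<phi> p x True] x by simp
      qed simp
    qed
    also have "\<dots> = ennreal ((8 * \<rho>) powr p) * (\<integral>\<^sup>+x. \<integral>\<^sup>+s. k y x s \<partial>lborel \<partial>lborel)"
      using sub_pair[of "\<lambda>(x, s). (y, x, s)"]
      by (intro nn_integral_cmult lborel.borel_measurable_nn_integral)
        (simp add: case_prod_unfold continuous_intros)
    finally show ?thesis using True by simp
  qed simp
  have slice: "(\<integral>\<^sup>+y. \<integral>\<^sup>+x. k y x s \<partial>lborel \<partial>lborel)
      \<le> indicator {0..1} s * (2 ^ ?n * ?I * emeasure lborel ?B)" for s
  proof (cases "s \<in> {0..1}")
    case True
    have gI: "(\<integral>\<^sup>+x. g x \<partial>lborel) = ?I" by (simp add: g_def)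
    (* the first form is for the substitution in x, the second for the one in y *)
    have conv: "x + s *\<^sub>R (y - x) = s *\<^sub>R y + (1 - s) *\<^sub>R x"
      "x + s *\<^sub>R (y - x) = (1 - s) *\<^sub>R x + s *\<^sub>R y" for x y :: 'a
      by (simp_all add: algebra_simps)
    show ?thesis
    proof (cases "s \<le> 1 / 2")
      case s: True
      have "(\<integral>\<^sup>+y. \<integral>\<^sup>+x. k y x s \<partial>lborel \<partial>lborel) \<le> (\<integral>\<^sup>+y. (2 ^ ?n * ?I) * indicator ?B y \<partial>lborel)"
      proof (rule nn_integral_mono)
        fix y
        have "(\<integral>\<^sup>+x. k y x s \<partial>lborel) \<le> (\<integral>\<^sup>+x. g (s *\<^sub>R y + (1 - s) *\<^sub>R x) \<partial>lborel)"
          unfolding k_def conv(1) by (intro nn_integral_mono) (auto simp: indicator_def)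
        also have "\<dots> \<le> 2 ^ ?n * ?I"
          using nn_integral_affine_le[OF g, of "1 - s" "s *\<^sub>R y"] s by (simp add: gI)
        finally show "(\<integral>\<^sup>+x. k y x s \<partial>lborel) \<le> (2 ^ ?n * ?I) * indicator ?B y"
          by (cases "y \<in> ?B") (simp_all add: k_def)
      qed
      also have "\<dots> = 2 ^ ?n * ?I * emeasure lborel ?B" by (simp add: nn_integral_cmult_indicator)
      finally show ?thesis using True by simp
    next
      case s: False
      have "(\<integral>\<^sup>+y. \<integral>\<^sup>+x. k y x s \<partial>lborel \<partial>lborel) = (\<integral>\<^sup>+x. \<integral>\<^sup>+y. k y x s \<partial>lborel \<partial>lborel)"
        using sub_pair[of "\<lambda>(x, y). (y, x, s)"]
        by (intro lborel_pair.Fubini') (simp add: case_prod_unfold continuous_intros)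
      also have "\<dots> \<le> (\<integral>\<^sup>+x. (2 ^ ?n * ?I) * indicator ?B x \<partial>lborel)"
      proof (rule nn_integral_mono)
        fix x
        have "(\<integral>\<^sup>+y. k y x s \<partial>lborel) \<le> (\<integral>\<^sup>+y. g ((1 - s) *\<^sub>R x + s *\<^sub>R y) \<partial>lborel)"
          unfolding k_def conv(2) by (intro nn_integral_mono) (auto simp: indicator_def)
        also have "\<dots> \<le> 2 ^ ?n * ?I"
          using nn_integral_affine_le[OF g, of s "(1 - s) *\<^sub>R x"] s by (simp add: gI)
        finally show "(\<integral>\<^sup>+y. k y x s \<partial>lborel) \<le> (2 ^ ?n * ?I) * indicator ?B x"
          by (cases "x \<in> ?B") (simp_all add: k_def)
      qed
      also have "\<dots> = 2 ^ ?n * ?I * emeasure lborel ?B" by (simp add: nn_integral_cmult_indicator)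
      finally show ?thesis using True by simp
    qed
  next
    case False
    then show ?thesis by (simp add: k_def)
  qed
  have swap: "(\<integral>\<^sup>+y. \<integral>\<^sup>+x. \<integral>\<^sup>+s. k y x s \<partial>lborel \<partial>lborel \<partial>lborel)
      = (\<integral>\<^sup>+s. \<integral>\<^sup>+y. \<integral>\<^sup>+x. k y x s \<partial>lborel \<partial>lborel \<partial>lborel)"
  proof -
    have "(\<integral>\<^sup>+x. \<integral>\<^sup>+s. k y x s \<partial>lborel \<partial>lborel) = (\<integral>\<^sup>+s. \<integral>\<^sup>+x. k y x s \<partial>lborel \<partial>lborel)" for y
      using sub_pair[of "\<lambda>(s, x). (y, x, s)"]
      by (intro lborel_pair.Fubini') (simp add: case_prod_unfold continuous_intros)
    moreover have "(\<integral>\<^sup>+y. \<integral>\<^sup>+s. \<integral>\<^sup>+x. k y x s \<partial>lborel \<partial>lborel \<partial>lborel)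
        = (\<integral>\<^sup>+s. \<integral>\<^sup>+y. \<integral>\<^sup>+x. k y x s \<partial>lborel \<partial>lborel \<partial>lborel)"
    proof (rule lborel_pair.Fubini')
      have "(\<lambda>(q, x). k (snd q) x (fst q)) \<in> borel_measurable ((lborel \<Otimes>\<^sub>M lborel) \<Otimes>\<^sub>M lborel)"
        using sub_pair[of "\<lambda>(q, x). (snd q, x, fst q)"]
        by (simp add: case_prod_unfold continuous_intros lborel_prod)
      from lborel.borel_measurable_nn_integral[OF this]
      show "(\<lambda>(s, y). \<integral>\<^sup>+x. k y x s \<partial>lborel) \<in> borel_measurable (lborel \<Otimes>\<^sub>M lborel)"
        by (simp add: case_prod_unfold)
    qed
    ultimately show ?thesis by simp
  qed
  obtain i where i: "0 \<le> i" "?I = ennreal i" using Ifin by (cases ?I) auto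
  obtain v where v: "0 < v" "emeasure lborel ?B = ennreal v"
  proof
    show "0 < unit_ball_vol (real ?n) * \<rho> ^ ?n" using \<rho> by simp
    show "emeasure lborel ?B = ennreal (unit_ball_vol (real ?n) * \<rho> ^ ?n)"
      using \<rho> by (simp add: emeasure_ball)
  qed
  have "ennreal (v * (K * (i + \<eta>))) = (\<integral>\<^sup>+y. (ennreal K * (?I + ennreal \<eta>)) * indicator ?B y \<partial>lborel)"
  proof -
    have "ennreal K * (?I + ennreal \<eta>) = ennreal (K * (i + \<eta>))"
      unfolding i(2) using i(1) K \<eta> by (simp add: ennreal_mult)
    then have "(\<integral>\<^sup>+y. (ennreal K * (?I + ennreal \<eta>)) * indicator ?B y \<partial>lborel)
        = ennreal (K * (i + \<eta>)) * ennreal v"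
      unfolding v(2)[symmetric] by (simp only: nn_integral_cmult_indicator sets_lborel \<open>?B \<in> sets borel\<close>)
    then show ?thesis
      using v(1) i(1) K \<eta> by (simp add: ennreal_mult'[symmetric] mult.commute)
  qed
  also have "\<dots> \<le> (\<integral>\<^sup>+y. ennreal ((8 * \<rho>) powr p) * (\<integral>\<^sup>+x. \<integral>\<^sup>+s. k y x s \<partial>lborel \<partial>lborel) \<partial>lborel)"
  proof (rule nn_integral_mono)
    fix y
    show "(ennreal K * (?I + ennreal \<eta>)) * indicator ?B y
        \<le> ennreal ((8 * \<rho>) powr p) * (\<integral>\<^sup>+x. \<integral>\<^sup>+s. k y x s \<partial>lborel \<partial>lborel)"
      using order_trans[OF _ Iy[of y]] large[of y] by (cases "y \<in> ?B") auto
  qed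
  also have "\<dots> = ennreal ((8 * \<rho>) powr p) * (\<integral>\<^sup>+s. \<integral>\<^sup>+y. \<integral>\<^sup>+x. k y x s \<partial>lborel \<partial>lborel \<partial>lborel)"
  proof (subst nn_integral_cmult)
    have "(\<lambda>(q, s). k (fst q) (snd q) s) \<in> borel_measurable ((lborel \<Otimes>\<^sub>M lborel) \<Otimes>\<^sub>M lborel)"
      using sub_pair[of "\<lambda>(q, s). (fst q, snd q, s)"]
      by (simp add: case_prod_unfold continuous_intros lborel_prod)
    from lborel.borel_measurable_nn_integral[OF this]
    have "(\<lambda>(y, x). \<integral>\<^sup>+s. k y x s \<partial>lborel) \<in> borel_measurable (lborel \<Otimes>\<^sub>M lborel)"
      by (simp add: case_prod_unfold)
    from lborel.borel_measurable_nn_integral[OF this]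
    show "(\<lambda>y. \<integral>\<^sup>+x. \<integral>\<^sup>+s. k y x s \<partial>lborel \<partial>lborel) \<in> borel_measurable lborel" .
  qed (simp add: swap)
  also have "\<dots> \<le> ennreal ((8 * \<rho>) powr p) * (\<integral>\<^sup>+s. indicator {0..1::real} s * (2 ^ ?n * ?I * emeasure lborel ?B) \<partial>lborel)"
    by (rule mult_left_mono[OF nn_integral_mono[OF slice]]) simp
  also have "\<dots> = ennreal (v * (K * i))"
  proof -
    have unit: "(\<integral>\<^sup>+s. indicator {0..1::real} s * X \<partial>lborel) = X" for X :: ennreal
      by (simp add: nn_integral_multc)
    show ?thesis
      unfolding unit v(2) i(2) K_def using v(1) i(1)
      by (simp add: ennreal_mult' ennreal_power[symmetric] mult_ac)
  qed
  finally have "v * (K * (i + \<eta>)) \<le> v * (K * i)"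
    using v i K by (simp add: ennreal_le_iff)
  then show False using v K \<eta> by simp
qed

context cusp
begin

text \<open>From a point \<open>(x, t)\<close> of the cusp go up vertically to \<open>(x, s)\<close> with \<open>1 < s < 2\<close>, a point of the
  ball because \<open>|x| < 1\<close>.  After averaging over \<open>s\<close> the bound depends on \<open>x\<close> only, and \<open>t\<close> ranges over
  an interval of length at most \<open>1\<close>.\<close>

lemma upper_le_ball:
  assumes \<phi>: "C1_grad \<phi> G" and \<epsilon>: "0 < \<epsilon>" "\<epsilon> \<le> 1 / 2"
  shows "(\<integral>\<^sup>+z\<in>upper \<epsilon>. ennreal (\<bar>\<phi> z\<bar> powr p) \<partial>lborel)
    \<le> ennreal (1 + 8 powr p) * ((\<integral>\<^sup>+z\<in>B. ennreal (\<bar>\<phi> z\<bar> powr p) \<partial>lborel)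
        + (\<integral>\<^sup>+z\<in>upper \<epsilon>. ennreal (norm (G z) powr p) \<partial>lborel))"
proof -
  define f where "f z = ennreal (\<bar>\<phi> z\<bar> powr p) * indicator B z" for z
  define h where "h z = ennreal (norm (G z) powr p) * indicator (upper \<epsilon>) z" for z
  have "B \<in> sets borel" by simp
  then have fm: "f \<in> borel_measurable borel" and hm: "h \<in> borel_measurable borel"
    using C1_grad_measurable[OF \<phi>] borel_upper unfolding f_def h_def by measurable
  have sec: "(\<lambda>r. k (x, r)) \<in> borel_measurable borel" if "k \<in> borel_measurable borel"
    for k :: "(real ^ 'm) \<times> real \<Rightarrow> ennreal" and x
    using measurable_compose[OF borel_measurable_continuous_onI that, of "\<lambda>r. (x, r)"]
    by (simp add: continuous_intros)
  define F where "F x = (\<integral>\<^sup>+r. f (x, r) + h (x, r) \<partial>lborel)" for x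
  have point: "ennreal (\<bar>\<phi> (x, t)\<bar> powr p) \<le> ennreal (8 powr p) * F x"
    if xt: "norm x < t powr a" "\<epsilon> \<le> t" "t \<le> 1" for x t
  proof -
    have ta: "t powr a \<le> 1" using xt \<epsilon> a by (intro powr_le1) auto
    have inB: "(x, s) \<in> B" if "1 \<le> s" "s < 2 + 1 / 2" for s
    proof -
      have "norm x < 1" using xt ta by simp
      then have "(norm x)\<^sup>2 < 1" by (simp add: abs_square_less_1)
      moreover have "(s - 2)\<^sup>2 \<le> 1" using that by (simp add: abs_square_le_1)
      ultimately show ?thesis by (simp only: mem_cusp_ball)
    qed
    have seg: "(x, r) \<in> upper \<epsilon>" if "t \<le> r" "r \<le> 2" for r
    proof (cases "r \<le> 1")
      case True
      have "t powr a \<le> r powr a" using that xt \<epsilon> a by (intro powr_mono2) auto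
      then show ?thesis using that True xt \<epsilon> by (auto simp: upper_def mem_\<Omega> simp del: mem_ball)
    next
      case False
      then have "(x, r) \<in> B" using that by (intro inB) auto
      then show ?thesis using B_subset_upper[OF \<epsilon>(2)] by blast
    qed
    let ?l = "2 - t"
    have l: "0 < ?l" "?l \<le> 2" using xt \<epsilon> by auto
    have J: "(\<integral>\<^sup>+r\<in>{0..?l}. ennreal (norm (G ((x, t) + r *\<^sub>R (0, 1))) powr p) \<partial>lborel)
        \<le> (\<integral>\<^sup>+r. h (x, r) \<partial>lborel)"
    proof -
      have "(\<integral>\<^sup>+r\<in>{0..?l}. ennreal (norm (G ((x, t) + r *\<^sub>R (0, 1))) powr p) \<partial>lborel)
          \<le> (\<integral>\<^sup>+r. h (x, t + 1 * r) \<partial>lborel)"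
      proof (rule nn_integral_mono)
        fix r
        show "ennreal (norm (G ((x, t) + r *\<^sub>R (0, 1))) powr p) * indicator {0..?l} r \<le> h (x, t + 1 * r)"
          using seg[of "t + r"] by (cases "r \<in> {0..?l}") (simp_all add: h_def)
      qed
      also have "\<dots> = (\<integral>\<^sup>+r. h (x, r) \<partial>lborel)"
        using nn_integral_real_affine[OF sec[OF hm, of x], of 1 t] by simp
      finally show ?thesis .
    qed
    have bound: "ennreal (\<bar>\<phi> (x, t)\<bar> powr p)
        \<le> ennreal (8 powr p) * f (x, s) + ennreal (8 powr p) * (\<integral>\<^sup>+r. h (x, r) \<partial>lborel)"
      if s: "1 < s" "s < 2" for s
    proof -
      have "ennreal (\<bar>\<phi> (x, t)\<bar> powr p) \<le> ennreal (2 powr p) * ennreal (\<bar>\<phi> ((x, t) + (s - t) *\<^sub>R (0, 1))\<bar> powr p)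
        + ennreal (4 powr p * norm (0 :: real ^ 'm, 1 :: real) powr p * ?l powr (p - 1))
          * (\<integral>\<^sup>+r\<in>{0..?l}. ennreal (norm (G ((x, t) + r *\<^sub>R (0, 1))) powr p) \<partial>lborel)"
        using s xt l by (intro C1_line_bound[OF \<phi> _ _ l(1) p]) auto
      also have "\<dots> \<le> ennreal (8 powr p) * f (x, s) + ennreal (8 powr p) * (\<integral>\<^sup>+r. h (x, r) \<partial>lborel)"
      proof (rule add_mono[OF mult_mono mult_mono[OF ennreal_leI J]])
        show "ennreal (2 powr p) \<le> ennreal (8 powr p)"
          using p by (intro ennreal_leI powr_mono2) auto
        show "ennreal (\<bar>\<phi> ((x, t) + (s - t) *\<^sub>R (0, 1))\<bar> powr p) \<le> f (x, s)"
          using inB[of s] s by (simp add: f_def del: mem_ball)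
        have "?l powr (p - 1) \<le> 2 powr (p - 1)" using l p by (intro powr_mono2) auto
        also have "(2::real) powr (p - 1) \<le> 2 powr p" by (intro powr_mono) auto
        finally have "4 powr p * ?l powr (p - 1) \<le> 4 powr p * 2 powr p" by (intro mult_left_mono) auto
        also have "\<dots> = 8 powr p" using powr_mult[of 4 2 p] by simp
        finally show "4 powr p * norm (0 :: real ^ 'm, 1 :: real) powr p * ?l powr (p - 1) \<le> 8 powr p"
          by simp
      qed auto
      finally show ?thesis .
    qed
    have "ennreal (\<bar>\<phi> (x, t)\<bar> powr p) = (\<integral>\<^sup>+s\<in>{1<..<2::real}. ennreal (\<bar>\<phi> (x, t)\<bar> powr p) \<partial>lborel)"
      by (simp add: nn_integral_cmult_indicator)
    also have "\<dots> \<le> (\<integral>\<^sup>+s. ennreal (8 powr p) * f (x, s)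
        + (ennreal (8 powr p) * (\<integral>\<^sup>+r. h (x, r) \<partial>lborel)) * indicator {1<..<2} s \<partial>lborel)"
    proof (rule nn_integral_mono)
      fix s
      show "ennreal (\<bar>\<phi> (x, t)\<bar> powr p) * indicator {1<..<2} s \<le> ennreal (8 powr p) * f (x, s)
        + (ennreal (8 powr p) * (\<integral>\<^sup>+r. h (x, r) \<partial>lborel)) * indicator {1<..<2} s"
        using bound[of s] by (cases "s \<in> {1<..<2}") auto
    qed
    also have "\<dots> = ennreal (8 powr p) * (\<integral>\<^sup>+s. f (x, s) \<partial>lborel) + ennreal (8 powr p) * (\<integral>\<^sup>+r. h (x, r) \<partial>lborel)"
      using sec[OF fm, of x] by (simp add: nn_integral_add nn_integral_cmult nn_integral_cmult_indicator)
    also have "\<dots> = ennreal (8 powr p) * F x"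
      using sec[OF fm, of x] sec[OF hm, of x] by (simp add: F_def nn_integral_add distrib_left)
    finally show ?thesis .
  qed
  define C :: "((real ^ 'm) \<times> real) set" where "C = {z. \<epsilon> \<le> snd z} \<inter> {z. snd z \<le> 1} \<inter> \<Omega>"
  have C: "C \<in> sets borel"
    unfolding C_def using borel_open[OF open_\<Omega>]
    by (intro sets.Int borel_closed[OF closed_Collect_le] continuous_intros)
  have fh: "(\<lambda>z. f z + h z) \<in> borel_measurable borel" using fm hm by simp
  have Fm: "F \<in> borel_measurable lborel"
    unfolding F_def using fh by (intro lborel.borel_measurable_nn_integral_fst) (simp add: lborel_prod)
  have kC: "(\<lambda>z. ennreal (\<bar>\<phi> z\<bar> powr p) * indicator (C - B) z) \<in> borel_measurable borel"
  proof -
    note [measurable] = C \<open>B \<in> sets borel\<close>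
    show ?thesis using C1_grad_measurable(1)[OF \<phi>] by measurable
  qed
  have C_le: "(\<integral>\<^sup>+z\<in>C - B. ennreal (\<bar>\<phi> z\<bar> powr p) \<partial>lborel) \<le> ennreal (8 powr p) * (\<integral>\<^sup>+z. f z + h z \<partial>lborel)"
  proof -
    from kC have "(\<integral>\<^sup>+z\<in>C - B. ennreal (\<bar>\<phi> z\<bar> powr p) \<partial>lborel)
        = (\<integral>\<^sup>+x. \<integral>\<^sup>+t. ennreal (\<bar>\<phi> (x, t)\<bar> powr p) * indicator (C - B) (x, t) \<partial>lborel \<partial>lborel)"
      by (rule nn_integral_lborel_iterated)
    also have "\<dots> \<le> (\<integral>\<^sup>+x. \<integral>\<^sup>+t. (ennreal (8 powr p) * F x) * indicator {0..1::real} t \<partial>lborel \<partial>lborel)"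
    proof (intro nn_integral_mono)
      fix x t
      show "ennreal (\<bar>\<phi> (x, t)\<bar> powr p) * indicator (C - B) (x, t)
          \<le> (ennreal (8 powr p) * F x) * indicator {0..1} t"
      proof (cases "(x, t) \<in> C - B")
        case True
        then have "\<epsilon> \<le> t" "t \<le> 1" "norm x < t powr a"
          by (auto simp: C_def mem_\<Omega> simp del: mem_ball)
        then show ?thesis using point[of x t] True \<epsilon> by simp
      qed simp
    qed
    also have "\<dots> = ennreal (8 powr p) * (\<integral>\<^sup>+x. F x \<partial>lborel)"
      using Fm by (simp add: nn_integral_cmult_indicator nn_integral_cmult)
    also have "(\<integral>\<^sup>+x. F x \<partial>lborel) = (\<integral>\<^sup>+z. f z + h z \<partial>lborel)"
      unfolding F_def by (rule nn_integral_lborel_iterated[OF fh, symmetric])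
    finally show ?thesis .
  qed
  have "(\<integral>\<^sup>+z\<in>upper \<epsilon>. ennreal (\<bar>\<phi> z\<bar> powr p) \<partial>lborel)
      \<le> (\<integral>\<^sup>+z. f z + ennreal (\<bar>\<phi> z\<bar> powr p) * indicator (C - B) z \<partial>lborel)"
  proof (rule nn_integral_mono)
    fix z :: "(real ^ 'm) \<times> real"
    have "z \<in> B \<or> z \<in> C - B" if "z \<in> upper \<epsilon>"
    proof -
      obtain x t where "z = (x, t)" by (cases z)
      then show ?thesis using that by (auto simp: upper_def mem_\<Omega> C_def simp del: mem_ball)
    qed
    then show "ennreal (\<bar>\<phi> z\<bar> powr p) * indicator (upper \<epsilon>) z \<le> f z + ennreal (\<bar>\<phi> z\<bar> powr p) * indicator (C - B) z"
      by (cases "z \<in> B"; cases "z \<in> upper \<epsilon>") (simp_all add: f_def del: mem_ball)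
  qed
  also have "\<dots> = (\<integral>\<^sup>+z. f z \<partial>lborel) + (\<integral>\<^sup>+z\<in>C - B. ennreal (\<bar>\<phi> z\<bar> powr p) \<partial>lborel)"
    using fm kC by (intro nn_integral_add) auto
  also have "\<dots> \<le> (\<integral>\<^sup>+z. f z + h z \<partial>lborel) + ennreal (8 powr p) * (\<integral>\<^sup>+z. f z + h z \<partial>lborel)"
    by (intro add_mono C_le nn_integral_mono) simp
  also have "\<dots> = ennreal (1 + 8 powr p) * (\<integral>\<^sup>+z. f z + h z \<partial>lborel)"
    by (simp add: distrib_right)
  also have "(\<integral>\<^sup>+z. f z + h z \<partial>lborel) = (\<integral>\<^sup>+z. f z \<partial>lborel) + (\<integral>\<^sup>+z. h z \<partial>lborel)"
    using fm hm by (intro nn_integral_add) auto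
  finally show ?thesis by (simp only: f_def h_def)
qed

section \<open>Truncation, and the total weight of the boundary\<close>

definition p_int :: "((real ^ 'm) \<times> real \<Rightarrow> 'b::real_normed_vector) \<Rightarrow> ((real ^ 'm) \<times> real) set \<Rightarrow> ennreal" where
  "p_int v D = (\<integral>\<^sup>+x\<in>D. ennreal (norm (v x) powr p) \<partial>lebesgue)"

lemma p_int_mono: "D \<subseteq> D' \<Longrightarrow> p_int v D \<le> p_int v D'"
  unfolding p_int_def by (intro nn_integral_mono mult_left_mono) (auto simp: indicator_def)

lemma p_int_lborel:
  "p_int v D = (\<integral>\<^sup>+x\<in>D. ennreal (norm (v x) powr p) \<partial>lborel)"
  unfolding p_int_def by (simp add: nn_integral_completion)

lemma norm_diff_powr_le:
  fixes v g :: "'b::real_normed_vector"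
  shows "norm v powr p \<le> 2 powr p * (norm (g - v) powr p + norm g powr p)"
proof -
  have "norm v powr p \<le> (norm (g - v) + norm g) powr p"
    using p norm_triangle_ineq[of "v - g" g] by (intro powr_mono2) (auto simp: norm_minus_commute)
  also have "\<dots> \<le> 2 powr p * (norm (g - v) powr p + norm g powr p)"
    using p by (intro powr_add_le) auto
  finally show ?thesis .
qed

lemma nn_integral_norm_powr_le:
  fixes v g :: "'a \<Rightarrow> 'b::{real_normed_vector, second_countable_topology}"
  assumes "v \<in> borel_measurable M" "g \<in> borel_measurable M" "h \<in> borel_measurable M"
  shows "(\<integral>\<^sup>+x. ennreal (norm (v x) powr p) * h x \<partial>M) \<le> ennreal (2 powr p) *
    ((\<integral>\<^sup>+x. ennreal (norm (g x - v x) powr p) * h x \<partial>M) + (\<integral>\<^sup>+x. ennreal (norm (g x) powr p) * h x \<partial>M))"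
proof -
  note [measurable] = assms
  have "(\<integral>\<^sup>+x. ennreal (norm (v x) powr p) * h x \<partial>M) \<le> (\<integral>\<^sup>+x. ennreal (2 powr p) *
      (ennreal (norm (g x - v x) powr p) * h x + ennreal (norm (g x) powr p) * h x) \<partial>M)"
  proof (rule nn_integral_mono)
    fix x
    have "ennreal (norm (v x) powr p) \<le> ennreal (2 powr p) * (ennreal (norm (g x - v x) powr p) + ennreal (norm (g x) powr p))"
      using norm_diff_powr_le[of "v x" "g x"]
      by (auto simp flip: ennreal_mult ennreal_plus intro!: ennreal_leI)
    from mult_right_mono[OF this, of "h x"]
    show "ennreal (norm (v x) powr p) * h x \<le> ennreal (2 powr p) *
      (ennreal (norm (g x - v x) powr p) * h x + ennreal (norm (g x) powr p) * h x)"
      by (simp add: mult.assoc distrib_right)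
  qed
  also have "\<dots> = ennreal (2 powr p) *
    ((\<integral>\<^sup>+x. ennreal (norm (g x - v x) powr p) * h x \<partial>M) + (\<integral>\<^sup>+x. ennreal (norm (g x) powr p) * h x \<partial>M))"
    by (simp add: nn_integral_cmult nn_integral_add)
  finally show ?thesis .
qed

lemma p_int_triangle:
  fixes v g :: "(real ^ 'm) \<times> real \<Rightarrow> 'b::{real_normed_vector, second_countable_topology}"
  assumes "v \<in> borel_measurable lebesgue" "g \<in> borel_measurable lebesgue" "D \<in> sets borel"
  shows "p_int v D \<le> ennreal (2 powr p) * (p_int (\<lambda>x. g x - v x) D + p_int g D)"
  unfolding p_int_def using assms
  by (intro nn_integral_norm_powr_le borel_measurable_indicator) (auto intro: sets_completionI_sets)

lemma p_int_minus_commute: "p_int (\<lambda>x. v x - g x) D = p_int (\<lambda>x. g x - v x) D"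
  unfolding p_int_def by (simp add: norm_minus_commute)

lemma borel_imp_lebesgue: "f \<in> borel_measurable borel \<Longrightarrow> f \<in> borel_measurable lebesgue"
  by (simp add: measurable_completion)

lemma nn_integral_exhaust:
  assumes f: "f \<in> borel_measurable M" and D: "incseq D" "\<And>k::nat. D k \<in> sets M"
    and le: "\<And>k. (\<integral>\<^sup>+x\<in>D k. f x \<partial>M) \<le> X"
  shows "(\<integral>\<^sup>+x\<in>(\<Union>k. D k). f x \<partial>M) \<le> X"
proof -
  have "(\<integral>\<^sup>+x\<in>(\<Union>k. D k). f x \<partial>M) = (\<integral>\<^sup>+x. (SUP k. f x * indicator (D k) x) \<partial>M)"
  proof (rule nn_integral_cong)
    fix x
    have "(SUP k. f x * indicator (D k) x) = f x * (SUP k. indicator (D k) x)"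
      by (simp add: SUP_mult_left_ennreal)
    also have "(SUP k. indicator (D k) x :: ennreal) = indicator (\<Union>k. D k) x"
    proof (cases "x \<in> (\<Union>k. D k)")
      case True
      then obtain k where k: "x \<in> D k" by blast
      have "(1 :: ennreal) \<le> (SUP k. indicator (D k) x)"
        by (rule SUP_upper2[of k]) (simp_all add: k)
      moreover have "(SUP k. indicator (D k) x :: ennreal) \<le> 1"
        by (intro SUP_least) (simp add: indicator_def)
      ultimately have "(SUP k. indicator (D k) x :: ennreal) = 1" by (rule antisym[rotated])
      then show ?thesis unfolding indicator_simps(1)[OF True] .
    qed simp
    finally show "f x * indicator (\<Union>k. D k) x = (SUP k. f x * indicator (D k) x)" by simp
  qed
  also have "\<dots> = (SUP k. \<integral>\<^sup>+x\<in>D k. f x \<partial>M)"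
  proof (rule nn_integral_monotone_convergence_SUP)
    show "incseq (\<lambda>k x. f x * indicator (D k) x)"
      using D(1) by (auto simp: incseq_def le_fun_def indicator_def)
  qed (use f D(2) in auto)
  also have "\<dots> \<le> X" by (intro SUP_least le)
  finally show ?thesis .
qed

text \<open>The heights \<open>1 / (k + 2)\<close> decrease to \<open>0\<close> and start at \<open>1/2\<close>, below the lowest point of the ball.\<close>

lemma exhaust_level:
  "incseq (\<lambda>k. {z \<in> A. 1 / (real k + 2) \<le> snd z})"
  "(\<Union>k. {z \<in> A. 1 / (real k + 2) \<le> snd z}) = {z \<in> A. 0 < snd z}"
proof -
  show "incseq (\<lambda>k. {z \<in> A. 1 / (real k + 2) \<le> snd z})"
  proof (rule incseq_SucI, rule subsetI)
    fix k z assume z: "z \<in> {z \<in> A. 1 / (real k + 2) \<le> snd z}"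
    have "1 / (real (Suc k) + 2) \<le> 1 / (real k + 2)" by (simp add: frac_le)
    also have "\<dots> \<le> snd z" using z by simp
    finally show "z \<in> {z \<in> A. 1 / (real (Suc k) + 2) \<le> snd z}" using z by simp
  qed
  have "\<exists>k. 1 / (real k + 2) \<le> t" if t: "0 < t" for t
  proof -
    obtain k where k: "inverse (real (Suc k)) < t" using reals_Archimedean[OF t] by blast
    have "1 / (real k + 2) \<le> inverse (real (Suc k))" by (simp add: inverse_eq_divide frac_le)
    then show ?thesis using k by (intro exI[of _ k]) linarith
  qed
  moreover have "0 < t" if "1 / (real k + 2) \<le> t" for t k
    using that by (rule less_le_trans[rotated]) simp
  ultimately have "(\<exists>k. 1 / (real k + 2) \<le> t) \<longleftrightarrow> 0 < t" for t by blast
  then show "(\<Union>k. {z \<in> A. 1 / (real k + 2) \<le> snd z}) = {z \<in> A. 0 < snd z}"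
    by (simp add: set_eq_iff)
qed

lemma \<Omega>_snd_pos: "z \<in> \<Omega> \<Longrightarrow> 0 < snd z"
  using ball_cusp_snd_gt[of z] by (cases z) (force simp: mem_\<Omega> simp del: mem_ball)

lemma p_int_\<Omega>_le:
  fixes v :: "(real ^ 'm) \<times> real \<Rightarrow> 'b::{real_normed_vector, second_countable_topology}"
  assumes v: "v \<in> borel_measurable lebesgue"
    and le: "\<And>\<epsilon>. 0 < \<epsilon> \<Longrightarrow> \<epsilon> \<le> 1 / 2 \<Longrightarrow> p_int v (upper \<epsilon>) \<le> X"
  shows "p_int v \<Omega> \<le> X"
proof -
  have "(\<integral>\<^sup>+x\<in>(\<Union>k. upper (1 / (real k + 2))). ennreal (norm (v x) powr p) \<partial>lebesgue) \<le> X"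
  proof (rule nn_integral_exhaust)
    show "incseq (\<lambda>k. upper (1 / (real k + 2)))" unfolding upper_def by (rule exhaust_level)
    show "upper (1 / (real k + 2)) \<in> sets lebesgue" for k by (simp add: sets_completionI_sets borel_upper)
    show "(\<integral>\<^sup>+x\<in>upper (1 / (real k + 2)). ennreal (norm (v x) powr p) \<partial>lebesgue) \<le> X" for k
      using le[of "1 / (real k + 2)"] by (simp add: p_int_def frac_le)
  qed (use v in measurable)
  moreover have "(\<Union>k. upper (1 / (real k + 2))) = \<Omega>"
    unfolding upper_def exhaust_level(2) using \<Omega>_snd_pos by blast
  ultimately show ?thesis by (simp add: p_int_def)
qed

lemma frontier_snd_nonneg: "z \<in> frontier \<Omega> \<Longrightarrow> 0 \<le> snd z"
proof -
  assume z: "z \<in> frontier \<Omega>"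
  have "closed {z :: (real ^ 'm) \<times> real. 0 \<le> snd z}" by (intro closed_Collect_le continuous_intros)
  moreover have "\<Omega> \<subseteq> {z. 0 \<le> snd z}" using \<Omega>_snd_pos by force
  ultimately have "closure \<Omega> \<subseteq> {z. 0 \<le> snd z}" by (rule closure_minimal[rotated])
  then show ?thesis using z by (auto simp: frontier_def)
qed

lemma w_bounds: "0 \<le> w z" "w z \<le> 1"
  by (simp_all add: w_eq)

text \<open>The points at height \<open>0\<close>, which no truncation reaches, carry no weight.\<close>

lemma frontier_int_le:
  assumes f: "f \<in> borel_measurable borel"
    and le: "\<And>\<epsilon>. 0 < \<epsilon> \<Longrightarrow> \<epsilon> \<le> 1 / 2 \<Longrightarrow> (\<integral>\<^sup>+z\<in>side \<epsilon>. f z * ennreal (w z) \<partial>H) \<le> X"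
  shows "(\<integral>\<^sup>+z\<in>frontier \<Omega>. f z * ennreal (w z) \<partial>H) \<le> X"
proof -
  have "(\<integral>\<^sup>+z\<in>(\<Union>k. side (1 / (real k + 2))). f z * ennreal (w z) \<partial>H) \<le> X"
  proof (rule nn_integral_exhaust)
    show "incseq (\<lambda>k. side (1 / (real k + 2)))" unfolding side_def by (rule exhaust_level)
    show "(\<integral>\<^sup>+z\<in>side (1 / (real k + 2)). f z * ennreal (w z) \<partial>H) \<le> X" for k
      using le[of "1 / (real k + 2)"] by (simp add: frac_le)
  qed (use f borel_w borel_side in auto)
  moreover have "(\<integral>\<^sup>+z\<in>frontier \<Omega>. f z * ennreal (w z) \<partial>H)
      = (\<integral>\<^sup>+z\<in>(\<Union>k. side (1 / (real k + 2))). f z * ennreal (w z) \<partial>H)"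
  proof (rule nn_integral_cong)
    fix z
    show "f z * ennreal (w z) * indicator (frontier \<Omega>) z
        = f z * ennreal (w z) * indicator (\<Union>k. side (1 / (real k + 2))) z"
      unfolding side_def exhaust_level(2) using frontier_snd_nonneg[of z] a
      by (cases "z \<in> frontier \<Omega>"; cases "snd z = 0") (auto simp: w_eq)
  qed
  ultimately show ?thesis by simp
qed

definition total_weight :: ennreal where "total_weight = (\<integral>\<^sup>+z\<in>frontier \<Omega>. ennreal (w z) \<partial>H)"

lemma bounded_\<Omega>: "bounded \<Omega>"
proof -
  have "{z \<in> \<Omega>. z \<notin> B} \<subseteq> cball 0 1 \<times> {0..1}"
  proof (intro subsetI)
    fix z assume z: "z \<in> {z \<in> \<Omega>. z \<notin> B}"
    obtain x t where zt: "z = (x, t)" by (cases z)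
    have xt: "norm x < t powr a" "0 < t" "t \<le> 1" using z unfolding zt mem_Collect_eq mem_\<Omega> by blast+
    then have "t powr a \<le> 1" using a by (intro powr_le1) auto
    then show "z \<in> cball 0 1 \<times> {0..1}" using xt by (simp add: zt)
  qed
  then have "bounded {z \<in> \<Omega>. z \<notin> B}"
    by (rule bounded_subset[rotated]) (intro bounded_Times bounded_cball bounded_closed_interval)
  then have "bounded ({z \<in> \<Omega>. z \<notin> B} \<union> B)" by simp
  then show ?thesis by (rule bounded_subset) blast
qed

text \<open>The trace inequality for the constant function \<open>1\<close>.\<close>

lemma total_weight_finite: "total_weight < top"
proof -
  have "(\<integral>\<^sup>+z\<in>frontier \<Omega>. 1 * ennreal (w z) \<partial>H) \<le> ennreal trace_const * emeasure lborel \<Omega>"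
  proof (rule frontier_int_le)
    fix \<epsilon> :: real assume \<epsilon>: "0 < \<epsilon>" "\<epsilon> \<le> 1 / 2"
    have "(\<integral>\<^sup>+z\<in>side \<epsilon>. 1 * ennreal (w z) \<partial>H) \<le> ennreal trace_const * emeasure lborel (upper \<epsilon>)"
      using trace_side[OF C1_grad_const[of 1] \<epsilon>] p borel_upper by (simp add: energy_density_def)
    also have "\<dots> \<le> ennreal trace_const * emeasure lborel \<Omega>"
      using borel_open[OF open_\<Omega>] by (intro mult_left_mono emeasure_mono) (auto simp: upper_def)
    finally show "(\<integral>\<^sup>+z\<in>side \<epsilon>. 1 * ennreal (w z) \<partial>H) \<le> ennreal trace_const * emeasure lborel \<Omega>" .
  qed simp
  also have "\<dots> < top"
    using emeasure_bounded_finite[OF bounded_\<Omega>] by (simp add: ennreal_mult_less_top)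
  finally show ?thesis by (simp add: total_weight_def)
qed

text \<open>On the upper hemisphere the weight is \<open>1\<close>, and the vertical projection of the hemisphere covers the
  unit ball of the hyperplane.\<close>

lemma total_weight_pos: "0 < total_weight"
proof -
  define U where "U = {z :: (real ^ 'm) \<times> real. dist (0, 2) z = sqrt 2} \<inter> {z. 2 \<le> snd z}"
  have "closed U" unfolding U_def by (intro closed_Int closed_Collect_eq closed_Collect_le continuous_intros)
  then have U: "U \<in> sets borel" by (rule borel_closed)
  have Uf: "U \<subseteq> frontier \<Omega>"
  proof
    fix z assume z: "z \<in> U"
    have "B \<subseteq> \<Omega>" by (auto simp: mem_\<Omega> simp del: mem_ball)
    then have "closure B \<subseteq> closure \<Omega>" by (rule closure_mono)
    moreover have "z \<in> closure B" using z by (simp add: U_def)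
    moreover have "z \<notin> \<Omega>" using z by (cases z) (auto simp: U_def mem_\<Omega>)
    ultimately show "z \<in> frontier \<Omega>" using interior_subset by (auto simp: frontier_def)
  qed
  have "ball 0 1 \<subseteq> fst ` U"
  proof
    fix x :: "real ^ 'm" assume "x \<in> ball 0 1"
    then have x: "(norm x)\<^sup>2 \<le> 2" using power_mono[of "norm x" 1 2] by simp
    have "(x, 2 + sqrt (2 - (norm x)\<^sup>2)) \<in> U"
      using x by (simp add: U_def dist_Pair_Pair dist_real_def)
    then show "x \<in> fst ` U" by force
  qed
  then have "emeasure lborel (ball 0 1 :: (real ^ 'm) set) \<le> 2 ^ DIM(real ^ 'm) * hausdorff_outer DIM(real ^ 'm) U"
    by (intro lborel_le_hausdorff_outer[of U fst]) (simp_all add: dist_fst_le)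
  moreover have "0 < emeasure lborel (ball 0 1 :: (real ^ 'm) set)"
    by (simp add: emeasure_ball)
  ultimately have "0 < hausdorff_outer CARD('m) U" by (auto simp: zero_less_iff_neq_zero)
  also have "\<dots> = (\<integral>\<^sup>+z. indicator U z \<partial>H)"
    using U emeasure_hausdorff_measure[OF U, of "CARD('m)"] by simp
  also have "\<dots> \<le> total_weight"
    unfolding total_weight_def
  proof (rule nn_integral_mono)
    fix z
    have "w z = 1" if "z \<in> U" using that a by (auto simp: U_def w_eq ge_one_powr_ge_zero)
    then show "indicator U z \<le> ennreal (w z) * indicator (frontier \<Omega>) z"
      using Uf by (auto simp: indicator_def)
  qed
  finally show ?thesis .
qed

text \<open>The constants of the three estimates for Sobolev functions.  Each is obtained from the one for
  smooth functions, with a factor \<open>2\<^sup>p\<close> for every passage between \<open>u\<close> and an approximating function.\<close>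

definition ball_const :: ennreal where
  "ball_const = ennreal (2 powr p) * (1 + ennreal ((8 * sqrt 2) powr p * 2 ^ DIM((real ^ 'm) \<times> real)) * (ennreal (2 powr p) + 1))"

definition domain_const :: ennreal where
  "domain_const = ennreal (2 powr p) * (1 + ennreal (1 + 8 powr p) * (ennreal (2 powr p) + ennreal (2 powr p)))"

definition boundary_const :: ennreal where
  "boundary_const = ennreal (2 powr p) * (1 + ennreal trace_const * (ennreal (2 powr p) + ennreal (2 powr p)))"

end

section \<open>The estimates for Sobolev functions\<close>

locale cusp_trace = cusp \<gamma> a p m for \<gamma> a p :: real and m :: "'m::finite itself" +
  fixes u \<tau> :: "(real ^ 'm) \<times> real \<Rightarrow> real"
  assumes u: "u \<in> W1p p \<Omega>" and \<tau>: "is_trace_off 0 p \<Omega> u \<tau>"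
begin

text \<open>The extensions by zero are measurable on the whole space; only their values on the domain and on
  its boundary matter.\<close>

definition u_ext :: "(real ^ 'm) \<times> real \<Rightarrow> real" where "u_ext x = (if x \<in> \<Omega> then u x else 0)"
definition grad_ext :: "(real ^ 'm) \<times> real \<Rightarrow> (real ^ 'm) \<times> real" where
  "grad_ext x = (if x \<in> \<Omega> then weak_grad \<Omega> u x else 0)"
definition \<tau>_ext :: "(real ^ 'm) \<times> real \<Rightarrow> real" where "\<tau>_ext x = (if x \<in> frontier \<Omega> then \<tau> x else 0)"

lemma \<Omega>_lebesgue: "\<Omega> \<in> sets lebesgue"
  using borel_open[OF open_\<Omega>] by (simp add: sets_completionI_sets)

lemma u_ext_measurable: "u_ext \<in> borel_measurable lebesgue"
  using u \<Omega>_lebesgue unfolding u_ext_def[abs_def] W1p_def Lp_def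
  by (subst measurable_restrict_space_iff[symmetric]) auto

lemma grad_ext_measurable: "grad_ext \<in> borel_measurable lebesgue"
  using u \<Omega>_lebesgue unfolding grad_ext_def[abs_def] W1p_def Lp_def
  by (subst measurable_restrict_space_iff[symmetric]) auto

lemma surface_eq: "surface_measure \<Omega> = restrict_space H (frontier \<Omega>)"
  by (simp add: surface_measure_def)

lemma frontier_borel: "frontier \<Omega> \<in> sets borel" by (simp add: borel_closed)

lemma \<tau>_ext_measurable: "\<tau>_ext \<in> borel_measurable borel"
proof -
  have "\<tau> \<in> borel_measurable (restrict_space H (frontier \<Omega>))"
    using \<tau> by (simp add: is_trace_off_def surface_eq)
  then have "\<tau>_ext \<in> borel_measurable H"
    unfolding \<tau>_ext_def[abs_def] using frontier_borel
    by (subst measurable_restrict_space_iff[symmetric]) auto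
  then show ?thesis by (simp cong: measurable_cong_sets)
qed

lemma snd_ge_notin_ball: "\<epsilon> \<le> snd z \<Longrightarrow> (z :: (real ^ 'm) \<times> real) \<notin> ball 0 \<epsilon>"
  using norm_snd_le[of "snd z" "fst z"] by auto

text \<open>A single approximating function with error \<open>\<eta>\<close> is enough: every estimate below carries a slack
  \<open>\<eta>\<close>, which is removed at the very end.\<close>

lemma smooth_approx:
  assumes \<epsilon>: "0 < \<epsilon>" and \<eta>: "0 < \<eta>"
  obtains \<phi> where "C1_grad \<phi> (gradient \<phi>)"
    "p_int (\<lambda>x. \<phi> x - u_ext x) (upper \<epsilon>) \<le> ennreal \<eta>"
    "p_int (\<lambda>x. gradient \<phi> x - grad_ext x) (upper \<epsilon>) \<le> ennreal \<eta>"
    "(\<integral>\<^sup>+z\<in>side \<epsilon>. ennreal (\<bar>\<phi> z - \<tau>_ext z\<bar> powr p) \<partial>H) \<le> ennreal \<eta>"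
proof -
  obtain \<Phi> where \<Phi>: "\<And>k. smooth (\<Phi> k)"
    "(\<lambda>k. \<integral>\<^sup>+x. ennreal (\<bar>\<Phi> k x - u x\<bar> powr p + norm (gradient (\<Phi> k) x - weak_grad \<Omega> u x) powr p)
         \<partial>lebesgue_on (\<Omega> - ball 0 \<epsilon>)) \<longlonglongrightarrow> 0"
    "(\<lambda>k. \<integral>\<^sup>+x\<in>frontier \<Omega> - ball 0 \<epsilon>. ennreal (\<bar>\<Phi> k x - \<tau> x\<bar> powr p) \<partial>surface_measure \<Omega>) \<longlonglongrightarrow> 0"
    using \<tau> \<epsilon> unfolding is_trace_off_def by blast
  have pos: "0 < ennreal \<eta>" using \<eta> by simp
  from eventually_conj[OF order_tendstoD(2)[OF \<Phi>(2) pos] order_tendstoD(2)[OF \<Phi>(3) pos]]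
  obtain k where k:
    "(\<integral>\<^sup>+x. ennreal (\<bar>\<Phi> k x - u x\<bar> powr p + norm (gradient (\<Phi> k) x - weak_grad \<Omega> u x) powr p)
         \<partial>lebesgue_on (\<Omega> - ball 0 \<epsilon>)) < ennreal \<eta>"
    "(\<integral>\<^sup>+x\<in>frontier \<Omega> - ball 0 \<epsilon>. ennreal (\<bar>\<Phi> k x - \<tau> x\<bar> powr p) \<partial>surface_measure \<Omega>) < ennreal \<eta>"
    unfolding eventually_sequentially by blast
  let ?f = "\<lambda>x. ennreal (\<bar>\<Phi> k x - u x\<bar> powr p + norm (gradient (\<Phi> k) x - weak_grad \<Omega> u x) powr p)"
  have "\<Omega> - ball 0 \<epsilon> \<in> sets lebesgue"
    using \<Omega>_lebesgue by (intro sets.Diff) auto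
  then have eq: "integral\<^sup>N (lebesgue_on (\<Omega> - ball 0 \<epsilon>)) ?f = (\<integral>\<^sup>+x\<in>\<Omega> - ball 0 \<epsilon>. ?f x \<partial>lebesgue)"
    by (subst nn_integral_restrict_space) auto
  show thesis
  proof (rule that[of "\<Phi> k"])
    show "C1_grad (\<Phi> k) (gradient (\<Phi> k))" by (rule smooth_C1_grad[OF \<Phi>(1)])
    have "p_int (\<lambda>x. \<Phi> k x - u_ext x) (upper \<epsilon>) \<le> (\<integral>\<^sup>+x\<in>\<Omega> - ball 0 \<epsilon>. ?f x \<partial>lebesgue)"
      unfolding p_int_def
    proof (rule nn_integral_mono)
      fix x
      show "ennreal (norm (\<Phi> k x - u_ext x) powr p) * indicator (upper \<epsilon>) x \<le> ?f x * indicator (\<Omega> - ball 0 \<epsilon>) x"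
        using snd_ge_notin_ball[of \<epsilon> x]
        by (cases "x \<in> upper \<epsilon>") (auto simp: upper_def u_ext_def intro!: ennreal_leI)
    qed
    then show "p_int (\<lambda>x. \<Phi> k x - u_ext x) (upper \<epsilon>) \<le> ennreal \<eta>"
      using k(1) unfolding eq by (meson le_less_trans less_imp_le)
    have "p_int (\<lambda>x. gradient (\<Phi> k) x - grad_ext x) (upper \<epsilon>) \<le> (\<integral>\<^sup>+x\<in>\<Omega> - ball 0 \<epsilon>. ?f x \<partial>lebesgue)"
      unfolding p_int_def
    proof (rule nn_integral_mono)
      fix x
      show "ennreal (norm (gradient (\<Phi> k) x - grad_ext x) powr p) * indicator (upper \<epsilon>) x \<le> ?f x * indicator (\<Omega> - ball 0 \<epsilon>) x"
        using snd_ge_notin_ball[of \<epsilon> x]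
        by (cases "x \<in> upper \<epsilon>") (auto simp: upper_def grad_ext_def intro!: ennreal_leI)
    qed
    then show "p_int (\<lambda>x. gradient (\<Phi> k) x - grad_ext x) (upper \<epsilon>) \<le> ennreal \<eta>"
      using k(1) unfolding eq by (meson le_less_trans less_imp_le)
    have "(\<integral>\<^sup>+z\<in>side \<epsilon>. ennreal (\<bar>\<Phi> k z - \<tau>_ext z\<bar> powr p) \<partial>H)
        \<le> (\<integral>\<^sup>+x. (ennreal (\<bar>\<Phi> k x - \<tau> x\<bar> powr p) * indicator (frontier \<Omega> - ball 0 \<epsilon>) x) * indicator (frontier \<Omega>) x \<partial>H)"
    proof (rule nn_integral_mono)
      fix z
      show "ennreal (\<bar>\<Phi> k z - \<tau>_ext z\<bar> powr p) * indicator (side \<epsilon>) z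
          \<le> (ennreal (\<bar>\<Phi> k z - \<tau> z\<bar> powr p) * indicator (frontier \<Omega> - ball 0 \<epsilon>) z) * indicator (frontier \<Omega>) z"
        using snd_ge_notin_ball[of \<epsilon> z]
        by (cases "z \<in> side \<epsilon>") (auto simp: side_def \<tau>_ext_def)
    qed
    also have "\<dots> = (\<integral>\<^sup>+x\<in>frontier \<Omega> - ball 0 \<epsilon>. ennreal (\<bar>\<Phi> k x - \<tau> x\<bar> powr p) \<partial>surface_measure \<Omega>)"
      unfolding surface_eq using frontier_borel by (subst nn_integral_restrict_space) auto
    finally show "(\<integral>\<^sup>+z\<in>side \<epsilon>. ennreal (\<bar>\<Phi> k z - \<tau>_ext z\<bar> powr p) \<partial>H) \<le> ennreal \<eta>"
      using k(2) by (meson le_less_trans less_imp_le)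
  qed
qed

lemma grad_ext_le: "p_int grad_ext D \<le> p_int grad_ext \<Omega>"
  unfolding p_int_def by (intro nn_integral_mono) (auto simp: grad_ext_def indicator_def)

lemma ball_estimate:
  assumes \<eta>: "0 < \<eta>"
  shows "\<exists>c. p_int (\<lambda>x. u_ext x - c) B \<le> ball_const * (p_int grad_ext \<Omega> + ennreal \<eta>)"
proof -
  let ?P = "ennreal (2 powr p)" and ?S = "p_int grad_ext \<Omega> + ennreal \<eta>"
  let ?K = "ennreal ((8 * sqrt 2) powr p * 2 ^ DIM((real ^ 'm) \<times> real))"
  obtain \<phi> where \<phi>: "C1_grad \<phi> (gradient \<phi>)"
    "p_int (\<lambda>x. \<phi> x - u_ext x) (upper (1/2)) \<le> ennreal \<eta>"
    "p_int (\<lambda>x. gradient \<phi> x - grad_ext x) (upper (1/2)) \<le> ennreal \<eta>"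
    by (rule smooth_approx[of "1/2" \<eta>]) (use \<eta> in auto)
  have BU: "B \<subseteq> upper (1/2)" by (rule B_subset_upper) simp
  have m: "\<phi> \<in> borel_measurable lebesgue" "gradient \<phi> \<in> borel_measurable lebesgue"
    using C1_grad_measurable[OF \<phi>(1)] by (simp_all add: borel_imp_lebesgue)
  obtain y where y: "p_int (\<lambda>x. \<phi> x - \<phi> y) B \<le> ?K * (p_int (gradient \<phi>) B + ennreal \<eta>)"
    using ball_poincare[OF \<phi>(1) p, of "sqrt 2" \<eta> "(0, 2)"] \<eta> by (auto simp: p_int_lborel)
  have "p_int (gradient \<phi>) B \<le> ?P * (p_int (\<lambda>x. grad_ext x - gradient \<phi> x) B + p_int grad_ext B)"
    by (rule p_int_triangle[OF m(2) grad_ext_measurable]) simp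
  also have "\<dots> \<le> ?P * (ennreal \<eta> + p_int grad_ext \<Omega>)"
    using \<phi>(3) p_int_mono[OF BU, of "\<lambda>x. gradient \<phi> x - grad_ext x"]
    by (intro mult_left_mono add_mono grad_ext_le) (auto simp: p_int_minus_commute[of grad_ext])
  finally have grad: "p_int (gradient \<phi>) B \<le> ?P * ?S" by (simp add: add.commute)
  have le: "ennreal \<eta> \<le> ?S" by simp
  have "p_int (\<lambda>x. u_ext x - \<phi> y) B
      \<le> ?P * (p_int (\<lambda>x. (\<phi> x - \<phi> y) - (u_ext x - \<phi> y)) B + p_int (\<lambda>x. \<phi> x - \<phi> y) B)"
    using m(1) u_ext_measurable by (intro p_int_triangle) auto
  also have "\<dots> \<le> ?P * (?S + ?K * (?P * ?S + ?S))"
  proof (intro mult_left_mono add_mono)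
    show "p_int (\<lambda>x. (\<phi> x - \<phi> y) - (u_ext x - \<phi> y)) B \<le> ?S"
      using order_trans[OF p_int_mono[OF BU] order_trans[OF \<phi>(2) le]] by simp
    show "p_int (\<lambda>x. \<phi> x - \<phi> y) B \<le> ?K * (?P * ?S + ?S)"
      by (rule order_trans[OF y]) (intro mult_left_mono add_mono grad le, simp)
  qed simp
  also have "\<dots> = ball_const * ?S" unfolding ball_const_def by (simp add: distrib_left distrib_right mult_ac)
  finally show ?thesis by blast
qed

lemma domain_estimate:
  assumes \<eta>: "0 < \<eta>"
  shows "p_int (\<lambda>x. u_ext x - c) \<Omega> \<le> domain_const * (p_int (\<lambda>x. u_ext x - c) B + p_int grad_ext \<Omega> + ennreal \<eta>)"
proof (rule p_int_\<Omega>_le)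
  let ?P = "ennreal (2 powr p)" and ?K = "ennreal (1 + 8 powr p)"
  let ?S = "p_int (\<lambda>x. u_ext x - c) B + p_int grad_ext \<Omega> + ennreal \<eta>"
  fix \<epsilon> :: real assume \<epsilon>: "0 < \<epsilon>" "\<epsilon> \<le> 1 / 2"
  obtain \<phi> where \<phi>: "C1_grad \<phi> (gradient \<phi>)"
    "p_int (\<lambda>x. \<phi> x - u_ext x) (upper \<epsilon>) \<le> ennreal \<eta>"
    "p_int (\<lambda>x. gradient \<phi> x - grad_ext x) (upper \<epsilon>) \<le> ennreal \<eta>"
    by (rule smooth_approx[of \<epsilon> \<eta>]) (use \<epsilon> \<eta> in auto)
  have m: "\<phi> \<in> borel_measurable lebesgue" "gradient \<phi> \<in> borel_measurable lebesgue"
    using C1_grad_measurable[OF \<phi>(1)] by (simp_all add: borel_imp_lebesgue)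
  have BU: "B \<subseteq> upper \<epsilon>" by (rule B_subset_upper[OF \<epsilon>(2)])
  have "p_int (\<lambda>x. \<phi> x - c) B \<le> ?P * (p_int (\<lambda>x. (u_ext x - c) - (\<phi> x - c)) B + p_int (\<lambda>x. u_ext x - c) B)"
    using m(1) u_ext_measurable by (intro p_int_triangle) auto
  also have "\<dots> \<le> ?P * (ennreal \<eta> + p_int (\<lambda>x. u_ext x - c) B)"
    using order_trans[OF p_int_mono[OF BU] \<phi>(2)]
    by (intro mult_left_mono add_mono) (auto simp: p_int_minus_commute[of u_ext])
  also have "\<dots> \<le> ?P * ?S"
    by (intro mult_left_mono) (auto simp: add.commute add.left_commute intro: add_left_mono)
  finally have b1: "p_int (\<lambda>x. \<phi> x - c) B \<le> ?P * ?S" .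
  have "p_int (gradient \<phi>) (upper \<epsilon>) \<le> ?P * (p_int (\<lambda>x. grad_ext x - gradient \<phi> x) (upper \<epsilon>) + p_int grad_ext (upper \<epsilon>))"
    by (rule p_int_triangle[OF m(2) grad_ext_measurable borel_upper])
  also have "\<dots> \<le> ?P * (ennreal \<eta> + p_int grad_ext \<Omega>)"
    using \<phi>(3) by (intro mult_left_mono add_mono grad_ext_le) (auto simp: p_int_minus_commute[of grad_ext])
  also have "\<dots> \<le> ?P * ?S"
    by (intro mult_left_mono) (auto simp: add.commute add.left_commute intro: add_left_mono)
  finally have b2: "p_int (gradient \<phi>) (upper \<epsilon>) \<le> ?P * ?S" .
  have "p_int (\<lambda>x. \<phi> x - c) (upper \<epsilon>) \<le> ?K * (p_int (\<lambda>x. \<phi> x - c) B + p_int (gradient \<phi>) (upper \<epsilon>))"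
    using upper_le_ball[OF C1_grad_diff_const[OF \<phi>(1), of c] \<epsilon>] by (simp add: p_int_lborel)
  also have "\<dots> \<le> ?K * (?P * ?S + ?P * ?S)"
    by (intro mult_left_mono add_mono b1 b2) simp
  finally have b3: "p_int (\<lambda>x. \<phi> x - c) (upper \<epsilon>) \<le> ?K * (?P * ?S + ?P * ?S)" .
  have "p_int (\<lambda>x. u_ext x - c) (upper \<epsilon>)
      \<le> ?P * (p_int (\<lambda>x. (\<phi> x - c) - (u_ext x - c)) (upper \<epsilon>) + p_int (\<lambda>x. \<phi> x - c) (upper \<epsilon>))"
    using m(1) u_ext_measurable by (intro p_int_triangle borel_upper) auto
  also have "\<dots> \<le> ?P * (?S + ?K * (?P * ?S + ?P * ?S))"
    using order_trans[OF \<phi>(2), of ?S] by (intro mult_left_mono add_mono b3) auto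
  also have "\<dots> = domain_const * ?S" unfolding domain_const_def by (simp add: distrib_left distrib_right mult_ac)
  finally show "p_int (\<lambda>x. u_ext x - c) (upper \<epsilon>) \<le> domain_const * ?S" .
qed (use u_ext_measurable in measurable)

definition deviation :: "real \<Rightarrow> ennreal" where
  "deviation c = (\<integral>\<^sup>+z\<in>frontier \<Omega>. ennreal (\<bar>\<tau>_ext z - c\<bar> powr p) * ennreal (w z) \<partial>H)"

lemma trace_estimate:
  assumes \<eta>: "0 < \<eta>"
  shows "deviation c \<le> boundary_const * (p_int (\<lambda>x. u_ext x - c) \<Omega> + p_int grad_ext \<Omega> + ennreal \<eta>)"
  unfolding deviation_def
proof (rule frontier_int_le)
  let ?P = "ennreal (2 powr p)" and ?K = "ennreal trace_const"
  let ?S = "p_int (\<lambda>x. u_ext x - c) \<Omega> + p_int grad_ext \<Omega> + ennreal \<eta>"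
  fix \<epsilon> :: real assume \<epsilon>: "0 < \<epsilon>" "\<epsilon> \<le> 1 / 2"
  obtain \<phi> where \<phi>: "C1_grad \<phi> (gradient \<phi>)"
    "p_int (\<lambda>x. \<phi> x - u_ext x) (upper \<epsilon>) \<le> ennreal \<eta>"
    "p_int (\<lambda>x. gradient \<phi> x - grad_ext x) (upper \<epsilon>) \<le> ennreal \<eta>"
    "(\<integral>\<^sup>+z\<in>side \<epsilon>. ennreal (\<bar>\<phi> z - \<tau>_ext z\<bar> powr p) \<partial>H) \<le> ennreal \<eta>"
    by (rule smooth_approx[of \<epsilon> \<eta>]) (use \<epsilon> \<eta> in auto)
  have m: "\<phi> \<in> borel_measurable lebesgue" "gradient \<phi> \<in> borel_measurable lebesgue"
    using C1_grad_measurable[OF \<phi>(1)] by (simp_all add: borel_imp_lebesgue)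
  have "p_int (\<lambda>x. \<phi> x - c) (upper \<epsilon>) \<le> ?P * (p_int (\<lambda>x. (u_ext x - c) - (\<phi> x - c)) (upper \<epsilon>) + p_int (\<lambda>x. u_ext x - c) (upper \<epsilon>))"
    using m(1) u_ext_measurable by (intro p_int_triangle borel_upper) auto
  also have "\<dots> \<le> ?P * (ennreal \<eta> + p_int (\<lambda>x. u_ext x - c) \<Omega>)"
    using \<phi>(2)
    by (intro mult_left_mono add_mono p_int_mono) (auto simp: p_int_minus_commute[of u_ext] upper_def)
  also have "\<dots> \<le> ?P * ?S"
    by (intro mult_left_mono) (auto simp: add.commute add.left_commute intro: add_left_mono)
  finally have b1: "p_int (\<lambda>x. \<phi> x - c) (upper \<epsilon>) \<le> ?P * ?S" .
  have "p_int (gradient \<phi>) (upper \<epsilon>) \<le> ?P * (p_int (\<lambda>x. grad_ext x - gradient \<phi> x) (upper \<epsilon>) + p_int grad_ext (upper \<epsilon>))"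
    by (rule p_int_triangle[OF m(2) grad_ext_measurable borel_upper])
  also have "\<dots> \<le> ?P * (ennreal \<eta> + p_int grad_ext \<Omega>)"
    using \<phi>(3) by (intro mult_left_mono add_mono grad_ext_le) (auto simp: p_int_minus_commute[of grad_ext])
  also have "\<dots> \<le> ?P * ?S"
    by (intro mult_left_mono) (auto simp: add.commute add.left_commute intro: add_left_mono)
  finally have b2: "p_int (gradient \<phi>) (upper \<epsilon>) \<le> ?P * ?S" .
  let ?h = "\<lambda>z. ennreal (w z) * indicator (side \<epsilon>) z"
  have "(\<integral>\<^sup>+z. ennreal (norm (\<phi> z - c) powr p) * ?h z \<partial>H)
      = (\<integral>\<^sup>+z\<in>side \<epsilon>. ennreal (\<bar>\<phi> z - c\<bar> powr p * w z) \<partial>H)"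
    using w_bounds by (intro nn_integral_cong) (simp add: ennreal_mult' mult.assoc)
  also have "\<dots> \<le> ?K * (\<integral>\<^sup>+x\<in>upper \<epsilon>. energy_density p (\<lambda>x. \<phi> x - c) (gradient \<phi>) x \<partial>lborel)"
    by (rule trace_side[OF C1_grad_diff_const[OF \<phi>(1)] \<epsilon>])
  also have "(\<integral>\<^sup>+x\<in>upper \<epsilon>. energy_density p (\<lambda>x. \<phi> x - c) (gradient \<phi>) x \<partial>lborel)
      = p_int (\<lambda>x. \<phi> x - c) (upper \<epsilon>) + p_int (gradient \<phi>) (upper \<epsilon>)"
    unfolding p_int_lborel energy_density_def
    using C1_grad_measurable[OF \<phi>(1)] borel_upper
    by (subst nn_integral_add[symmetric]) (auto simp: distrib_right)
  also have "?K * \<dots> \<le> ?K * (?P * ?S + ?P * ?S)"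
    by (intro mult_left_mono add_mono b1 b2) simp
  finally have b3: "(\<integral>\<^sup>+z. ennreal (norm (\<phi> z - c) powr p) * ?h z \<partial>H) \<le> ?K * (?P * ?S + ?P * ?S)" .
  have "(\<integral>\<^sup>+z. ennreal (norm ((\<phi> z - c) - (\<tau>_ext z - c)) powr p) * ?h z \<partial>H)
      \<le> (\<integral>\<^sup>+z\<in>side \<epsilon>. ennreal (\<bar>\<phi> z - \<tau>_ext z\<bar> powr p) \<partial>H)"
  proof (rule nn_integral_mono)
    fix z
    have "ennreal (\<bar>\<phi> z - \<tau>_ext z\<bar> powr p) * ennreal (w z) \<le> ennreal (\<bar>\<phi> z - \<tau>_ext z\<bar> powr p)"
      using w_bounds[of z] by (auto simp: ennreal_mult[symmetric] mult_left_le intro!: ennreal_leI)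
    then show "ennreal (norm ((\<phi> z - c) - (\<tau>_ext z - c)) powr p) * ?h z \<le> ennreal (\<bar>\<phi> z - \<tau>_ext z\<bar> powr p) * indicator (side \<epsilon>) z"
      by (cases "z \<in> side \<epsilon>") simp_all
  qed
  also have "\<dots> \<le> ?S" using order_trans[OF \<phi>(4), of ?S] by simp
  finally have b4: "(\<integral>\<^sup>+z. ennreal (norm ((\<phi> z - c) - (\<tau>_ext z - c)) powr p) * ?h z \<partial>H) \<le> ?S" .
  have "(\<integral>\<^sup>+z\<in>side \<epsilon>. ennreal (\<bar>\<tau>_ext z - c\<bar> powr p) * ennreal (w z) \<partial>H)
      = (\<integral>\<^sup>+z. ennreal (norm (\<tau>_ext z - c) powr p) * ?h z \<partial>H)"
    by (intro nn_integral_cong) (simp add: mult.assoc)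
  also have "\<dots> \<le> ?P * ((\<integral>\<^sup>+z. ennreal (norm ((\<phi> z - c) - (\<tau>_ext z - c)) powr p) * ?h z \<partial>H)
      + (\<integral>\<^sup>+z. ennreal (norm (\<phi> z - c) powr p) * ?h z \<partial>H))"
    using C1_grad_measurable(1)[OF \<phi>(1)] \<tau>_ext_measurable borel_w borel_side[of \<epsilon>]
    by (intro nn_integral_norm_powr_le) auto
  also have "\<dots> \<le> ?P * (?S + ?K * (?P * ?S + ?P * ?S))"
    by (intro mult_left_mono add_mono b3 b4) simp
  also have "\<dots> = boundary_const * ?S" unfolding boundary_const_def by (simp add: distrib_left distrib_right mult_ac)
  finally show "(\<integral>\<^sup>+z\<in>side \<epsilon>. ennreal (\<bar>\<tau>_ext z - c\<bar> powr p) * ennreal (w z) \<partial>H) \<le> boundary_const * ?S" .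
qed (use \<tau>_ext_measurable in measurable)

end

section \<open>The minimising property and the conclusion\<close>

text \<open>The graph of the convex function \<open>|s|\<^sup>p\<close> lies above its tangent at \<open>t\<close>, evaluated at \<open>s = t - c\<close>.
  This is Young's inequality for \<open>|t - c|\<close> and \<open>|t|\<^sup>p\<^sup>-\<^sup>1\<close>.\<close>

lemma powr_abs_tangent:
  fixes t c p :: real
  assumes p: "1 < p"
  shows "\<bar>t\<bar> powr p \<le> \<bar>t - c\<bar> powr p + p * c * (\<bar>t\<bar> powr (p - 2) * t)"
proof (cases "t = 0")
  case False
  define q where "q = p / (p - 1)"
  have q: "1 < q" "1 / p + 1 / q = 1" using p by (simp_all add: q_def field_simps)
  let ?s = "\<bar>t\<bar> powr (p - 2) * t"
  have s: "\<bar>?s\<bar> = \<bar>t\<bar> powr (p - 1)" "t * ?s = \<bar>t\<bar> powr p"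
  proof -
    have "\<bar>?s\<bar> = \<bar>t\<bar> powr (p - 2) * \<bar>t\<bar> powr 1" using False by (simp add: abs_mult)
    also have "\<dots> = \<bar>t\<bar> powr (p - 1)" unfolding powr_add[symmetric] by simp
    finally show "\<bar>?s\<bar> = \<bar>t\<bar> powr (p - 1)" .
    have "t * ?s = \<bar>t\<bar> powr (p - 2) * (\<bar>t\<bar> * \<bar>t\<bar>)" by (simp add: mult.left_commute)
    also have "\<bar>t\<bar> * \<bar>t\<bar> = \<bar>t\<bar> powr 2" using False by (simp add: power2_eq_square)
    also have "\<bar>t\<bar> powr (p - 2) * \<bar>t\<bar> powr 2 = \<bar>t\<bar> powr p" unfolding powr_add[symmetric] by simp
    finally show "t * ?s = \<bar>t\<bar> powr p" .
  qed
  have "(t - c) * ?s \<le> \<bar>t - c\<bar> * \<bar>t\<bar> powr (p - 1)"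
    using abs_ge_self[of "(t - c) * ?s"] by (simp only: abs_mult[of "t - c" ?s] s)
  also have "\<dots> \<le> \<bar>t - c\<bar> powr p / p + (\<bar>t\<bar> powr (p - 1)) powr q / q"
    using Youngs_inequality[of p q "\<bar>t - c\<bar>" "\<bar>t\<bar> powr (p - 1)"] p q by simp
  also have "(\<bar>t\<bar> powr (p - 1)) powr q = \<bar>t\<bar> powr p"
    using p by (simp add: powr_powr q_def)
  finally have "p * ((t - c) * ?s) \<le> \<bar>t - c\<bar> powr p + (p - 1) * \<bar>t\<bar> powr p"
    using p by (simp add: q_def field_simps)
  moreover have "p * ((t - c) * ?s) = p * (t * ?s) - p * c * ?s"
    by (simp only: left_diff_distrib right_diff_distrib mult.assoc)
  moreover have "(p - 1) * \<bar>t\<bar> powr p = p * \<bar>t\<bar> powr p - \<bar>t\<bar> powr p"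
    by (simp only: left_diff_distrib mult_1)
  ultimately show ?thesis unfolding s(2) by linarith
qed simp

context cusp
begin

text \<open>The constants by which \<open>\<integral> |u - c|\<^sup>p\<close>, \<open>\<integral> |\<tau> - c|\<^sup>p w ds\<close> and finally \<open>\<integral> |u|\<^sup>p\<close> are
  bounded in terms of the gradient, for the constant \<open>c\<close> provided by the ball.\<close>

definition domain_poincare_const :: ennreal where "domain_poincare_const = domain_const * (ball_const + 1)"
definition trace_poincare_const :: ennreal where "trace_poincare_const = boundary_const * (domain_poincare_const + 1)"
definition poincare_const :: ennreal where
  "poincare_const = ennreal (2 powr p) * (domain_poincare_const + (ennreal (2 powr p) * (trace_poincare_const + trace_poincare_const)) / total_weight * emeasure lborel \<Omega>)"

lemma poincare_const_finite: "poincare_const < top"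
proof -
  have 1: "ball_const < top" "domain_const < top" "boundary_const < top"
    unfolding ball_const_def domain_const_def boundary_const_def
    by (simp_all add: ennreal_mult_less_top ennreal_add_less_top)
  then have 2: "domain_poincare_const < top" "trace_poincare_const < top"
    unfolding domain_poincare_const_def trace_poincare_const_def
    by (simp_all add: ennreal_mult_less_top ennreal_add_less_top)
  have "(ennreal (2 powr p) * (trace_poincare_const + trace_poincare_const)) / total_weight < top"
    using 2 less_imp_neq[OF total_weight_pos] by (simp add: less_top[symmetric] ennreal_divide_eq_top_iff ennreal_mult_eq_top_iff)
  then show ?thesis
    unfolding poincare_const_def using 2 emeasure_bounded_finite[OF bounded_\<Omega>]
    by (simp add: ennreal_mult_less_top ennreal_add_less_top)
qed

end

context cusp_trace
begin

abbreviation S where "S \<equiv> surface_measure \<Omega>"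

lemma nn_integral_S: "(\<integral>\<^sup>+z. f z \<partial>S) = (\<integral>\<^sup>+z\<in>frontier \<Omega>. f z \<partial>H)"
  unfolding surface_eq using frontier_borel by (subst nn_integral_restrict_space) auto

lemma deviation_surface: "deviation c = (\<integral>\<^sup>+z. ennreal (\<bar>\<tau> z - c\<bar> powr p * w z) \<partial>S)"
  unfolding deviation_def nn_integral_S
  using w_bounds by (intro nn_integral_cong) (simp add: \<tau>_ext_def indicator_def ennreal_mult)

lemma \<tau>_measurable: "\<tau> \<in> borel_measurable S"
  using \<tau> by (simp add: is_trace_off_def)

lemma w_measurable_S: "w \<in> borel_measurable S"
  unfolding surface_eq by (intro measurable_restrict_space1) (simp cong: measurable_cong_sets)

lemma p_int_fin: "p_int u_ext \<Omega> < top" "p_int grad_ext \<Omega> < top"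
  and p_int_Lp: "p_int u_ext \<Omega> = ennreal (LINT x|lebesgue_on \<Omega>. norm (u x) powr p)"
    "p_int grad_ext \<Omega> = ennreal (LINT x|lebesgue_on \<Omega>. norm (weak_grad \<Omega> u x) powr p)"
proof -
  have i: "integrable (lebesgue_on \<Omega>) (\<lambda>x. norm (u x) powr p)"
    "integrable (lebesgue_on \<Omega>) (\<lambda>x. norm (weak_grad \<Omega> u x) powr p)"
    using u by (simp_all add: W1p_def Lp_def)
  have "p_int u_ext \<Omega> = (\<integral>\<^sup>+x. ennreal (norm (u x) powr p) \<partial>lebesgue_on \<Omega>)"
    unfolding p_int_def using \<Omega>_lebesgue
    by (subst nn_integral_restrict_space) (auto intro!: nn_integral_cong simp: u_ext_def indicator_def)
  also have "\<dots> = ennreal (LINT x|lebesgue_on \<Omega>. norm (u x) powr p)"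
    by (rule nn_integral_eq_integral[OF i(1)]) simp
  finally show 1: "p_int u_ext \<Omega> = ennreal (LINT x|lebesgue_on \<Omega>. norm (u x) powr p)" .
  have "p_int grad_ext \<Omega> = (\<integral>\<^sup>+x. ennreal (norm (weak_grad \<Omega> u x) powr p) \<partial>lebesgue_on \<Omega>)"
    unfolding p_int_def using \<Omega>_lebesgue
    by (subst nn_integral_restrict_space) (auto intro!: nn_integral_cong simp: grad_ext_def indicator_def)
  also have "\<dots> = ennreal (LINT x|lebesgue_on \<Omega>. norm (weak_grad \<Omega> u x) powr p)"
    by (rule nn_integral_eq_integral[OF i(2)]) simp
  finally show 2: "p_int grad_ext \<Omega> = ennreal (LINT x|lebesgue_on \<Omega>. norm (weak_grad \<Omega> u x) powr p)" .
  show "p_int u_ext \<Omega> < top" "p_int grad_ext \<Omega> < top" unfolding 1 2 by simp_all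
qed

lemma deviation_zero_finite: "deviation 0 < top"
proof -
  have "deviation 0 \<le> boundary_const * (p_int (\<lambda>x. u_ext x - 0) \<Omega> + p_int grad_ext \<Omega> + ennreal 1)"
    by (rule trace_estimate) simp
  also have "\<dots> < top"
    using p_int_fin unfolding boundary_const_def by (simp add: ennreal_mult_less_top ennreal_add_less_top)
  finally show ?thesis .
qed

text \<open>Integrate the tangent inequality against the weight; the linear term drops out by the hypothesis.
  The integral in the hypothesis converges because \<open>|t|\<^sup>p\<^sup>-\<^sup>1 \<le> 1 + |t|\<^sup>p\<close> and both \<open>w\<close> and
  \<open>|\<tau>|\<^sup>p w\<close> are integrable.\<close>

lemma deviation_zero_minimal:
  assumes cond: "(LINT x|S. \<bar>\<tau> x\<bar> powr (p - 2) * \<tau> x * w x) = 0"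
  shows "deviation 0 \<le> deviation c"
proof (cases "deviation c = top")
  case False
  note [measurable] = \<tau>_measurable w_measurable_S
  have int: "integrable S (\<lambda>z. \<bar>\<tau> z - d\<bar> powr p * w z)" if "deviation d < top" for d
    using that w_bounds unfolding deviation_surface by (intro integrableI_nonneg) auto
  have i0: "integrable S (\<lambda>z. \<bar>\<tau> z\<bar> powr p * w z)" using int[OF deviation_zero_finite] by simp
  have ic: "integrable S (\<lambda>z. \<bar>\<tau> z - c\<bar> powr p * w z)" using int False by (simp add: less_top)
  have iw: "integrable S w"
    using total_weight_finite w_bounds by (intro integrableI_nonneg) (auto simp: total_weight_def nn_integral_S)
  have ib: "integrable S (\<lambda>z. w z + \<bar>\<tau> z\<bar> powr p * w z)" using iw i0 by simp
  have "integrable S (\<lambda>z. \<bar>\<tau> z\<bar> powr (p - 2) * \<tau> z * w z)"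
  proof (rule Bochner_Integration.integrable_bound[OF ib])
    show "AE z in S. norm (\<bar>\<tau> z\<bar> powr (p - 2) * \<tau> z * w z) \<le> norm (w z + \<bar>\<tau> z\<bar> powr p * w z)"
    proof (rule AE_I2)
      fix z
      have "\<bar>\<bar>\<tau> z\<bar> powr (p - 2) * \<tau> z\<bar> \<le> 1 + \<bar>\<tau> z\<bar> powr p"
      proof (cases "\<tau> z = 0")
        case nz: False
        have "\<bar>\<bar>\<tau> z\<bar> powr (p - 2) * \<tau> z\<bar> = \<bar>\<tau> z\<bar> powr (p - 2) * \<bar>\<tau> z\<bar> powr 1"
          using nz by (simp add: abs_mult)
        also have "\<dots> = \<bar>\<tau> z\<bar> powr (p - 1)" unfolding powr_add[symmetric] by simp
        also have "\<dots> \<le> 1 + \<bar>\<tau> z\<bar> powr p"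
        proof (cases "\<bar>\<tau> z\<bar> \<le> 1")
          case True
          then show ?thesis using p powr_le1[of "p - 1" "\<bar>\<tau> z\<bar>"] by (simp add: add_increasing2)
        next
          case False
          then have "\<bar>\<tau> z\<bar> powr (p - 1) \<le> \<bar>\<tau> z\<bar> powr p" by (intro powr_mono) auto
          then show ?thesis by linarith
        qed
        finally show ?thesis .
      qed simp
      from mult_right_mono[OF this w_bounds(1)[of z]]
      show "norm (\<bar>\<tau> z\<bar> powr (p - 2) * \<tau> z * w z) \<le> norm (w z + \<bar>\<tau> z\<bar> powr p * w z)"
        using w_bounds(1)[of z] by (simp add: abs_mult distrib_right)
    qed
  qed (intro borel_measurable_times powr_real_measurable borel_measurable_abs borel_measurable_const
      \<tau>_measurable w_measurable_S)
  note iff = this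
  have "(LINT z|S. \<bar>\<tau> z\<bar> powr p * w z)
      \<le> (LINT z|S. \<bar>\<tau> z - c\<bar> powr p * w z + (p * c) * (\<bar>\<tau> z\<bar> powr (p - 2) * \<tau> z * w z))"
  proof (rule integral_mono)
    fix z
    show "\<bar>\<tau> z\<bar> powr p * w z \<le> \<bar>\<tau> z - c\<bar> powr p * w z + (p * c) * (\<bar>\<tau> z\<bar> powr (p - 2) * \<tau> z * w z)"
      using mult_right_mono[OF powr_abs_tangent[OF p, of "\<tau> z" c] w_bounds(1)[of z]]
      by (simp add: algebra_simps)
  qed (use i0 ic iff in auto)
  also have "\<dots> = (LINT z|S. \<bar>\<tau> z - c\<bar> powr p * w z)"
    using ic iff cond by simp
  finally have "ennreal (LINT z|S. \<bar>\<tau> z\<bar> powr p * w z) \<le> ennreal (LINT z|S. \<bar>\<tau> z - c\<bar> powr p * w z)"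
    by (rule ennreal_leI)
  then show ?thesis
    unfolding deviation_surface using w_bounds
    by (simp add: nn_integral_eq_integral[OF i0] nn_integral_eq_integral[OF ic])
qed simp

text \<open>The value \<open>|c|\<^sup>p\<close> is its own weighted mean over the boundary, and is bounded there by
  \<open>2\<^sup>p (|\<tau> - c|\<^sup>p + |\<tau>|\<^sup>p)\<close>; by minimality the second term is no larger in the mean than the
  first.\<close>

lemma poincare_slack:
  assumes cond: "(LINT x|S. \<bar>\<tau> x\<bar> powr (p - 2) * \<tau> x * w x) = 0" and \<eta>: "0 < \<eta>"
  shows "p_int u_ext \<Omega> \<le> poincare_const * (p_int grad_ext \<Omega> + ennreal \<eta>)"
proof -
  let ?S = "p_int grad_ext \<Omega> + ennreal \<eta>" and ?P = "ennreal (2 powr p)"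
  have factor: "k * (l * s + s) = (k * (l + 1)) * s" for k l s :: ennreal
    by (simp add: algebra_simps)
  obtain c where c: "p_int (\<lambda>x. u_ext x - c) B \<le> ball_const * ?S" using ball_estimate[OF \<eta>] by blast
  have "p_int (\<lambda>x. u_ext x - c) \<Omega> \<le> domain_const * (p_int (\<lambda>x. u_ext x - c) B + ?S)"
    using domain_estimate[OF \<eta>, of c] by (simp add: add.assoc)
  also have "\<dots> \<le> domain_const * (ball_const * ?S + ?S)" by (intro mult_left_mono add_right_mono c) simp
  finally have d: "p_int (\<lambda>x. u_ext x - c) \<Omega> \<le> domain_poincare_const * ?S"
    unfolding factor domain_poincare_const_def .
  have "deviation c \<le> boundary_const * (p_int (\<lambda>x. u_ext x - c) \<Omega> + ?S)"
    using trace_estimate[OF \<eta>, of c] by (simp add: add.assoc)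
  also have "\<dots> \<le> boundary_const * (domain_poincare_const * ?S + ?S)" by (intro mult_left_mono add_right_mono d) simp
  finally have t: "deviation c \<le> trace_poincare_const * ?S"
    unfolding factor trace_poincare_const_def .
  have t0: "deviation 0 \<le> trace_poincare_const * ?S" by (rule order_trans[OF deviation_zero_minimal[OF cond] t])
  have "ennreal (\<bar>c\<bar> powr p) * total_weight = (\<integral>\<^sup>+z. ennreal (norm c powr p) * ennreal (w z) \<partial>S)"
    using w_measurable_S by (simp add: total_weight_def nn_integral_S[symmetric] nn_integral_cmult)
  also have "\<dots> \<le> ?P * ((\<integral>\<^sup>+z. ennreal (norm (\<tau> z - c) powr p) * ennreal (w z) \<partial>S)
      + (\<integral>\<^sup>+z. ennreal (norm (\<tau> z) powr p) * ennreal (w z) \<partial>S))"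
    using \<tau>_measurable w_measurable_S by (intro nn_integral_norm_powr_le) auto
  also have "\<dots> = ?P * (deviation c + deviation 0)"
    using w_bounds by (simp add: deviation_surface ennreal_mult)
  also have "\<dots> \<le> ?P * (trace_poincare_const * ?S + trace_poincare_const * ?S)" by (intro mult_left_mono add_mono t t0) simp
  finally have "ennreal (\<bar>c\<bar> powr p) * total_weight / total_weight \<le> ?P * (trace_poincare_const * ?S + trace_poincare_const * ?S) / total_weight"
    by (rule divide_right_mono_ennreal)
  moreover have "ennreal (\<bar>c\<bar> powr p) * total_weight / total_weight = ennreal (\<bar>c\<bar> powr p)"
    using total_weight_pos total_weight_finite by (intro mult_divide_eq_ennreal) auto
  moreover have "k * (l * s + l * s) / d = (k * (l + l)) / d * s" for k l s d :: ennreal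
  proof -
    have "(k * (l + l)) / d * s = (k * (l + l)) * s / d"
      by (simp add: ennreal_divide_times ennreal_times_divide)
    also have "(k * (l + l)) * s = k * (l * s + l * s)" by (simp add: algebra_simps)
    finally show ?thesis by simp
  qed
  ultimately have cW: "ennreal (\<bar>c\<bar> powr p) \<le> (?P * (trace_poincare_const + trace_poincare_const)) / total_weight * ?S"
    by simp
  have const: "p_int (\<lambda>_. c) \<Omega> = ennreal (\<bar>c\<bar> powr p) * emeasure lborel \<Omega>"
    unfolding p_int_lborel using borel_open[OF open_\<Omega>] by (simp add: nn_integral_cmult_indicator)
  have "p_int u_ext \<Omega> \<le> ?P * (p_int (\<lambda>x. c - u_ext x) \<Omega> + p_int (\<lambda>_. c) \<Omega>)"
    using u_ext_measurable borel_open[OF open_\<Omega>] by (intro p_int_triangle) auto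
  also have "\<dots> \<le> ?P * (domain_poincare_const * ?S + ((?P * (trace_poincare_const + trace_poincare_const)) / total_weight * ?S) * emeasure lborel \<Omega>)"
    unfolding const using d p_int_minus_commute[of "\<lambda>_. c" u_ext]
    by (intro mult_left_mono add_mono mult_right_mono cW) simp_all
  also have "\<dots> = poincare_const * ?S"
  proof -
    have "k * (l * s + (x * s) * v) = (k * (l + x * v)) * s" for k l s x v :: ennreal
      by (simp add: algebra_simps)
    then show ?thesis unfolding poincare_const_def .
  qed
  finally show ?thesis .
qed

lemma poincare_Lp:
  assumes cond: "(LINT x|S. \<bar>\<tau> x\<bar> powr (p - 2) * \<tau> x * w x) = 0"
  shows "Lp_norm p \<Omega> u \<le> (enn2real poincare_const + 1) powr (1 / p) * Lp_norm p \<Omega> (weak_grad \<Omega> u)"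
proof -
  let ?k = "enn2real poincare_const + 1"
  let ?I = "LINT x|lebesgue_on \<Omega>. norm (u x) powr p"
  let ?J = "LINT x|lebesgue_on \<Omega>. norm (weak_grad \<Omega> u x) powr p"
  have k: "0 < ?k" by (simp add: add_nonneg_pos)
  have IJ: "0 \<le> ?I" "0 \<le> ?J" by simp_all
  have ck: "poincare_const \<le> ennreal ?k"
    using poincare_const_finite by (cases poincare_const) (auto intro: ennreal_leI)
  have "?I \<le> ?k * ?J + e" if e: "0 < e" for e
  proof -
    have "ennreal ?I \<le> poincare_const * (ennreal ?J + ennreal (e / ?k))"
      using poincare_slack[OF cond, of "e / ?k"] e k unfolding p_int_Lp by simp
    also have "\<dots> \<le> ennreal ?k * (ennreal ?J + ennreal (e / ?k))" by (intro mult_right_mono ck) simp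
    also have "\<dots> = ennreal (?k * (?J + e / ?k))"
      using k e IJ by (simp add: ennreal_mult)
    finally have "?I \<le> ?k * (?J + e / ?k)" using k e IJ by (simp add: ennreal_le_iff)
    then show ?thesis using k by (simp add: distrib_left)
  qed
  then have "?I \<le> ?k * ?J" by (rule field_le_epsilon)
  then have "?I powr (1 / p) \<le> (?k * ?J) powr (1 / p)" using IJ p by (intro powr_mono2) auto
  also have "\<dots> = ?k powr (1 / p) * ?J powr (1 / p)" using k IJ by (simp add: powr_mult)
  finally show ?thesis by (simp add: Lp_norm_def)
qed

end

theorem theorem2p4:
  fixes \<gamma> p :: real and n :: nat
  assumes "n = CARD('m::finite) + 1"
    and "real n < \<gamma>"
    and "1 < p"
  shows "\<exists>C>0. \<forall>u \<in> W1p p (cusp_domain \<gamma> :: ((real ^ 'm) \<times> real) set). \<forall>\<tau>.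
           is_trace_off 0 p (cusp_domain \<gamma>) u \<tau> \<and>
           (LINT x|surface_measure (cusp_domain \<gamma>).
              \<bar>\<tau> x\<bar> powr (p - 2) * \<tau> x * cusp_weight \<gamma> x) = 0 \<longrightarrow>
           Lp_norm p (cusp_domain \<gamma>) u \<le> C * Lp_norm p (cusp_domain \<gamma>) (weak_grad (cusp_domain \<gamma>) u)"
proof -
  interpret cusp \<gamma> "(\<gamma> - 1) / real CARD('m)" p "TYPE('m)"
    by standard (use assms in auto)
  show ?thesis
  proof (intro exI[of _ "(enn2real poincare_const + 1) powr (1 / p)"] conjI ballI allI impI)
    show "0 < (enn2real poincare_const + 1) powr (1 / p)"
      by (simp add: add_nonneg_eq_0_iff)
    fix u \<tau>
    assume "u \<in> W1p p \<Omega>" and h: "is_trace_off 0 p \<Omega> u \<tau> \<and>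
      (LINT x|surface_measure \<Omega>. \<bar>\<tau> x\<bar> powr (p - 2) * \<tau> x * w x) = 0"
    then interpret cusp_trace \<gamma> "(\<gamma> - 1) / real CARD('m)" p "TYPE('m)" u \<tau>
      by unfold_locales auto
    show "Lp_norm p \<Omega> u \<le> (enn2real poincare_const + 1) powr (1 / p) * Lp_norm p \<Omega> (weak_grad \<Omega> u)"
      using h by (intro poincare_Lp) blast
  qed
qed

end
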